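(* Let $X=(x_0,x_1)$ be a bounded interval, let $\zeta\in C_{{\rm pw},+}(X)$ and set $\alpha=-\bigl(\frac12\log\zeta\bigr)'$ (distributional derivative). Suppose $\zeta\notin C_+(X)$, and denote by $y_j$ $(1\le j\le n)$ the points of discontinuity of $\zeta$ in their natural order $x_0<y_1<\cdots<y_n<x_1$, with $y_0=x_0$ and $y_{n+1}=x_1$. Write $$r_j=\frac{\zeta(y_j-)-\zeta(y_j+)}{\zeta(y_j-)+\zeta(y_j+)}\qquad(1\le j\le n).$$ For $1\le j\le n+1$ set $\alpha_j=\alpha|_{(y_{j-1},y_j)}$, $\mu_j=e^{2i(y_j-y_{j-1})\omega}$, $$\tilde\mu_j=\mu_j\frac{\overline{E_{\alpha_j}^{(y_{j-1},y_j)}(\omega)+E_{-\alpha_j}^{(y_{j-1},y_j)}(\omega)}}{E_{\alpha_j}^{(y_{j-1},y_j)}(\omega)+E_{-\alpha_j}^{(y_{j-1},y_j)}(\omega)},\qquad \rho_j=\overline{\mu_j}\,\frac{E_{\alpha_j}^{(y_{j-1},y_j)}(\omega)-E_{-\alpha_j}^{(y_{j-1},y_j)}(\omega)}{\overline{E_{\alpha_j}^{(y_{j-1},y_j)}(\omega)+E_{-\alpha_j}^{(y_{j-1},y_j)}(\omega)}}.$$ Then, for $\xi\in\mathbb{D}$, $g_\zeta^\omega(\xi)$ is $C^\infty$ with respect to $\omega$, and: (i) $g_\zeta^\omega=\varphi_{\tilde\mu_1,\rho_1}\circ\varphi_{1,r_1}\circ\cdots\circ\varphi_{\tilde\mu_n,\rho_n}\circ\varphi_{1,r_n}\circ\varphi_{\tilde\mu_{n+1},\rho_{n+1}}$;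 (ii) $g_\zeta^\omega(\xi)\sim\varphi_{\mu_1,r_1}\circ\cdots\circ\varphi_{\mu_n,r_n}(\mu_{n+1}\xi)$ as $|\omega|\to\infty$, i.e. the difference of the two sides tends to $0$.
   Context: $\mathbb{D}$ is the open unit disk; $\varphi_{\mu,\rho}(\xi)=\mu\frac{\xi+\rho}{1+\bar\rho\xi}$ for $\mu\in S^1$ (unit circle) and $\rho\in\mathbb{D}$. A function on $X$ is regulated if it is a uniform limit of step functions (piecewise-constant with finitely many discontinuities); $\mathrm{Reg}_+(X)$ is the set of regulated $f$ with $f>\varepsilon$ on $X$ for some $\varepsilon>0$. $C_+(X)$ is the set of absolutely continuous $f\in\mathrm{Reg}_+(X)$. $C_{{\rm pw},+}(X)$ is the set of $f\in\mathrm{Reg}_+(X)$ for which there is a finite partition of $X$ such that $f$ is absolutely continuous on each open subinterval of the partition. Functions equal a.e. are identified, and representatives without removable discontinuities are used. One-sided limits are written $f(x\pm)$. On each $(y_{j-1},y_j)$, $\alpha_j=-\zeta'/(2\zeta)$ is a real-valued $L^1$ function. Harmonic exponential: for real-valued $\beta\in L^1((a,b))$ and $\omega\in\mathbb{R}$, $$E^{(a,b)}_\beta(\omega)=1+\sum_{j=1}^\infty\ \int\limits_{a<s_1<\cdots<s_j<b}\exp\Bigl(2i\omega\sum_{\nu=1}^j(-1)^{j-\nu}(s_\nu-a)\Bigr)\prod_{\nu=1}^j\beta(s_\nu)\,ds_1\cdots ds_j .$$ Generalized reflection coefficient: for $\omega\in\mathbb{R}\setminus\{0\}$ put $u^{\ell}=\frac12\bigl(u-\frac{1}{i\omega}u'\bigr)$,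 $u^{\rm r}=\frac12\bigl(u+\frac{1}{i\omega}u'\bigr)$. For $\zeta\in\mathrm{Reg}_+(X)$, for all $\omega\in\mathbb{R}$ outside a countable set (containing $0$) and every $\xi\in\mathbb{D}$, the problem $(\zeta u')'+\omega^2\zeta u=0$ on $X$, $u^{\rm r}(x_0+)=1$, $u^{\ell}(x_1-)=\xi u^{\rm r}(x_1-)$ has a unique solution $u$ with $u$ and $\zeta u'$ absolutely continuous (equation holding a.e.); $g_\zeta^\omega(\xi)=u^{\ell}(x_0+)$. As a function of $\omega$, $g_\zeta^\omega$ is regarded as defined almost everywhere, and identities, asymptotics and smoothness in $\omega$ are understood up to equality almost everywhere. *)

theory Defs
  imports "HOL-Analysis.Analysis"
begin

section \<open>Absolutely continuous and regulated functions on an open interval\<close>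

text \<open>The finite families of non-overlapping compact subintervals of \<open>S\<close> are encoded as divisions
  of subsets of \<open>S\<close>.\<close>

definition absolutely_continuous_on :: "real set \<Rightarrow> (real \<Rightarrow> 'a::real_normed_vector) \<Rightarrow> bool" where
  "absolutely_continuous_on S f \<longleftrightarrow>
     (\<forall>\<epsilon>>0. \<exists>\<delta>>0. \<forall>D T. D division_of T \<and> T \<subseteq> S \<and> (\<Sum>K\<in>D. measure lborel K) < \<delta> \<longrightarrow>
        (\<Sum>K\<in>D. norm (f (Sup K) - f (Inf K))) < \<epsilon>)"

definition interval_partition :: "real \<Rightarrow> real \<Rightarrow> nat \<Rightarrow> (nat \<Rightarrow> real) \<Rightarrow> bool" where
  "interval_partition x0 x1 N p \<longleftrightarrow> p 0 = x0 \<and> p N = x1 \<and> (\<forall>i<N. p i < p (Suc i))"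

definition step_function :: "real \<Rightarrow> real \<Rightarrow> (real \<Rightarrow> real) \<Rightarrow> bool" where
  "step_function x0 x1 s \<longleftrightarrow>
     (\<exists>N p. interval_partition x0 x1 N p \<and> (\<forall>i<N. s constant_on {p i<..<p (Suc i)}))"

definition regulated :: "real \<Rightarrow> real \<Rightarrow> (real \<Rightarrow> real) \<Rightarrow> bool" where
  "regulated x0 x1 f \<longleftrightarrow>
     (\<exists>s. (\<forall>n. step_function x0 x1 (s n)) \<and> uniform_limit {x0<..<x1} s f sequentially)"

definition Reg_plus :: "real \<Rightarrow> real \<Rightarrow> (real \<Rightarrow> real) set" where
  "Reg_plus x0 x1 = {f. regulated x0 x1 f \<and> (\<exists>\<epsilon>>0. \<forall>x\<in>{x0<..<x1}. f x > \<epsilon>)}"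

definition C_plus :: "real \<Rightarrow> real \<Rightarrow> (real \<Rightarrow> real) set" where
  "C_plus x0 x1 = {f \<in> Reg_plus x0 x1. absolutely_continuous_on {x0<..<x1} f}"

definition C_pw_plus :: "real \<Rightarrow> real \<Rightarrow> (real \<Rightarrow> real) set" where
  "C_pw_plus x0 x1 = {f \<in> Reg_plus x0 x1.
     \<exists>N p. interval_partition x0 x1 N p \<and>
       (\<forall>i<N. absolutely_continuous_on {p i<..<p (Suc i)} f)}"

text \<open>The representative of an almost-everywhere class is fixed by this condition up to its values
  at the jumps, which are immaterial below.\<close>

definition no_removable_discontinuities :: "real set \<Rightarrow> (real \<Rightarrow> real) \<Rightarrow> bool" where
  "no_removable_discontinuities S f \<longleftrightarrow> (\<forall>x\<in>S. \<forall>l. (f \<longlongrightarrow> l) (at x) \<longrightarrow> isCont f x)"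

definition smooth :: "(real \<Rightarrow> complex) \<Rightarrow> bool" where
  "smooth f \<longleftrightarrow>
     (\<exists>D. D (0::nat) = f \<and> (\<forall>k x. (D k has_vector_derivative D (Suc k) x) (at x)))"


section \<open>Disk automorphisms\<close>

definition moebius :: "complex \<Rightarrow> complex \<Rightarrow> complex \<Rightarrow> complex" where
  "moebius \<mu> \<rho> \<xi> = \<mu> * ((\<xi> + \<rho>) / (1 + cnj \<rho> * \<xi>))"


section \<open>Harmonic exponential\<close>

text \<open>Lebesgue rather than Borel measure on the factors, so that every \<open>L\<^sup>1\<close> function \<open>\<beta>\<close>
  has a measurable integrand.\<close>

definition harmonic_exp_term ::
    "real \<Rightarrow> real \<Rightarrow> (real \<Rightarrow> real) \<Rightarrow> real \<Rightarrow> nat \<Rightarrow> complex" where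
  "harmonic_exp_term a b \<beta> \<omega> j =
     set_lebesgue_integral (PiM {1..j} (\<lambda>_. lebesgue))
       {s. (\<forall>\<nu>\<in>{1..j}. a < s \<nu> \<and> s \<nu> < b) \<and> (\<forall>\<nu>\<in>{1..<j}. s \<nu> < s (Suc \<nu>))}
       (\<lambda>s. exp (2 * \<i> * of_real \<omega> * of_real (\<Sum>\<nu>=1..j. (- 1) ^ (j - \<nu>) * (s \<nu> - a))) *
            of_real (\<Prod>\<nu>=1..j. \<beta> (s \<nu>)))"

definition harmonic_exp :: "real \<Rightarrow> real \<Rightarrow> (real \<Rightarrow> real) \<Rightarrow> real \<Rightarrow> complex" where
  "harmonic_exp a b \<beta> \<omega> = 1 + (\<Sum>j. harmonic_exp_term a b \<beta> \<omega> (Suc j))"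


section \<open>Generalized reflection coefficient\<close>

definition left_part :: "real \<Rightarrow> (real \<Rightarrow> complex) \<Rightarrow> (real \<Rightarrow> complex) \<Rightarrow> real \<Rightarrow> complex" where
  "left_part \<omega> u u' x = (1/2) * (u x - 1 / (\<i> * of_real \<omega>) * u' x)"

definition right_part :: "real \<Rightarrow> (real \<Rightarrow> complex) \<Rightarrow> (real \<Rightarrow> complex) \<Rightarrow> real \<Rightarrow> complex" where
  "right_part \<omega> u u' x = (1/2) * (u x + 1 / (\<i> * of_real \<omega>) * u' x)"

text \<open>The derivative of an absolutely continuous \<open>u\<close> exists almost everywhere only; \<open>u'\<close> is the
  representative for which \<open>\<zeta> u'\<close> is absolutely continuous, and the one-sided limits of \<open>u'\<close> are
  limits of this representative. It is determined by \<open>u\<close> on the interval.\<close>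

definition wave_solution ::
    "(real \<Rightarrow> real) \<Rightarrow> real \<Rightarrow> real \<Rightarrow> real \<Rightarrow> (real \<Rightarrow> complex) \<Rightarrow> (real \<Rightarrow> complex) \<Rightarrow> bool" where
  "wave_solution \<zeta> x0 x1 \<omega> u u' \<longleftrightarrow>
     absolutely_continuous_on {x0<..<x1} u \<and>
     absolutely_continuous_on {x0<..<x1} (\<lambda>x. of_real (\<zeta> x) * u' x) \<and>
     (AE x in lborel. x \<in> {x0<..<x1} \<longrightarrow> (u has_vector_derivative u' x) (at x)) \<and>
     (AE x in lborel. x \<in> {x0<..<x1} \<longrightarrow>
        ((\<lambda>t. of_real (\<zeta> t) * u' t) has_vector_derivative - (of_real (\<omega>\<^sup>2 * \<zeta> x) * u x)) (at x))"

definition reflection_problem ::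
    "(real \<Rightarrow> real) \<Rightarrow> real \<Rightarrow> real \<Rightarrow> real \<Rightarrow> complex \<Rightarrow>
     (real \<Rightarrow> complex) \<Rightarrow> (real \<Rightarrow> complex) \<Rightarrow> bool" where
  "reflection_problem \<zeta> x0 x1 \<omega> \<xi> u u' \<longleftrightarrow>
     wave_solution \<zeta> x0 x1 \<omega> u u' \<and>
     (right_part \<omega> u u' \<longlongrightarrow> 1) (at_right x0) \<and>
     (\<exists>l. (right_part \<omega> u u' \<longlongrightarrow> l) (at_left x1) \<and>
          (left_part \<omega> u u' \<longlongrightarrow> \<xi> * l) (at_left x1))"

text \<open>Unspecified at those \<open>\<omega>\<close> (in particular \<open>\<omega> = 0\<close>) where the problem is not well posed.\<close>

definition reflection_coeff ::
    "(real \<Rightarrow> real) \<Rightarrow> real \<Rightarrow> real \<Rightarrow> real \<Rightarrow> complex \<Rightarrow> complex" where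
  "reflection_coeff \<zeta> x0 x1 \<omega> \<xi> =
     (THE w. \<exists>u u'. reflection_problem \<zeta> x0 x1 \<omega> \<xi> u u' \<and>
        (\<forall>v v'. reflection_problem \<zeta> x0 x1 \<omega> \<xi> v v' \<longrightarrow> (\<forall>x\<in>{x0<..<x1}. v x = u x)) \<and>
        (left_part \<omega> u u' \<longlongrightarrow> w) (at_right x0))"


section \<open>Parameters of the factorization\<close>

definition jump_coeff :: "(real \<Rightarrow> real) \<Rightarrow> real \<Rightarrow> real" where
  "jump_coeff \<zeta> y =
     (Lim (at_left y) \<zeta> - Lim (at_right y) \<zeta>) / (Lim (at_left y) \<zeta> + Lim (at_right y) \<zeta>)"

text \<open>Between consecutive jumps \<open>\<zeta>\<close> is absolutely continuous, so there the distributional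
  derivative of \<open>- ln \<zeta> / 2\<close> is given by the pointwise derivative, which exists almost everywhere.\<close>

definition alpha :: "(real \<Rightarrow> real) \<Rightarrow> real \<Rightarrow> real" where
  "alpha \<zeta> x = - deriv \<zeta> x / (2 * \<zeta> x)"

definition E_plus :: "(real \<Rightarrow> real) \<Rightarrow> (nat \<Rightarrow> real) \<Rightarrow> nat \<Rightarrow> real \<Rightarrow> complex" where
  "E_plus \<zeta> y j \<omega> = harmonic_exp (y (j - 1)) (y j) (alpha \<zeta>) \<omega>"

definition E_minus :: "(real \<Rightarrow> real) \<Rightarrow> (nat \<Rightarrow> real) \<Rightarrow> nat \<Rightarrow> real \<Rightarrow> complex" where
  "E_minus \<zeta> y j \<omega> = harmonic_exp (y (j - 1)) (y j) (\<lambda>s. - alpha \<zeta> s) \<omega>"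

definition mu :: "(nat \<Rightarrow> real) \<Rightarrow> nat \<Rightarrow> real \<Rightarrow> complex" where
  "mu y j \<omega> = exp (2 * \<i> * of_real ((y j - y (j - 1)) * \<omega>))"

definition mu_tilde :: "(real \<Rightarrow> real) \<Rightarrow> (nat \<Rightarrow> real) \<Rightarrow> nat \<Rightarrow> real \<Rightarrow> complex" where
  "mu_tilde \<zeta> y j \<omega> =
     mu y j \<omega> * (cnj (E_plus \<zeta> y j \<omega> + E_minus \<zeta> y j \<omega>) / (E_plus \<zeta> y j \<omega> + E_minus \<zeta> y j \<omega>))"

definition rho :: "(real \<Rightarrow> real) \<Rightarrow> (nat \<Rightarrow> real) \<Rightarrow> nat \<Rightarrow> real \<Rightarrow> complex" where
  "rho \<zeta> y j \<omega> =
     cnj (mu y j \<omega>) *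
     ((E_plus \<zeta> y j \<omega> - E_minus \<zeta> y j \<omega>) / cnj (E_plus \<zeta> y j \<omega> + E_minus \<zeta> y j \<omega>))"

end

theory Submission
  imports Defs "HOL-Complex_Analysis.Complex_Analysis"
begin

text \<open>Between two consecutive jumps, the wave equation becomes, in terms of its left and right going
  components scaled by \<open>sqrt \<zeta>\<close> and seen in a rotating frame, a first order system whose coefficients
  are \<open>\<plusminus>\<alpha>\<close> times a phase. The integral equation of the harmonic exponentials says exactly that they
  solve this system. Solving it backwards from the right end of the piece therefore turns the
  reflection ratio there into a disk automorphism of it; the continuity of \<open>u\<close> and \<open>\<zeta> u'\<close> across a
  jump contributes the automorphism with parameter \<open>r\<^sub>j\<close>, and (i) follows by composition. The harmonic
  exponentials are restrictions of entire functions of \<open>\<omega>\<close>, hence the smoothness, and tend to 1 by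
  the Riemann--Lebesgue lemma and dominated convergence; the automorphisms in between are uniformly
  Lipschitz on the disk, hence (ii).\<close>

section \<open>Absolutely continuous functions\<close>

text \<open>Between jumps \<zeta> is merely absolutely continuous, so \<alpha> is merely integrable
  and all differential equations hold almost everywhere; moreover \<open>alpha\<close> is built from
  the pointwise \<open>deriv\<close>. Hence the long preparation: absolutely continuous functions
  are differentiable almost everywhere and are the integrals of their derivatives.
  \<open>ac_primitive\<close> packages this. The equation of a harmonic exponential is antilinear in
  it. For the half sum P and half difference Q of the exponentials of \<alpha> and -\<alpha> it
  yields the conserved quantity |P|^2 - |Q|^2 = 1. This one identity makes the transfer matrices
  invertible, preserves the disk, and keeps every denominator nonzero at every real frequency, so
  that 0 is the only frequency to exclude. The boundary problem is solved by shooting from the right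
  end, where the ratio \<xi> fixes the data up to a factor. The right going part cannot vanish at
  the left end, and dividing by it gives the normalisation. Conjugated exponentials remain analytic
  in the frequency because, at real \<omega>, conjugation amounts to replacing \<omega> by
  -\<omega>.\<close>

definition nonoverlapping :: "real set \<Rightarrow> 'i set \<Rightarrow> ('i \<Rightarrow> real) \<Rightarrow> ('i \<Rightarrow> real) \<Rightarrow> bool" where
  "nonoverlapping S I c d \<longleftrightarrow> finite I \<and> (\<forall>i\<in>I. c i \<le> d i \<and> {c i..d i} \<subseteq> S) \<and>
     disjoint_family_on (\<lambda>i. {c i<..<d i}) I"

lemma greaterThanLessThan_disjoint_iff:
  fixes a b c d :: real
  shows "{a<..<b} \<inter> {c<..<d} = {} \<longleftrightarrow> b \<le> a \<or> d \<le> c \<or> b \<le> c \<or> d \<le> a"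
proof -
  have "{a<..<b} \<inter> {c<..<d} = {max a c<..<min b d}" by auto
  then show ?thesis by (simp only: greaterThanLessThan_empty_iff) linarith
qed

lemma nonoverlappingD:
  assumes "nonoverlapping S I c d" "i \<in> I"
  shows "c i \<le> d i" "c i \<in> S" "d i \<in> S" "{c i..d i} \<subseteq> S"
proof -
  show 1: "c i \<le> d i" "{c i..d i} \<subseteq> S" using assms by (auto simp: nonoverlapping_def)
  then have "c i \<in> {c i..d i}" "d i \<in> {c i..d i}" by auto
  with 1 show "c i \<in> S" "d i \<in> S" by blast+
qed

text \<open>The definition speaks of divisions, that is, of sets of intervals; indexed families
  survive maps that merge intervals or shrink them to points. Degenerate members are dropped before
  the division is formed, since several of them may coincide and they contribute nothing to either
  sum.\<close>

lemma absolutely_continuous_on_families: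
  fixes f :: "real \<Rightarrow> 'a::real_normed_vector"
  assumes "absolutely_continuous_on S f" "0 < \<epsilon>"
  obtains \<delta> where "0 < \<delta>"
    "\<And>(I :: 'i set) c d. nonoverlapping S I c d \<Longrightarrow> (\<Sum>i\<in>I. d i - c i) < \<delta> \<Longrightarrow>
        (\<Sum>i\<in>I. norm (f (d i) - f (c i))) < \<epsilon>"
proof -
  obtain \<delta> where \<delta>: "\<delta> > 0" "\<forall>D T. D division_of T \<and> T \<subseteq> S \<and> (\<Sum>K\<in>D. measure lborel K) < \<delta> \<longrightarrow>
        (\<Sum>K\<in>D. norm (f (Sup K) - f (Inf K))) < \<epsilon>"
    using mp[OF spec[OF assms(1)[unfolded absolutely_continuous_on_def]] assms(2)] by (elim exE conjE)
  have "(\<Sum>i\<in>I. norm (f (d i) - f (c i))) < \<epsilon>"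
    if I: "nonoverlapping S I c d" and small: "(\<Sum>i\<in>I. d i - c i) < \<delta>" for I :: "'i set" and c d
  proof -
    define J where "J = {i\<in>I. c i < d i}"
    define K where "K = (\<lambda>i. {c i..d i})"
    have fin: "finite J" "finite I" using I by (auto simp: J_def nonoverlapping_def)
    have sub: "K i \<subseteq> S" if "i \<in> J" for i
      using I that by (auto simp: J_def K_def nonoverlapping_def)
    have int: "interior (K i) \<inter> interior (K j) = {}" if "i \<in> J" "j \<in> J" "i \<noteq> j" for i j
      using I that by (simp add: J_def K_def nonoverlapping_def disjoint_family_on_def)
    have inj: "inj_on K J"
    proof (rule inj_onI, rule ccontr)
      fix i j assume "i \<in> J" "j \<in> J" "K i = K j" "i \<noteq> j"
      then have "interior (K i) = {}" using int[of i j] by auto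
      then show False using \<open>i \<in> J\<close> by (simp add: J_def K_def)
    qed
    have div: "(K ` J) division_of (\<Union>(K ` J))"
      unfolding division_of_def
    proof (intro conjI ballI impI)
      fix X assume "X \<in> K ` J"
      then obtain i where i: "i \<in> J" "X = K i" by auto
      show "X \<noteq> {}" using i by (auto simp: J_def K_def)
      show "\<exists>a b. X = cbox a b" using i by (auto simp: K_def)
      show "X \<subseteq> \<Union> (K ` J)" using i by auto
      fix Y assume "Y \<in> K ` J" "X \<noteq> Y"
      then obtain j where "j \<in> J" "Y = K j" "i \<noteq> j" using i by auto
      then show "interior X \<inter> interior Y = {}" using int i by auto
    qed (use fin in auto)
    have "(\<Sum>X\<in>K ` J. measure lborel X) = (\<Sum>i\<in>J. d i - c i)"
      by (subst sum.reindex[OF inj]) (auto intro!: sum.cong simp: K_def J_def)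
    also have "\<dots> \<le> (\<Sum>i\<in>I. d i - c i)"
      by (intro sum_mono2) (use I in \<open>auto simp: J_def nonoverlapping_def\<close>)
    finally have "(\<Sum>X\<in>K ` J. norm (f (Sup X) - f (Inf X))) < \<epsilon>"
      using small sub div by (intro mp[OF spec[OF spec[OF \<delta>(2)]]]) auto
    also have "(\<Sum>X\<in>K ` J. norm (f (Sup X) - f (Inf X))) = (\<Sum>i\<in>J. norm (f (d i) - f (c i)))"
      by (subst sum.reindex[OF inj]) (auto intro!: sum.cong simp: K_def J_def)
    also have "\<dots> = (\<Sum>i\<in>I. norm (f (d i) - f (c i)))"
      proof (intro sum.mono_neutral_left ballI)
      fix i assume "i \<in> I - J"
      then have "c i = d i" using I by (force simp: J_def nonoverlapping_def)
      then show "norm (f (d i) - f (c i)) = 0" by simp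
    qed (use fin in \<open>auto simp: J_def\<close>)
    finally show ?thesis .
  qed
  with \<delta>(1) show thesis by (rule that)
qed

lemma division_of_nonoverlapping:
  fixes D :: "real set set"
  assumes D: "D division_of T" and T: "T \<subseteq> S"
  shows "\<And>K. K \<in> D \<Longrightarrow> K = {Inf K..Sup K} \<and> Inf K \<le> Sup K" and "nonoverlapping S D Inf Sup"
proof -
  have K: "K = {Inf K..Sup K} \<and> Inf K \<le> Sup K" if KD: "K \<in> D" for K
  proof -
    obtain a b where "K = cbox a b" "K \<noteq> {}" using division_ofD(3)[OF D KD] division_ofD(4)[OF D KD] by blast
    then show ?thesis by auto
  qed
  have "interior K = {Inf K<..<Sup K}" if "K \<in> D" for K
    using arg_cong[OF conjunct1[OF K[OF that]], of interior] by (simp only: interior_atLeastAtMost_real)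
  moreover have "{Inf K..Sup K} \<subseteq> S" if "K \<in> D" for K
    using conjunct1[OF K[OF that]] division_ofD(2)[OF D that] T by simp
  ultimately show "nonoverlapping S D Inf Sup"
    using division_ofD(1,5)[OF D] conjunct2[OF K]
    unfolding nonoverlapping_def disjoint_family_on_def by simp
  show "K = {Inf K..Sup K} \<and> Inf K \<le> Sup K" if "K \<in> D" for K by (rule K[OF that])
qed

text \<open>The index type is \<open>real set\<close> because a division is a family indexed by its
  own members, with \<open>Inf\<close> and \<open>Sup\<close> as end points.\<close>

lemma absolutely_continuous_onI:
  fixes f :: "real \<Rightarrow> 'a::real_normed_vector"
  assumes "\<And>\<epsilon>. 0 < \<epsilon> \<Longrightarrow> \<exists>\<delta>>0. \<forall>(I :: real set set) c d. nonoverlapping S I c d \<longrightarrow> (\<Sum>i\<in>I. d i - c i) < \<delta> \<longrightarrow>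
        (\<Sum>i\<in>I. norm (f (d i) - f (c i))) < \<epsilon>"
  shows "absolutely_continuous_on S f"
  unfolding absolutely_continuous_on_def
proof (intro allI impI)
  fix \<epsilon> :: real assume "\<epsilon> > 0"
  from assms[OF this] obtain \<delta> where \<delta>: "\<delta> > 0"
    "\<And>(I :: real set set) c d. nonoverlapping S I c d \<Longrightarrow> (\<Sum>i\<in>I. d i - c i) < \<delta> \<Longrightarrow>
        (\<Sum>i\<in>I. norm (f (d i) - f (c i))) < \<epsilon>" by metis
  have "(\<Sum>K\<in>D. norm (f (Sup K) - f (Inf K))) < \<epsilon>"
    if D: "D division_of T" and T: "T \<subseteq> S" and small: "(\<Sum>K\<in>D. measure lborel K) < \<delta>" for D T
  proof -
    note K = division_of_nonoverlapping(1)[OF D T]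
    have "nonoverlapping S D Inf Sup" by (rule division_of_nonoverlapping(2)[OF D T])
    moreover have "(\<Sum>K\<in>D. Sup K - Inf K) = (\<Sum>K\<in>D. measure lborel K)"
    proof (intro sum.cong refl)
      fix K assume "K \<in> D"
      from arg_cong[OF conjunct1[OF K[OF this]], of "measure lborel"] conjunct2[OF K[OF this]]
      show "Sup K - Inf K = measure lborel K" by simp
    qed
    ultimately show ?thesis using small by (intro \<delta>) auto
  qed
  then show "\<exists>\<delta>>0. \<forall>D T. D division_of T \<and> T \<subseteq> S \<and> (\<Sum>K\<in>D. measure lborel K) < \<delta> \<longrightarrow>
        (\<Sum>K\<in>D. norm (f (Sup K) - f (Inf K))) < \<epsilon>" using \<delta>(1) by blast
qed

lemma nonoverlapping_subset: "nonoverlapping S I c d \<Longrightarrow> S \<subseteq> T \<Longrightarrow> nonoverlapping T I c d"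
  by (fastforce simp: nonoverlapping_def)

lemma absolutely_continuous_on_subset:
  "absolutely_continuous_on T f \<Longrightarrow> S \<subseteq> T \<Longrightarrow> absolutely_continuous_on S f"
  unfolding absolutely_continuous_on_def by (meson order_trans)

text \<open>One estimate on increments serves sums, products, linear images, compositions and
  changes of representative.\<close>

lemma absolutely_continuous_on_dominated:
  fixes h :: "real \<Rightarrow> 'c::real_normed_vector" and f :: "real \<Rightarrow> 'a::real_normed_vector"
    and g :: "real \<Rightarrow> 'b::real_normed_vector"
  assumes f: "absolutely_continuous_on S f" and g: "absolutely_continuous_on S g"
    and dom: "\<And>x y. x \<in> S \<Longrightarrow> y \<in> S \<Longrightarrow> norm (h y - h x) \<le> K * (norm (f y - f x) + norm (g y - g x))"
  shows "absolutely_continuous_on S h"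
proof (rule absolutely_continuous_onI)
  fix \<epsilon> :: real assume "\<epsilon> > 0"
  \<comment> \<open>\<open>K\<close> may be zero or negative, but the tolerance is going to be
    divided by it.\<close>
  define K' where "K' = max K 1"
  have K': "K' > 0" "K \<le> K'" by (auto simp: K'_def)
  then have e: "\<epsilon> / (2 * K') > 0" using \<open>\<epsilon> > 0\<close> by simp
  obtain \<delta>1 where 1: "\<delta>1 > 0" "\<And>(I :: real set set) c d. nonoverlapping S I c d \<Longrightarrow> (\<Sum>i\<in>I. d i - c i) < \<delta>1 \<Longrightarrow>
        (\<Sum>i\<in>I. norm (f (d i) - f (c i))) < \<epsilon> / (2 * K')"
    using absolutely_continuous_on_families[OF f e] by blast
  obtain \<delta>2 where 2: "\<delta>2 > 0" "\<And>(I :: real set set) c d. nonoverlapping S I c d \<Longrightarrow> (\<Sum>i\<in>I. d i - c i) < \<delta>2 \<Longrightarrow>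
        (\<Sum>i\<in>I. norm (g (d i) - g (c i))) < \<epsilon> / (2 * K')"
    using absolutely_continuous_on_families[OF g e] by blast
  have "(\<Sum>i\<in>I. norm (h (d i) - h (c i))) < \<epsilon>"
    if I: "nonoverlapping S I c d" and small: "(\<Sum>i\<in>I. d i - c i) < min \<delta>1 \<delta>2" for I :: "real set set" and c d
  proof -
    have mem: "c i \<in> S" "d i \<in> S" if "i \<in> I" for i
      using nonoverlappingD[OF I that] by auto
    have "(\<Sum>i\<in>I. norm (h (d i) - h (c i))) \<le> (\<Sum>i\<in>I. K' * (norm (f (d i) - f (c i)) + norm (g (d i) - g (c i))))"
      by (intro sum_mono order.trans[OF dom] mult_right_mono K') (auto simp: mem)
    also have "\<dots> = K' * ((\<Sum>i\<in>I. norm (f (d i) - f (c i))) + (\<Sum>i\<in>I. norm (g (d i) - g (c i))))"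
      by (simp only: sum_distrib_left[symmetric] sum.distrib)
    also have "\<dots> < K' * (\<epsilon> / (2 * K') + \<epsilon> / (2 * K'))"
      using 1(2)[OF I] 2(2)[OF I] small K' by (intro mult_strict_left_mono add_strict_mono) auto
    also have "\<dots> = \<epsilon>" using K' by (simp add: field_simps)
    finally show ?thesis .
  qed
  then show "\<exists>\<delta>>0. \<forall>(I :: real set set) c d. nonoverlapping S I c d \<longrightarrow> (\<Sum>i\<in>I. d i - c i) < \<delta> \<longrightarrow>
        (\<Sum>i\<in>I. norm (h (d i) - h (c i))) < \<epsilon>"
    using 1(1) 2(1) by (intro exI[of _ "min \<delta>1 \<delta>2"]) auto
qed

lemma absolutely_continuous_on_lipschitz:
  fixes h :: "real \<Rightarrow> 'c::real_normed_vector"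
  assumes "\<And>x y. x \<in> S \<Longrightarrow> y \<in> S \<Longrightarrow> norm (h y - h x) \<le> K * \<bar>y - x\<bar>"
  shows "absolutely_continuous_on S h"
proof -
  have "absolutely_continuous_on S (\<lambda>x::real. x)"
  proof (rule absolutely_continuous_onI)
    fix \<epsilon> :: real assume "\<epsilon> > 0"
    have "(\<Sum>i\<in>I. norm (d i - c i)) = (\<Sum>i\<in>I. d i - c i)" if "nonoverlapping S I c d" for I :: "real set set" and c d
      using that by (intro sum.cong) (auto simp: nonoverlapping_def)
    then show "\<exists>\<delta>>0. \<forall>(I :: real set set) c d. nonoverlapping S I c d \<longrightarrow> (\<Sum>i\<in>I. d i - c i) < \<delta> \<longrightarrow>
        (\<Sum>i\<in>I. norm (d i - c i)) < \<epsilon>" using \<open>\<epsilon> > 0\<close> by (intro exI[of _ \<epsilon>]) simp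
  qed
  \<comment> \<open>The identity occupies both slots, hence half the constant.\<close>
  from absolutely_continuous_on_dominated[OF this this, of h "K/2"] assms show ?thesis by simp
qed

section \<open>Uniform continuity and extension to the closed interval\<close>

lemma absolutely_continuous_on_imp_uniformly_continuous_on:
  fixes f :: "real \<Rightarrow> 'a::real_normed_vector"
  assumes f: "absolutely_continuous_on S f" and S: "is_interval S"
  shows "uniformly_continuous_on S f"
  unfolding uniformly_continuous_on_def
proof (intro allI impI)
  fix e :: real assume "e > 0"
  obtain \<delta> where \<delta>: "\<delta> > 0" "\<And>(I :: unit set) c d. nonoverlapping S I c d \<Longrightarrow> (\<Sum>i\<in>I. d i - c i) < \<delta> \<Longrightarrow>
        (\<Sum>i\<in>I. norm (f (d i) - f (c i))) < e"
    using absolutely_continuous_on_families[OF f \<open>e > 0\<close>] by blast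
  have *: "norm (f y - f x) < e" if "x \<in> S" "y \<in> S" "x \<le> y" "dist y x < \<delta>" for x y
  proof -
    have "{x..y} \<subseteq> S"
      using that S unfolding is_interval_1 by (meson atLeastAtMost_iff subsetI)
    then have "nonoverlapping S {()} (\<lambda>_. x) (\<lambda>_. y)"
      using that by (simp add: nonoverlapping_def disjoint_family_on_def)
    from \<delta>(2)[OF this] that show ?thesis by (auto simp: dist_real_def)
  qed
  show "\<exists>d>0. \<forall>x\<in>S. \<forall>x'\<in>S. dist x' x < d \<longrightarrow> dist (f x') (f x) < e"
  proof (intro exI[of _ \<delta>] conjI ballI impI)
    fix x x' assume "x \<in> S" "x' \<in> S" "dist x' x < \<delta>"
    then show "dist (f x') (f x) < e"
    proof (cases "x \<le> x'")
      case False
      then have "norm (f x - f x') < e"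
        using \<open>x \<in> S\<close> \<open>x' \<in> S\<close> \<open>dist x' x < \<delta>\<close> by (intro *) (simp_all add: dist_commute)
      then show ?thesis by (simp add: dist_norm norm_minus_commute)
    qed (simp add: dist_norm *)
  qed (rule \<delta>(1))
qed

lemma absolutely_continuous_on_imp_continuous_on:
  fixes f :: "real \<Rightarrow> 'a::real_normed_vector"
  assumes "absolutely_continuous_on S f" "is_interval S"
  shows "continuous_on S f"
  using absolutely_continuous_on_imp_uniformly_continuous_on[OF assms] uniformly_continuous_imp_continuous by blast

text \<open>Contracting a family towards the midpoint of \<open>[a, b]\<close> moves it into the open interval without
  increasing lengths.\<close>

lemma absolutely_continuous_on_closure:
  fixes f g :: "real \<Rightarrow> 'a::real_normed_vector"
  assumes ab: "a < b" and f: "absolutely_continuous_on {a<..<b} f" and g: "continuous_on {a..b} g"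
    and eq: "\<And>x. x \<in> {a<..<b} \<Longrightarrow> g x = f x"
  shows "absolutely_continuous_on {a..b} g"
proof (rule absolutely_continuous_onI)
  fix \<epsilon> :: real assume "\<epsilon> > 0"
  \<comment> \<open>The limit at the end of the proof weakens the strict inequality; half of
    \<epsilon> leaves room to restore it.\<close>
  then have "\<epsilon>/2 > 0" by simp
  obtain \<delta> where \<delta>: "\<delta> > 0" "\<And>(I :: real set set) c d. nonoverlapping {a<..<b} I c d \<Longrightarrow> (\<Sum>i\<in>I. d i - c i) < \<delta> \<Longrightarrow>
        (\<Sum>i\<in>I. norm (f (d i) - f (c i))) < \<epsilon>/2"
    using absolutely_continuous_on_families[OF f \<open>\<epsilon>/2 > 0\<close>] by blast
  have "(\<Sum>i\<in>I. norm (g (d i) - g (c i))) < \<epsilon>"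
    if I: "nonoverlapping {a..b} I c d" and small: "(\<Sum>i\<in>I. d i - c i) < \<delta>" for I :: "real set set" and c d
  proof -
    define m where "m = (a + b) / 2"
    define \<phi> where "\<phi> = (\<lambda>t x. m + (1 - t) * (x - m))"
    have cd: "c i \<le> d i" "c i \<in> {a..b}" "d i \<in> {a..b}" if "i \<in> I" for i
      using nonoverlappingD[OF I that] by auto
    have in_open: "\<phi> t x \<in> {a<..<b}" if "0 < t" "t < 1" "x \<in> {a..b}" for t x
    proof -
      have "0 < t * (m - a) + (1 - t) * (x - a)" "0 < t * (b - m) + (1 - t) * (b - x)"
        using ab that by (auto simp: m_def intro!: add_pos_nonneg)
      moreover have "t * (m - a) + (1 - t) * (x - a) = \<phi> t x - a" "t * (b - m) + (1 - t) * (b - x) = b - \<phi> t x"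
        unfolding \<phi>_def by algebra+
      ultimately have "0 < \<phi> t x - a" "0 < b - \<phi> t x" by simp_all
      then show ?thesis by simp
    qed
    have le: "(\<Sum>i\<in>I. norm (g (\<phi> t (d i)) - g (\<phi> t (c i)))) \<le> \<epsilon>/2" if t: "0 < t" "t < 1" for t
    proof -
      have mono: "\<phi> t x \<le> \<phi> t y \<longleftrightarrow> x \<le> y" for x y using t by (simp add: \<phi>_def)
      have "nonoverlapping {a<..<b} I (\<lambda>i. \<phi> t (c i)) (\<lambda>i. \<phi> t (d i))"
        unfolding nonoverlapping_def
      proof (intro conjI ballI)
        show "finite I" using I by (simp add: nonoverlapping_def)
        fix i assume i: "i \<in> I"
        show "\<phi> t (c i) \<le> \<phi> t (d i)" using cd[OF i] mono by simp
        show "{\<phi> t (c i)..\<phi> t (d i)} \<subseteq> {a<..<b}" using in_open[OF t cd(2)[OF i]] in_open[OF t cd(3)[OF i]] by auto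
      next
        show "disjoint_family_on (\<lambda>i. {\<phi> t (c i)<..<\<phi> t (d i)}) I"
          using I by (simp add: nonoverlapping_def disjoint_family_on_def greaterThanLessThan_disjoint_iff mono del: Int_greaterThanLessThan)
      qed
      moreover have "(\<Sum>i\<in>I. \<phi> t (d i) - \<phi> t (c i)) \<le> (\<Sum>i\<in>I. d i - c i)"
      proof (rule sum_mono)
        fix i assume i: "i \<in> I"
        have "\<phi> t (d i) - \<phi> t (c i) = (1 - t) * (d i - c i)" by (simp add: \<phi>_def algebra_simps)
        then show "\<phi> t (d i) - \<phi> t (c i) \<le> d i - c i" using t cd[OF i] by (simp add: mult_left_le_one_le)
      qed
      ultimately have "(\<Sum>i\<in>I. norm (f (\<phi> t (d i)) - f (\<phi> t (c i)))) < \<epsilon>/2"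
        using small by (intro \<delta>(2)) auto
      also have "(\<Sum>i\<in>I. norm (f (\<phi> t (d i)) - f (\<phi> t (c i)))) = (\<Sum>i\<in>I. norm (g (\<phi> t (d i)) - g (\<phi> t (c i))))"
        using in_open[OF t] cd by (intro sum.cong refl) (simp add: eq)
      finally show ?thesis by simp
    qed
    \<comment> \<open>At t = 0 the contraction is the identity, so continuity of \<open>g\<close> on
      the closed interval brings the sums back to the original family.\<close>
    have lim: "((\<lambda>t. g (\<phi> t x)) \<longlongrightarrow> g x) (at_right 0)" if x: "x \<in> {a..b}" for x
    proof -
      have 1: "((\<lambda>t. \<phi> t x) \<longlongrightarrow> \<phi> 0 x) (at_right 0)" unfolding \<phi>_def by (intro tendsto_intros)
      have 2: "\<forall>\<^sub>F t in at_right 0. \<phi> t x \<in> {a..b}"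
        using eventually_at_right_less[of 0] eventually_at_right_real[of 0 1] in_open[OF _ _ x]
        by (auto elim!: eventually_elim2 simp: less_imp_le)
      have "continuous (at x within {a..b}) g" using g x by (simp add: continuous_on_eq_continuous_within)
      then have "(g \<longlongrightarrow> g x) (at x within {a..b})" by (simp add: continuous_within)
      from continuous_on_tendsto_compose[OF g, of "\<lambda>t. \<phi> t x" x] 1 2 x show ?thesis
        by (simp add: \<phi>_def)
    qed
    have "((\<lambda>t. \<Sum>i\<in>I. norm (g (\<phi> t (d i)) - g (\<phi> t (c i)))) \<longlongrightarrow> (\<Sum>i\<in>I. norm (g (d i) - g (c i)))) (at_right 0)"
      by (intro tendsto_intros lim cd)
    moreover have "\<forall>\<^sub>F t in at_right 0. (\<Sum>i\<in>I. norm (g (\<phi> t (d i)) - g (\<phi> t (c i)))) \<le> \<epsilon>/2"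
      using eventually_at_right_less[of 0] eventually_at_right_real[of 0 1] le by (auto elim!: eventually_elim2)
    ultimately have "(\<Sum>i\<in>I. norm (g (d i) - g (c i))) \<le> \<epsilon>/2"
      by (rule tendsto_upperbound) simp
    then show ?thesis using \<open>\<epsilon> > 0\<close> by simp
  qed
  then show "\<exists>\<delta>>0. \<forall>(I :: real set set) c d. nonoverlapping {a..b} I c d \<longrightarrow> (\<Sum>i\<in>I. d i - c i) < \<delta> \<longrightarrow>
        (\<Sum>i\<in>I. norm (g (d i) - g (c i))) < \<epsilon>" using \<delta>(1) by blast
qed

text \<open>Uniform continuity and completeness supply the values at the end points.\<close>

lemma absolutely_continuous_on_extend:
  fixes f :: "real \<Rightarrow> 'a::banach"
  assumes ab: "a < b" and f: "absolutely_continuous_on {a<..<b} f"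
  obtains g where "absolutely_continuous_on {a..b} g" "\<And>x. x \<in> {a<..<b} \<Longrightarrow> g x = f x"
    "(f \<longlongrightarrow> g a) (at_right a)" "(f \<longlongrightarrow> g b) (at_left b)"
proof -
  have "uniformly_continuous_on {a<..<b} f"
    by (rule absolutely_continuous_on_imp_uniformly_continuous_on[OF f]) (simp add: is_interval_1)
  then obtain g where g: "uniformly_continuous_on (closure {a<..<b}) g" "\<And>x. x \<in> {a<..<b} \<Longrightarrow> f x = g x"
    using uniformly_continuous_on_extension_on_closure by metis
  have cont: "continuous_on {a..b} g" using g(1) ab uniformly_continuous_imp_continuous by fastforce
  have "(g \<longlongrightarrow> g a) (at_right a)" "(g \<longlongrightarrow> g b) (at_left b)"
    using cont ab by (auto simp: continuous_on_Icc_at_rightD continuous_on_Icc_at_leftD)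
  moreover have "\<forall>\<^sub>F x in at_right a. g x = f x"
    using eventually_at_right_real[OF ab] by eventually_elim (simp add: g(2))
  moreover have "\<forall>\<^sub>F x in at_left b. g x = f x"
    using eventually_at_left_real[OF ab] by eventually_elim (simp add: g(2))
  ultimately have "(f \<longlongrightarrow> g a) (at_right a)" "(f \<longlongrightarrow> g b) (at_left b)"
    using Lim_transform_eventually by blast+
  moreover have "absolutely_continuous_on {a..b} g"
    by (rule absolutely_continuous_on_closure[OF ab f cont]) (simp add: g(2))
  ultimately show thesis using that g(2) by simp
qed

text \<open>Truncation collapses the members beyond \<open>m\<close> to the point \<open>m\<close>,
  one of the reasons why families admit degenerate intervals. Together with the companion for
  \<open>max\<close> it cuts a family at \<open>m\<close>.\<close>

lemma nonoverlapping_min: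
  assumes I: "nonoverlapping {a..b} I c d" and m: "a \<le> m"
  shows "nonoverlapping {a..m} I (\<lambda>i. min m (c i)) (\<lambda>i. min m (d i))"
  unfolding nonoverlapping_def
proof (intro conjI ballI)
  show "finite I" using I by (simp add: nonoverlapping_def)
  show "disjoint_family_on (\<lambda>i. {min m (c i)<..<min m (d i)}) I"
    unfolding disjoint_family_on_def greaterThanLessThan_disjoint_iff
  proof (intro ballI impI)
    fix i j assume "i \<in> I" "j \<in> I" "i \<noteq> j"
    then have "d i \<le> c i \<or> d j \<le> c j \<or> d i \<le> c j \<or> d j \<le> c i"
      using I unfolding nonoverlapping_def disjoint_family_on_def greaterThanLessThan_disjoint_iff by blast
    then show "min m (d i) \<le> min m (c i) \<or> min m (d j) \<le> min m (c j) \<or>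
        min m (d i) \<le> min m (c j) \<or> min m (d j) \<le> min m (c i)"
      using min.mono[OF order.refl[of m]] by blast
  qed
  fix i assume "i \<in> I"
  from nonoverlappingD[OF I this] m show "min m (c i) \<le> min m (d i)" "{min m (c i)..min m (d i)} \<subseteq> {a..m}"
    by auto
qed

lemma nonoverlapping_max:
  assumes I: "nonoverlapping {a..b} I c d" and m: "m \<le> b"
  shows "nonoverlapping {m..b} I (\<lambda>i. max m (c i)) (\<lambda>i. max m (d i))"
  unfolding nonoverlapping_def
proof (intro conjI ballI)
  show "finite I" using I by (simp add: nonoverlapping_def)
  show "disjoint_family_on (\<lambda>i. {max m (c i)<..<max m (d i)}) I"
    unfolding disjoint_family_on_def greaterThanLessThan_disjoint_iff
  proof (intro ballI impI)
    fix i j assume "i \<in> I" "j \<in> I" "i \<noteq> j"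
    then have "d i \<le> c i \<or> d j \<le> c j \<or> d i \<le> c j \<or> d j \<le> c i"
      using I unfolding nonoverlapping_def disjoint_family_on_def greaterThanLessThan_disjoint_iff by blast
    then show "max m (d i) \<le> max m (c i) \<or> max m (d j) \<le> max m (c j) \<or>
        max m (d i) \<le> max m (c j) \<or> max m (d j) \<le> max m (c i)"
      using max.mono[OF order.refl[of m]] by blast
  qed
  fix i assume "i \<in> I"
  from nonoverlappingD[OF I this] m show "max m (c i) \<le> max m (d i)" "{max m (c i)..max m (d i)} \<subseteq> {m..b}"
    by auto
qed

text \<open>Cutting at \<open>m\<close> inserts the value \<open>f m\<close>; if \<open>m\<close>
  lies outside the interval, one of the two summands is zero.\<close>

lemma norm_diff_split_le:
  fixes f :: "real \<Rightarrow> 'a::real_normed_vector"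
  assumes "c \<le> d"
  shows "norm (f d - f c) \<le> norm (f (min m d) - f (min m c)) + norm (f (max m d) - f (max m c))"
proof -
  consider "d \<le> m" | "m \<le> c" | "c \<le> m" "m \<le> d" using assms by linarith
  then show ?thesis
  proof cases
    case 3
    have "norm (f d - f c) \<le> norm (f m - f c) + norm (f d - f m)"
      using norm_triangle_ineq[of "f m - f c" "f d - f m"] by simp
    then show ?thesis using 3 by (simp add: min_absorb1 min_absorb2 max_absorb1 max_absorb2)
  qed (use assms in \<open>simp_all add: min_absorb1 min_absorb2 max_absorb1 max_absorb2\<close>)
qed

text \<open>The sum is the measure of a disjoint union of open intervals, which lies in
  \<open>U\<close>.\<close>

lemma nonoverlapping_sum_length_le:
  fixes U :: "real set"
  assumes I: "nonoverlapping U I c d" and U: "U \<in> sets lebesgue" "emeasure lebesgue U < ennreal \<delta>"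
  shows "(\<Sum>i\<in>I. d i - c i) < \<delta>"
proof -
  have fin: "finite I" using I by (simp add: nonoverlapping_def)
  have "ennreal (\<Sum>i\<in>I. d i - c i) = (\<Sum>i\<in>I. emeasure lebesgue {c i<..<d i})"
    using nonoverlappingD[OF I] by (subst sum_ennreal[symmetric]) (auto intro!: sum.cong)
  also have "\<dots> = emeasure lebesgue (\<Union>i\<in>I. {c i<..<d i})"
    using I by (intro sum_emeasure) (auto simp: nonoverlapping_def)
  also have "\<dots> \<le> emeasure lebesgue U"
    using nonoverlappingD(4)[OF I] U by (intro emeasure_mono UN_least) (force simp: subset_iff)+
  also have "\<dots> < ennreal \<delta>" by (rule U)
  finally show ?thesis by (simp add: ennreal_less_iff sum_nonneg nonoverlappingD(1)[OF I])
qed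

text \<open>An interval of length below \<open>n * \<delta>\<close> can be cut into \<open>n\<close>
  parts shorter than \<delta>, each of variation at most 1, so that \<open>n\<close> bounds the
  total.\<close>

lemma absolutely_continuous_on_imp_bounded_variation:
  fixes f :: "real \<Rightarrow> 'a::real_normed_vector"
  assumes f: "absolutely_continuous_on {a..b} f"
  obtains B where "0 \<le> B" "\<And>(I :: 'i set) c d. nonoverlapping {a..b} I c d \<Longrightarrow> (\<Sum>i\<in>I. norm (f (d i) - f (c i))) \<le> B"
proof -
  obtain \<delta> where \<delta>: "\<delta> > 0" "\<And>(I :: 'i set) c d. nonoverlapping {a..b} I c d \<Longrightarrow> (\<Sum>i\<in>I. d i - c i) < \<delta> \<Longrightarrow>
        (\<Sum>i\<in>I. norm (f (d i) - f (c i))) < 1"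
    using absolutely_continuous_on_families[OF f zero_less_one] by blast
  have *: "(\<Sum>i\<in>I. norm (f (d i) - f (c i))) \<le> real n"
    if "nonoverlapping {x..b} I c d" "a \<le> x" "b - x < real n * \<delta>" for n x and I :: "'i set" and c d
    using that
  proof (induction n arbitrary: x c d)
    case 0
    then have "I = {}" using nonoverlappingD(2)[OF 0(1)] by fastforce
    then show ?case by simp
  next
    case (Suc n)
    note I = Suc.prems(1)
    show ?case
    proof (cases "x + \<delta> \<le> b")
      case True
      \<comment> \<open>With the slack q > 0, the cut has to lie strictly between x and x + \<delta>
        and to leave less than \<open>n * \<delta>\<close> on its right. The correction \<delta> q /
        (\<delta> + q) is positive and smaller than both \<delta> and q, which is what this
        takes.\<close>
      define m where "m = x + \<delta> - \<delta> * (real (Suc n) * \<delta> - (b - x)) / (\<delta> + (real (Suc n) * \<delta> - (b - x)))"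
      define q where "q = real (Suc n) * \<delta> - (b - x)"
      have q: "q > 0" using Suc.prems by (simp add: q_def)
      have mq: "m = x + \<delta> - \<delta> * q / (\<delta> + q)" by (simp add: m_def q_def)
      have dq: "0 < \<delta> * q / (\<delta> + q)" "\<delta> * q / (\<delta> + q) < \<delta>" "\<delta> * q / (\<delta> + q) < q"
        using \<delta>(1) q by (simp_all add: field_simps)
      have m: "x < m" "m < x + \<delta>" "b - m < real n * \<delta>" using dq by (auto simp: mq q_def algebra_simps)
      have "(\<Sum>i\<in>I. norm (f (d i) - f (c i))) \<le>
        (\<Sum>i\<in>I. norm (f (min m (d i)) - f (min m (c i))) + norm (f (max m (d i)) - f (max m (c i))))"
        using nonoverlappingD(1)[OF I] by (intro sum_mono norm_diff_split_le)
      also have "\<dots> = (\<Sum>i\<in>I. norm (f (min m (d i)) - f (min m (c i)))) + (\<Sum>i\<in>I. norm (f (max m (d i)) - f (max m (c i))))"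
        by (rule sum.distrib)
      also have "(\<Sum>i\<in>I. norm (f (max m (d i)) - f (max m (c i)))) \<le> real n"
        using m True Suc.prems by (intro Suc.IH[of m] nonoverlapping_max[OF I]) auto
      also have "(\<Sum>i\<in>I. norm (f (min m (d i)) - f (min m (c i)))) < 1"
      proof (rule \<delta>(2))
        have N: "nonoverlapping {x..m} I (\<lambda>i. min m (c i)) (\<lambda>i. min m (d i))"
          using m by (intro nonoverlapping_min[OF I]) auto
        then show "nonoverlapping {a..b} I (\<lambda>i. min m (c i)) (\<lambda>i. min m (d i))"
          by (rule nonoverlapping_subset) (use m True Suc.prems in auto)
        show "(\<Sum>i\<in>I. min m (d i) - min m (c i)) < \<delta>"
          using m \<delta>(1) by (intro nonoverlapping_sum_length_le[OF N]) (auto simp: ennreal_less_iff)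
      qed
      finally show ?thesis by simp
    next
      case False
      have "(\<Sum>i\<in>I. norm (f (d i) - f (c i))) < 1"
      proof (rule \<delta>(2))
        show "nonoverlapping {a..b} I c d"
          by (rule nonoverlapping_subset[OF I]) (use Suc.prems in auto)
        show "(\<Sum>i\<in>I. d i - c i) < \<delta>"
          using False \<delta>(1) by (intro nonoverlapping_sum_length_le[OF I])
            (cases "x \<le> b", auto simp: ennreal_less_iff emeasure_lborel_Icc_eq)
      qed
      then show ?thesis by simp
    qed
  qed
  obtain n where "b - a < real n * \<delta>" using reals_Archimedean3[OF \<delta>(1)] by blast
  show thesis by (rule that[of "real n"]) (simp, rule *[OF _ order.refl \<open>b - a < real n * \<delta>\<close>])
qed

section \<open>Fundamental theorem of calculus for absolutely continuous functions\<close>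

lemma AE_lborel_imp_negligible:
  assumes "AE x in lborel. P x"
  shows "negligible {x::real. \<not> P x}"
proof -
  obtain N where N: "{x\<in>space lborel. \<not> P x} \<subseteq> N" "N \<in> null_sets lborel"
    using assms by (auto simp: eventually_ae_filter)
  then have "negligible N"
    by (auto simp: negligible_iff_null_sets intro: null_sets_completionI)
  then show ?thesis using N(1) by (elim negligible_subset) simp
qed

lemma negligible_imp_AE_lborel:
  assumes "negligible N" "\<And>x::real. x \<notin> N \<Longrightarrow> P x"
  shows "AE x in lborel. P x"
proof -
  have "AE x in lebesgue. P x"
    using assms AE_not_in[of N lebesgue] by (auto simp: negligible_iff_null_sets elim: eventually_mono)
  then show ?thesis by (simp add: AE_completion_iff)
qed

text \<open>Henstock's proof: on the exceptional null set the gauge is confined to an open set of small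
  measure, where absolute continuity controls the increments.\<close>

lemma fundamental_theorem_of_calculus_absolutely_continuous:
  fixes F :: "real \<Rightarrow> 'a::banach"
  assumes ab: "a \<le> b" and F: "absolutely_continuous_on {a..b} F"
    and der: "AE x in lborel. a < x \<and> x < b \<longrightarrow> (F has_vector_derivative f x) (at x)"
  shows "(f has_integral (F b - F a)) {a..b}"
proof -
  define N where "N = {x. \<not> (a < x \<and> x < b \<longrightarrow> (F has_vector_derivative f x) (at x))} \<union> {a, b}"
  have N: "negligible N"
    unfolding N_def using AE_lborel_imp_negligible[OF der] by (intro negligible_Un) auto
  \<comment> \<open>With value 0 at the tags in \<open>N\<close>, the error of the Riemann sum at
    these tags consists of increments of \<open>F\<close> alone.\<close>
  define f0 where "f0 = (\<lambda>x. if x \<in> N then 0 else f x)"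
  have "(f0 has_integral (F b - F a)) {a..b}"
    unfolding has_integral_real
  proof (intro allI impI)
    fix e :: real assume e: "e > 0"
    then have e2: "e/2 > 0" by simp
    obtain \<delta> where \<delta>: "\<delta> > 0" "\<And>(I :: (real \<times> real set) set) c d. nonoverlapping {a..b} I c d \<Longrightarrow>
      (\<Sum>i\<in>I. d i - c i) < \<delta> \<Longrightarrow> (\<Sum>i\<in>I. norm (F (d i) - F (c i))) < e/2"
      using absolutely_continuous_on_families[OF F e2] by blast
    have "N \<in> sets lebesgue" using N by (simp add: negligible_imp_sets)
    then obtain U where U: "open U" "N \<subseteq> U" "U - N \<in> lmeasurable" "emeasure lebesgue (U - N) < ennreal \<delta>"
      using sets_lebesgue_outer_open[OF _ \<delta>(1)] by blast
    have Uset: "U \<in> sets lebesgue" using U(1) by simp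
    have "emeasure lebesgue U = emeasure lebesgue (U - N)"
      using N Uset by (simp add: emeasure_Diff_null_set negligible_iff_null_sets)
    then have Usmall: "emeasure lebesgue U < ennreal \<delta>" using U by simp
    \<comment> \<open>The tags outside \<open>N\<close> contribute at most \<eta> (b - a), hence at
      most e/2; the summand 1 covers a = b.\<close>
    define \<eta> where "\<eta> = e / (2 * (b - a + 1))"
    have \<eta>: "\<eta> > 0" using e ab by (simp add: \<eta>_def)
    have "\<exists>r>0. \<forall>y. norm (y - x) < r \<longrightarrow> norm (F y - F x - (y - x) *\<^sub>R f x) \<le> \<eta> * norm (y - x)"
      if "x \<in> {a..b} - N" for x
    proof -
      have "(F has_vector_derivative f x) (at x)" using that by (auto simp: N_def)
      then show ?thesis using \<eta> by (simp add: has_vector_derivative_def has_derivative_at_alt)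
    qed
    then have "\<forall>x\<in>{a..b} - N. \<exists>r>0. \<forall>y. norm (y - x) < r \<longrightarrow> norm (F y - F x - (y - x) *\<^sub>R f x) \<le> \<eta> * norm (y - x)"
      by (intro ballI)
    from bchoice[OF this] obtain r where rr: "\<forall>x\<in>{a..b} - N. r x > 0 \<and>
        (\<forall>y. norm (y - x) < r x \<longrightarrow> norm (F y - F x - (y - x) *\<^sub>R f x) \<le> \<eta> * norm (y - x))" by (elim exE)
    have r: "r x > 0" "norm (y - x) < r x \<Longrightarrow> norm (F y - F x - (y - x) *\<^sub>R f x) \<le> \<eta> * norm (y - x)"
      if "x \<in> {a..b} - N" for x y
      using bspec[OF rr that] by simp_all
    define \<gamma> where "\<gamma> = (\<lambda>x. if x \<in> N then U else if x \<in> {a..b} then ball x (r x) else UNIV)"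
    have "gauge \<gamma>" using U r(1) by (auto simp: gauge_def \<gamma>_def)
    moreover have "norm ((\<Sum>(x, K)\<in>p. measure lborel K *\<^sub>R f0 x) - (F b - F a)) < e"
      if p: "p tagged_division_of {a..b}" and fine: "\<gamma> fine p" for p
    proof -
      have finp: "finite p" using p by auto
      define p1 where "p1 = {q\<in>p. fst q \<in> N}"
      define p2 where "p2 = {q\<in>p. fst q \<notin> N}"
      have pp: "p = p1 \<union> p2" "p1 \<inter> p2 = {}" "finite p1" "finite p2"
        using finp by (auto simp: p1_def p2_def)
      have iv: "\<exists>u v. K = {u..v} \<and> u \<le> v \<and> u \<le> x \<and> x \<le> v \<and> a \<le> u \<and> v \<le> b" if xK: "(x, K) \<in> p" for x K
      proof -
        obtain u v where uv: "K = cbox u v" using tagged_division_ofD(4)[OF p xK] by blast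
        have x: "x \<in> K" "K \<subseteq> {a..b}" using tagged_division_ofD(2,3)[OF p xK] by auto
        then have "u \<in> K" "v \<in> K" by (auto simp: uv)
        then show ?thesis using x by (intro exI[of _ u] exI[of _ v]) (auto simp: uv)
      qed
      have sumF: "F b - F a = (\<Sum>(x, K)\<in>p. F (Sup K) - F (Inf K))"
        using additive_tagged_division_1[OF ab p, of F] by simp
      have sumx: "b - a = (\<Sum>(x, K)\<in>p. Sup K - Inf K)"
        using additive_tagged_division_1[OF ab p, of "\<lambda>x. x"] by simp
      define g where "g = (\<lambda>q. measure lborel (snd q) *\<^sub>R f0 (fst q) - (F (Sup (snd q)) - F (Inf (snd q))))"
      have "(\<Sum>(x, K)\<in>p. measure lborel K *\<^sub>R f0 x) - (F b - F a) = (\<Sum>q\<in>p. g q)"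
        unfolding sumF g_def by (simp add: split_beta sum_subtractf)
      also have "\<dots> = (\<Sum>q\<in>p1. g q) + (\<Sum>q\<in>p2. g q)"
        using pp by (simp add: sum.union_disjoint)
      finally have "norm ((\<Sum>(x, K)\<in>p. measure lborel K *\<^sub>R f0 x) - (F b - F a)) \<le> norm (\<Sum>q\<in>p1. g q) + norm (\<Sum>q\<in>p2. g q)"
        by (simp add: norm_triangle_ineq)
      also have "norm (\<Sum>q\<in>p1. g q) \<le> (\<Sum>q\<in>p1. norm (F (Sup (snd q)) - F (Inf (snd q))))"
        by (rule order.trans[OF norm_sum]) (intro sum_mono, auto simp: g_def p1_def f0_def norm_minus_commute)
      also have "\<dots> < e/2"
      proof -
        have no: "nonoverlapping ({a..b} \<inter> U) p1 (\<lambda>q. Inf (snd q)) (\<lambda>q. Sup (snd q))"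
          unfolding nonoverlapping_def disjoint_family_on_def
        proof (intro conjI ballI impI)
          show "finite p1" by fact
        next
          fix q assume q: "q \<in> p1"
          obtain x K where xK: "q = (x, K)" by force
          then have qp: "(x, K) \<in> p" "x \<in> N" using q by (auto simp: p1_def)
          obtain u v where uv: "K = {u..v}" "u \<le> v" using iv[OF qp(1)] by blast
          show "Inf (snd q) \<le> Sup (snd q)" using uv by (simp add: xK)
          have "K \<subseteq> \<gamma> x" by (rule fineD[OF fine qp(1)])
          then have "K \<subseteq> U" using qp by (simp add: \<gamma>_def)
          moreover have "K \<subseteq> {a..b}" using tagged_division_ofD(3)[OF p qp(1)] .
          ultimately show "{Inf (snd q)..Sup (snd q)} \<subseteq> {a..b} \<inter> U" using uv by (simp add: xK)
        next
          fix q q' assume q: "q \<in> p1" "q' \<in> p1" "q \<noteq> q'"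
          obtain x K where xK: "q = (x, K)" by force
          obtain x' K' where xK': "q' = (x', K')" by force
          have qp: "(x, K) \<in> p" "(x', K') \<in> p" using q xK xK' by (auto simp: p1_def)
          obtain u v where uv: "K = {u..v}" "u \<le> v" using iv[OF qp(1)] by blast
          obtain u' v' where uv': "K' = {u'..v'}" "u' \<le> v'" using iv[OF qp(2)] by blast
          have "interior K \<inter> interior K' = {}"
            using tagged_division_ofD(5)[OF p qp] q xK xK' by blast
          then show "{Inf (snd q)<..<Sup (snd q)} \<inter> {Inf (snd q')<..<Sup (snd q')} = {}"
            using uv uv' by (simp add: xK xK' del: Int_greaterThanLessThan)
        qed
        show ?thesis
        proof (rule \<delta>(2))
          show "nonoverlapping {a..b} p1 (\<lambda>q. Inf (snd q)) (\<lambda>q. Sup (snd q))"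
            by (rule nonoverlapping_subset[OF no]) simp
          show "(\<Sum>q\<in>p1. Sup (snd q) - Inf (snd q)) < \<delta>"
            by (rule nonoverlapping_sum_length_le[OF nonoverlapping_subset[OF no] Uset Usmall]) simp
        qed
      qed
      also have "norm (\<Sum>q\<in>p2. g q) \<le> e/2"
      proof -
        have "norm (\<Sum>q\<in>p2. g q) \<le> (\<Sum>q\<in>p2. \<eta> * (Sup (snd q) - Inf (snd q)))"
        proof (rule order.trans[OF norm_sum sum_mono])
          fix q assume q: "q \<in> p2"
          obtain x K where xK: "q = (x, K)" by force
          then have qp: "(x, K) \<in> p" "x \<notin> N" using q by (auto simp: p2_def)
          obtain u v where uv: "K = {u..v}" "u \<le> v" "u \<le> x" "x \<le> v" "a \<le> u" "v \<le> b"
            using iv[OF qp(1)] by blast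
          have xin: "x \<in> {a..b} - N" using uv qp by auto
          have "K \<subseteq> \<gamma> x" by (rule fineD[OF fine qp(1)])
          then have "K \<subseteq> ball x (r x)" using qp xin by (simp add: \<gamma>_def)
          moreover have "u \<in> K" "v \<in> K" using uv by auto
          ultimately have "u \<in> ball x (r x)" "v \<in> ball x (r x)" by blast+
          then have d: "norm (u - x) < r x" "norm (v - x) < r x" by (simp_all add: dist_real_def abs_minus_commute)
          \<comment> \<open>Straddle estimate: both end points are compared with the tag x, and the
            two errors add up to \<eta> times the length of the interval.\<close>
          have "g q = (F u - F x - (u - x) *\<^sub>R f x) - (F v - F x - (v - x) *\<^sub>R f x)"
            using uv qp by (simp add: g_def xK f0_def algebra_simps)
          also have "norm \<dots> \<le> \<eta> * norm (u - x) + \<eta> * norm (v - x)"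
            by (rule order.trans[OF norm_triangle_ineq4 add_mono]) (intro r(2) xin d)+
          also have "\<dots> = \<eta> * (v - u)" using uv by (simp add: algebra_simps)
          finally show "norm (g q) \<le> \<eta> * (Sup (snd q) - Inf (snd q))" using uv by (simp add: xK)
        qed
        also have "\<dots> \<le> (\<Sum>q\<in>p. \<eta> * (Sup (snd q) - Inf (snd q)))"
        proof (rule sum_mono2[OF finp])
          show "p2 \<subseteq> p" by (auto simp: p2_def)
          fix q assume "q \<in> p - p2"
          then obtain x K where xK: "q = (x, K)" "(x, K) \<in> p" by (cases q) auto
          obtain u v where "K = {u..v}" "u \<le> v" using iv[OF xK(2)] by blast
          then show "0 \<le> \<eta> * (Sup (snd q) - Inf (snd q))" using \<eta> by (simp add: xK)
        qed
        also have "\<dots> = \<eta> * (b - a)" unfolding sumx by (simp add: sum_distrib_left split_beta)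
        also have "\<dots> \<le> e/2" using e ab by (simp add: \<eta>_def field_simps)
        finally show ?thesis .
      qed
      finally show ?thesis by simp
    qed
    ultimately show "\<exists>\<gamma>. gauge \<gamma> \<and> (\<forall>p. p tagged_division_of {a..b} \<and> \<gamma> fine p \<longrightarrow>
        norm ((\<Sum>(x, K)\<in>p. measure lborel K *\<^sub>R f0 x) - (F b - F a)) < e)"
      by (intro exI[of _ \<gamma>] conjI allI impI) simp_all
  qed
  then show ?thesis
    by (rule has_integral_spike[OF N, rotated]) (simp add: f0_def)
qed

text \<open>Only the almost everywhere class of \<open>f\<close> matters, so this also expresses
  differential equations in the sense of Caratheodory.\<close>

definition ac_primitive :: "real \<Rightarrow> real \<Rightarrow> (real \<Rightarrow> 'a::real_normed_vector) \<Rightarrow> (real \<Rightarrow> 'a) \<Rightarrow> bool" where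
  "ac_primitive a b F f \<longleftrightarrow> absolutely_continuous_on {a..b} F \<and>
     (AE x in lborel. a < x \<and> x < b \<longrightarrow> (F has_vector_derivative f x) (at x))"

lemma ac_primitive_has_integral:
  fixes F :: "real \<Rightarrow> 'a::banach"
  assumes F: "ac_primitive a b F f" and cd: "a \<le> c" "c \<le> d" "d \<le> b"
  shows "(f has_integral (F d - F c)) {c..d}"
proof (rule fundamental_theorem_of_calculus_absolutely_continuous[OF cd(2)])
  show "absolutely_continuous_on {c..d} F"
    using F cd by (auto simp: ac_primitive_def elim: absolutely_continuous_on_subset)
  have "AE x in lborel. a < x \<and> x < b \<longrightarrow> (F has_vector_derivative f x) (at x)"
    using F by (simp add: ac_primitive_def)
  then show "AE x in lborel. c < x \<and> x < d \<longrightarrow> (F has_vector_derivative f x) (at x)"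
    by eventually_elim (use cd in auto)
qed

text \<open>The integrals of \<open>f\<close> over the members of a division are increments of
  \<open>F\<close>, and their norms have bounded sums because \<open>F\<close> has bounded
  variation.\<close>

lemma ac_primitive_absolutely_integrable:
  fixes F :: "real \<Rightarrow> 'a::euclidean_space"
  assumes ab: "a \<le> b" and F: "ac_primitive a b F f"
  shows "f absolutely_integrable_on {a..b}"
proof -
  have "absolutely_continuous_on {a..b} F" using F by (simp add: ac_primitive_def)
  then obtain B where B: "\<And>(I :: real set set) c d. nonoverlapping {a..b} I c d \<Longrightarrow> (\<Sum>i\<in>I. norm (F (d i) - F (c i))) \<le> B"
    using absolutely_continuous_on_imp_bounded_variation by blast
  have "f absolutely_integrable_on cbox a b"
  proof (rule bounded_variation_absolutely_integrable_interval)
    show "f integrable_on cbox a b"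
      using ac_primitive_has_integral[OF F order.refl ab order.refl] by auto
    fix D assume D: "D division_of cbox a b"
    note K = division_of_nonoverlapping(1)[OF D order.refl]
    have no: "nonoverlapping {a..b} D Inf Sup"
      using division_of_nonoverlapping(2)[OF D order.refl] by simp
    have "(\<Sum>K\<in>D. norm (integral K f)) = (\<Sum>K\<in>D. norm (F (Sup K) - F (Inf K)))"
    proof (intro sum.cong refl)
      fix X assume X: "X \<in> D"
      from nonoverlappingD[OF no X] have "(f has_integral (F (Sup X) - F (Inf X))) {Inf X..Sup X}"
        by (intro ac_primitive_has_integral[OF F]) auto
      from integral_unique[OF this] conjunct1[OF K[OF X]]
      show "norm (integral X f) = norm (F (Sup X) - F (Inf X))" by simp
    qed
    also have "\<dots> \<le> B" by (rule B[OF no])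
    finally show "(\<Sum>K\<in>D. norm (integral K f)) \<le> B" .
  qed
  then show ?thesis by simp
qed

lemma ac_primitive_continuous_on:
  fixes F :: "real \<Rightarrow> 'a::real_normed_vector"
  shows "ac_primitive a b F f \<Longrightarrow> continuous_on {a..b} F"
  by (auto simp: ac_primitive_def is_interval_1 intro!: absolutely_continuous_on_imp_continuous_on)

text \<open>Truncating \<open>f\<close> to norm at most \<open>k\<close> reduces the approximation to bounded functions, for which
  the continuous functions converging almost everywhere to \<open>f\<close> can be truncated as well.\<close>

lemma absolutely_integrable_approximate_continuous:
  fixes f :: "real \<Rightarrow> 'b::euclidean_space"
  assumes f: "f absolutely_integrable_on {a..b}" and e: "0 < e"
  obtains g where "continuous_on UNIV g" "bounded (range g)"
    "(\<lambda>x. norm (f x - g x)) integrable_on {a..b}" "integral {a..b} (\<lambda>x. norm (f x - g x)) < e"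
proof -
  define M where "M = lebesgue_on {a..b}"
  have S: "{a..b} \<in> sets lebesgue" by simp
  have fm: "f \<in> borel_measurable M" "integrable M (\<lambda>x. norm (f x))"
    using f by (auto simp: M_def absolutely_integrable_measurable[OF S] o_def)
  interpret finite_measure M unfolding M_def by (rule finite_measure_lebesgue_on) simp
  \<comment> \<open>The radial retraction onto the ball of radius k, in a form that is visibly
    continuous.\<close>
  define cl where "cl = (\<lambda>(k::real) (v::'b). v /\<^sub>R max 1 (norm v / k))"
  have cl_cont: "continuous_on UNIV (cl k)" if "k > 0" for k
    unfolding cl_def using that by (intro continuous_intros) auto
  have cl_meas: "cl k \<in> borel_measurable borel" if "k > 0" for k
    by (rule borel_measurable_continuous_onI[OF cl_cont[OF that]])
  have cl_bound: "norm (cl k v) \<le> k" if "k > 0" for k v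
    using that by (cases "norm v \<le> k") (auto simp: cl_def max_def field_simps)
  have cl_eq: "cl k v = v" if "k > 0" "norm v \<le> k" for k v
    using that by (simp add: cl_def max_def field_simps)
  have cl_diff: "norm (v - cl k v) \<le> norm v" if "k > 0" for k v
  proof -
    define t where "t = inverse (max 1 (norm v / k))"
    have t: "0 \<le> t" "t \<le> 1" by (auto simp: t_def inverse_le_1_iff)
    have "v - cl k v = (1 - t) *\<^sub>R v" by (simp add: cl_def t_def scaleR_diff_left)
    then show ?thesis using t by (simp add: mult_left_le_one_le)
  qed
  have lim1: "(\<lambda>n. \<integral>x. norm (f x - cl (real (Suc n)) (f x)) \<partial>M) \<longlonglongrightarrow> (\<integral>x. 0 \<partial>M)"
  proof (rule integral_dominated_convergence[where w = "\<lambda>x. norm (f x)"])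
    show "(\<lambda>x. norm (f x - cl (real (Suc n)) (f x))) \<in> borel_measurable M" for n
      using fm(1) measurable_compose[OF fm(1) cl_meas[of "real (Suc n)"]] by simp
    show "AE x in M. (\<lambda>n. norm (f x - cl (real (Suc n)) (f x))) \<longlonglongrightarrow> 0"
    proof (rule AE_I2)
      fix x
      obtain N :: nat where N: "norm (f x) \<le> real N" using real_arch_simple by blast
      have "\<forall>\<^sub>F n in sequentially. norm (f x - cl (real (Suc n)) (f x)) = 0"
        using eventually_ge_at_top[of N] by eventually_elim (use N in \<open>auto intro!: cl_eq[symmetric]\<close>)
      then show "(\<lambda>n. norm (f x - cl (real (Suc n)) (f x))) \<longlonglongrightarrow> 0" by (rule tendsto_eventually)
    qed
    show "AE x in M. norm (norm (f x - cl (real (Suc n)) (f x))) \<le> norm (f x)" for n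
      using cl_diff by simp
  qed (use fm in auto)
  then have "(\<lambda>n. \<integral>x. norm (f x - cl (real (Suc n)) (f x)) \<partial>M) \<longlonglongrightarrow> 0" by simp
  from order_tendstoD(2)[OF this, of "e/2"] e obtain m where m: "(\<integral>x. norm (f x - cl (real (Suc m)) (f x)) \<partial>M) < e/2"
    by (auto dest: eventually_happens)
  define k where "k = real (Suc m)"
  have k: "k > 0" by (simp add: k_def)
  \<comment> \<open>\<open>measurable_on\<close> provides continuous functions that converge to
    \<open>f\<close> off a null set.\<close>
  have "f measurable_on {a..b}" using fm(1) by (simp add: measurable_on_iff_borel_measurable[OF S] M_def)
  then obtain N g where N: "negligible N" and gc: "\<And>n::nat. continuous_on UNIV (g n)"
    and gl: "\<And>x. x \<notin> N \<Longrightarrow> (\<lambda>n. g n x) \<longlonglongrightarrow> (if x \<in> {a..b} then f x else 0)"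
    unfolding measurable_on_def by auto
  define h where "h = (\<lambda>n x. cl k (g n x))"
  have hc: "continuous_on UNIV (h n)" for n
    unfolding h_def using continuous_on_compose2[OF cl_cont[OF k] gc[of n]] by simp
  have hm: "h n \<in> borel_measurable M" for n
  proof -
    have "h n \<in> borel_measurable borel" using hc by (rule borel_measurable_continuous_onI)
    then have "h n \<in> borel_measurable lebesgue" by (simp add: measurable_completion)
    then show ?thesis unfolding M_def by (rule measurable_restrict_space1)
  qed
  have fkm: "(\<lambda>x. cl k (f x)) \<in> borel_measurable M" using measurable_compose[OF fm(1) cl_meas[OF k]] .
  \<comment> \<open>Truncation supplies the constant majorant 2 k, which is integrable on a space of
    finite measure.\<close>
  have lim2: "(\<lambda>n. \<integral>x. norm (cl k (f x) - h n x) \<partial>M) \<longlonglongrightarrow> (\<integral>x. 0 \<partial>M)"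
  proof (rule integral_dominated_convergence[where w = "\<lambda>x. 2 * k"])
    show "(\<lambda>x. norm (cl k (f x) - h n x)) \<in> borel_measurable M" for n using fkm hm by simp
    have "AE x in lebesgue. x \<notin> N" using N by (simp add: negligible_iff_null_sets AE_not_in)
    then have "AE x in M. x \<notin> N \<and> x \<in> {a..b}"
      unfolding M_def by (subst AE_restrict_space_iff) (auto elim: eventually_mono)
    then show "AE x in M. (\<lambda>n. norm (cl k (f x) - h n x)) \<longlonglongrightarrow> 0"
    proof eventually_elim
      case (elim x)
      have "(\<lambda>n. cl k (g n x)) \<longlonglongrightarrow> cl k (f x)"
        by (rule continuous_on_tendsto_compose[OF cl_cont[OF k]]) (use gl[of x] elim in auto)
      then have "(\<lambda>n. norm (cl k (f x) - h n x)) \<longlonglongrightarrow> norm (cl k (f x) - cl k (f x))"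
        unfolding h_def by (intro tendsto_intros)
      then show ?case by simp
    qed
    show "AE x in M. norm (norm (cl k (f x) - h n x)) \<le> 2 * k" for n
    proof (rule AE_I2)
      fix x
      have "norm (cl k (f x) - h n x) \<le> norm (cl k (f x)) + norm (h n x)" by (rule norm_triangle_ineq4)
      also have "\<dots> \<le> k + k" unfolding h_def by (intro add_mono cl_bound[OF k])
      finally show "norm (norm (cl k (f x) - h n x)) \<le> 2 * k" by simp
    qed
  qed auto
  then have "(\<lambda>n. \<integral>x. norm (cl k (f x) - h n x) \<partial>M) \<longlonglongrightarrow> 0" by simp
  from order_tendstoD(2)[OF this, of "e/2"] e obtain n where n: "(\<integral>x. norm (cl k (f x) - h n x) \<partial>M) < e/2"
    by (auto dest: eventually_happens)
  have i1: "integrable M (\<lambda>x. norm (f x - cl k (f x)))"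
    by (rule Bochner_Integration.integrable_bound[OF fm(2)]) (use fm(1) fkm cl_diff[OF k] in auto)
  have i2: "integrable M (\<lambda>x. norm (cl k (f x) - h n x))"
  proof (rule Bochner_Integration.integrable_bound[of M "\<lambda>x. 2 * k"])
    show "AE x in M. norm (norm (cl k (f x) - h n x)) \<le> norm (2 * k)"
    proof (rule AE_I2)
      fix x
      have "norm (cl k (f x) - h n x) \<le> norm (cl k (f x)) + norm (h n x)" by (rule norm_triangle_ineq4)
      also have "\<dots> \<le> k + k" unfolding h_def by (intro add_mono cl_bound[OF k])
      finally show "norm (norm (cl k (f x) - h n x)) \<le> norm (2 * k)" using k by simp
    qed
  qed (use fkm hm in auto)
  have tri: "norm (f x - h n x) \<le> norm (f x - cl k (f x)) + norm (cl k (f x) - h n x)" for x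
    using norm_triangle_ineq[of "f x - cl k (f x)" "cl k (f x) - h n x"] by simp
  have i3: "integrable M (\<lambda>x. norm (f x - h n x))"
  proof (rule Bochner_Integration.integrable_bound[OF Bochner_Integration.integrable_add[OF i1 i2]])
    show "AE x in M. norm (norm (f x - h n x)) \<le> norm (norm (f x - cl k (f x)) + norm (cl k (f x) - h n x))"
      using tri by (intro AE_I2) simp
  qed (use fm(1) hm in auto)
  have "(\<integral>x. norm (f x - h n x) \<partial>M) \<le> (\<integral>x. norm (f x - cl k (f x)) + norm (cl k (f x) - h n x) \<partial>M)"
    by (intro integral_mono i3 Bochner_Integration.integrable_add i1 i2 tri)
  also have "\<dots> < e/2 + e/2"
    using m n unfolding k_def[symmetric] by (subst Bochner_Integration.integral_add[OF i1 i2]) linarith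
  finally have "integral {a..b} (\<lambda>x. norm (f x - h n x)) < e"
    using lebesgue_integral_eq_integral[OF i3[unfolded M_def] S] by (simp add: M_def)
  moreover have "(\<lambda>x. norm (f x - h n x)) integrable_on {a..b}"
    using i3 unfolding M_def by (rule integrable_on_lebesgue_on) simp
  moreover have "bounded (range (h n))"
    unfolding bounded_iff h_def using cl_bound[OF k] by blast
  ultimately show thesis using hc by (intro that[of "h n"])
qed

text \<open>A point lies in at most one of the disjoint open intervals, so the restrictions of
  \<open>h\<close> to them add up to at most \<open>h\<close>.\<close>

lemma nonoverlapping_sum_integral_le:
  fixes h :: "real \<Rightarrow> real"
  assumes I: "nonoverlapping {a..b} I c d" and h: "h integrable_on {a..b}" "\<And>x. 0 \<le> h x"
  shows "(\<Sum>i\<in>I. integral {c i..d i} h) \<le> integral {a..b} h"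
proof -
  have fin: "finite I" using I by (simp add: nonoverlapping_def)
  have sub: "{c i<..<d i} \<inter> {a..b} = {c i<..<d i}" if "i \<in> I" for i
    using nonoverlappingD(4)[OF I that] by force
  have int: "(\<lambda>x. if x \<in> {c i<..<d i} then h x else 0) integrable_on {a..b}"
    "integral {a..b} (\<lambda>x. if x \<in> {c i<..<d i} then h x else 0) = integral {c i..d i} h" if "i \<in> I" for i
  proof -
    have "h integrable_on {c i..d i}"
      using h(1) nonoverlappingD(4)[OF I that] by (rule integrable_on_subinterval)
    then show "(\<lambda>x. if x \<in> {c i<..<d i} then h x else 0) integrable_on {a..b}"
      unfolding integrable_restrict_Int sub[OF that] by (simp add: integrable_on_Icc_iff_Ioo)
    show "integral {a..b} (\<lambda>x. if x \<in> {c i<..<d i} then h x else 0) = integral {c i..d i} h"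
      unfolding Henstock_Kurzweil_Integration.integral_restrict_Int sub[OF that] by (simp add: integral_open_interval_real)
  qed
  have "(\<Sum>i\<in>I. integral {c i..d i} h) = integral {a..b} (\<lambda>x. \<Sum>i\<in>I. if x \<in> {c i<..<d i} then h x else 0)"
    using int fin by (simp add: Henstock_Kurzweil_Integration.integral_sum)
  also have "\<dots> \<le> integral {a..b} h"
  proof (rule integral_le)
    show "(\<lambda>x. \<Sum>i\<in>I. if x \<in> {c i<..<d i} then h x else 0) integrable_on {a..b}"
      using int fin by (intro integrable_sum) auto
    fix x
    show "(\<Sum>i\<in>I. if x \<in> {c i<..<d i} then h x else 0) \<le> h x"
    proof (cases "\<exists>j\<in>I. x \<in> {c j<..<d j}")
      case True
      then obtain j where j: "j \<in> I" "x \<in> {c j<..<d j}" by blast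
      have "(if x \<in> {c i<..<d i} then h x else 0) = (if i = j then h x else 0)" if "i \<in> I" for i
      proof (cases "i = j")
        case False
        then have "{c i<..<d i} \<inter> {c j<..<d j} = {}"
          using I j that unfolding nonoverlapping_def disjoint_family_on_def by blast
        then have "x \<notin> {c i<..<d i}" using j by blast
        then show ?thesis using False by auto
      qed (use j in simp)
      then have "(\<Sum>i\<in>I. if x \<in> {c i<..<d i} then h x else 0) = (\<Sum>i\<in>I. if i = j then h x else 0)"
        by (intro sum.cong) auto
      then show ?thesis using fin j by simp
    next
      case False
      then have "(\<Sum>i\<in>I. if x \<in> {c i<..<d i} then h x else 0) = 0" by (intro sum.neutral) auto
      then show ?thesis using h(2) by simp
    qed
  qed (rule h(1))
  finally show ?thesis .
qed

section \<open>Indefinite integrals\<close>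

lemma indefinite_integral_diff:
  fixes f :: "real \<Rightarrow> 'a::banach"
  assumes "f integrable_on {a..b}" "a \<le> c" "c \<le> d" "d \<le> b"
  shows "integral {a..d} f - integral {a..c} f = integral {c..d} f"
proof -
  have "f integrable_on {a..d}" by (rule integrable_on_subinterval[OF assms(1)]) (use assms in auto)
  from Henstock_Kurzweil_Integration.integral_combine[OF assms(2,3) this] show ?thesis by (simp add: algebra_simps)
qed

text \<open>Up to an error that is small in the mean, \<open>f\<close> is bounded by some M. The
  bounded part contributes at most M times the total length of the family, the error at most its
  full integral, whatever the family.\<close>

lemma absolutely_continuous_on_indefinite_integral:
  fixes f :: "real \<Rightarrow> 'b::euclidean_space"
  assumes f: "f absolutely_integrable_on {a..b}"
  shows "absolutely_continuous_on {a..b} (\<lambda>t. integral {a..t} f)"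
proof (rule absolutely_continuous_onI)
  fix \<epsilon> :: real assume "\<epsilon> > 0"
  then have "\<epsilon>/2 > 0" by simp
  from absolutely_integrable_approximate_continuous[OF f this]
  obtain g where g: "continuous_on UNIV g" "bounded (range g)" "(\<lambda>x. norm (f x - g x)) integrable_on {a..b}"
    "integral {a..b} (\<lambda>x. norm (f x - g x)) < \<epsilon>/2" by metis
  obtain M where M: "M > 0" "\<And>x. norm (g x) \<le> M" using g(2) by (auto simp: bounded_pos)
  have fi: "f integrable_on {a..b}" using f absolutely_integrable_on_def by blast
  have "(\<Sum>i\<in>I. norm (integral {a..d i} f - integral {a..c i} f)) < \<epsilon>"
    if I: "nonoverlapping {a..b} I c d" and small: "(\<Sum>i\<in>I. d i - c i) < \<epsilon> / (2 * M)" for I :: "real set set" and c d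
  proof -
    have "(\<Sum>i\<in>I. norm (integral {a..d i} f - integral {a..c i} f)) \<le>
      (\<Sum>i\<in>I. integral {c i..d i} (\<lambda>x. norm (f x - g x)) + M * (d i - c i))"
    proof (rule sum_mono)
      fix i assume i: "i \<in> I"
      note cd = nonoverlappingD[OF I i]
      have sub: "h integrable_on {c i..d i}" if "h integrable_on {a..b}" for h :: "real \<Rightarrow> 'z::banach"
        using that cd(4) by (rule integrable_on_subinterval)
      have "norm (integral {a..d i} f - integral {a..c i} f) = norm (integral {c i..d i} f)"
        using cd by (simp add: indefinite_integral_diff[OF fi])
      also have "\<dots> \<le> integral {c i..d i} (\<lambda>x. norm (f x - g x) + M)"
      proof (rule Henstock_Kurzweil_Integration.integral_norm_bound_integral[OF sub[OF fi]])
        show "(\<lambda>x. norm (f x - g x) + M) integrable_on {c i..d i}"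
          using sub[OF g(3)] by (intro integrable_add) auto
        fix x show "norm (f x) \<le> norm (f x - g x) + M"
          using norm_triangle_ineq[of "f x - g x" "g x"] M(2)[of x] by simp
      qed
      also have "\<dots> = integral {c i..d i} (\<lambda>x. norm (f x - g x)) + M * (d i - c i)"
        using sub[OF g(3)] cd by (subst Henstock_Kurzweil_Integration.integral_add) auto
      finally show "norm (integral {a..d i} f - integral {a..c i} f) \<le> \<dots>" .
    qed
    also have "\<dots> = (\<Sum>i\<in>I. integral {c i..d i} (\<lambda>x. norm (f x - g x))) + M * (\<Sum>i\<in>I. d i - c i)"
      by (simp only: sum.distrib sum_distrib_left)
    also have "\<dots> < \<epsilon>/2 + M * (\<epsilon> / (2 * M))"
    proof (rule add_less_le_mono)
      show "(\<Sum>i\<in>I. integral {c i..d i} (\<lambda>x. norm (f x - g x))) < \<epsilon>/2"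
        using nonoverlapping_sum_integral_le[OF I g(3)] g(4) by simp
      show "M * (\<Sum>i\<in>I. d i - c i) \<le> M * (\<epsilon> / (2 * M))" using small M by (intro mult_left_mono) auto
    qed
    also have "\<dots> = \<epsilon>" using M by simp
    finally show ?thesis .
  qed
  then show "\<exists>\<delta>>0. \<forall>(I :: real set set) c d. nonoverlapping {a..b} I c d \<longrightarrow> (\<Sum>i\<in>I. d i - c i) < \<delta> \<longrightarrow>
        (\<Sum>i\<in>I. norm (integral {a..d i} f - integral {a..c i} f)) < \<epsilon>"
    using M \<open>\<epsilon> > 0\<close> by (intro exI[of _ "\<epsilon> / (2 * M)"]) auto
qed

text \<open>This is the shape in which \<open>integrable_ccontinuous_explicit\<close> delivers
  derivatives of integrals, one side at a time.\<close>

lemma has_vector_derivative_atI: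
  fixes F :: "real \<Rightarrow> 'a::real_normed_vector"
  assumes "\<And>e. e > 0 \<Longrightarrow> \<exists>d>0. \<forall>h. 0 < h \<and> h < d \<longrightarrow> norm ((F (x + h) - F x) /\<^sub>R h - v) < e"
    and "\<And>e. e > 0 \<Longrightarrow> \<exists>d>0. \<forall>h. 0 < h \<and> h < d \<longrightarrow> norm ((F x - F (x - h)) /\<^sub>R h - v) < e"
  shows "(F has_vector_derivative v) (at x)"
  unfolding has_vector_derivative_def has_derivative_at_alt
proof (intro conjI allI impI)
  show "bounded_linear (\<lambda>t. t *\<^sub>R v)" by (rule bounded_linear_scaleR_left)
  fix e :: real assume e: "e > 0"
  obtain d1 where d1: "d1 > 0" "\<forall>h. 0 < h \<and> h < d1 \<longrightarrow> norm ((F (x + h) - F x) /\<^sub>R h - v) < e" using assms(1)[OF e] by blast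
  obtain d2 where d2: "d2 > 0" "\<forall>h. 0 < h \<and> h < d2 \<longrightarrow> norm ((F x - F (x - h)) /\<^sub>R h - v) < e" using assms(2)[OF e] by blast
  have "norm (F y - F x - (y - x) *\<^sub>R v) \<le> e * norm (y - x)" if y: "norm (y - x) < min d1 d2" for y
  proof -
    consider "y = x" | "y > x" | "y < x" by linarith
    then show ?thesis
    proof cases
      case 2
      then have "norm ((F y - F x) /\<^sub>R (y - x) - v) < e" using spec[OF d1(2), of "y - x"] y by simp
      then have "(y - x) * norm ((F y - F x) /\<^sub>R (y - x) - v) \<le> (y - x) * e" using 2 by (intro mult_left_mono) auto
      also have "(y - x) * norm ((F y - F x) /\<^sub>R (y - x) - v) = norm ((y - x) *\<^sub>R ((F y - F x) /\<^sub>R (y - x) - v))" using 2 by simp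
      also have "(y - x) *\<^sub>R ((F y - F x) /\<^sub>R (y - x) - v) = F y - F x - (y - x) *\<^sub>R v" using 2 by (simp add: scaleR_diff_right)
      finally show ?thesis using 2 by (simp add: mult.commute)
    next
      case 3
      then have "norm ((F x - F y) /\<^sub>R (x - y) - v) < e" using spec[OF d2(2), of "x - y"] y by simp
      then have "(x - y) * norm ((F x - F y) /\<^sub>R (x - y) - v) \<le> (x - y) * e" using 3 by (intro mult_left_mono) auto
      also have "(x - y) * norm ((F x - F y) /\<^sub>R (x - y) - v) = norm ((x - y) *\<^sub>R ((F x - F y) /\<^sub>R (x - y) - v))" using 3 by simp
      also have "(x - y) *\<^sub>R ((F x - F y) /\<^sub>R (x - y) - v) = - (F y - F x - (y - x) *\<^sub>R v)" using 3 by (simp add: scaleR_diff_right scaleR_diff_left)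
      finally show ?thesis using 3 unfolding norm_minus_cancel by (simp add: mult.commute)
    qed simp
  qed
  then show "\<exists>d>0. \<forall>y. norm (y - x) < d \<longrightarrow> norm (F y - F x - (y - x) *\<^sub>R v) \<le> e * norm (y - x)"
    using d1(1) d2(1) by (intro exI[of _ "min d1 d2"]) simp
qed

text \<open>Lebesgue differentiation. Right difference quotients come from the one-sided theorem for
  \<open>f\<close>, left ones from the same theorem for the reflected function.\<close>

lemma ac_primitive_indefinite_integral:
  fixes f :: "real \<Rightarrow> 'b::euclidean_space"
  assumes f: "f absolutely_integrable_on {a..b}"
  shows "ac_primitive a b (\<lambda>t. integral {a..t} f) f"
  unfolding ac_primitive_def
proof
  show "absolutely_continuous_on {a..b} (\<lambda>t. integral {a..t} f)"
    by (rule absolutely_continuous_on_indefinite_integral[OF f])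
  have fi: "f integrable_on {a..b}" using f absolutely_integrable_on_def by blast
  \<comment> \<open>Extension by zero makes the function integrable on every bounded interval, as
    the one-sided theorem demands.\<close>
  define f0 where "f0 = (\<lambda>x. if x \<in> {a..b} then f x else 0)"
  have f0i: "f0 integrable_on UNIV" unfolding f0_def integrable_restrict_UNIV by (rule fi)
  then have f0c: "f0 integrable_on {u..v}" for u v by (rule integrable_on_subinterval) simp
  have f0r: "(\<lambda>x. f0 (- x)) integrable_on cbox u v" for u v
    using Henstock_Kurzweil_Integration.integrable_reflect_real[where f = f0 and a = "- v" and b = "- u"] f0c[of "-v" "-u"] by simp
  obtain N1 where N1: "negligible N1" "\<And>x e. x \<notin> N1 \<Longrightarrow> 0 < e \<Longrightarrow>
      \<exists>d>0. \<forall>h. 0 < h \<and> h < d \<longrightarrow> norm (integral {x..x + h} f0 /\<^sub>R h - f0 x) < e"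
    using integrable_ccontinuous_explicit[of f0] f0c by (simp add: cbox_interval) metis
  obtain N2 where N2: "negligible N2" "\<And>x e. x \<notin> N2 \<Longrightarrow> 0 < e \<Longrightarrow>
      \<exists>d>0. \<forall>h. 0 < h \<and> h < d \<longrightarrow> norm (integral {x..x + h} (\<lambda>x. f0 (- x)) /\<^sub>R h - f0 (- x)) < e"
    using integrable_ccontinuous_explicit[of "\<lambda>x. f0 (- x)"] f0r by (simp add: cbox_interval) metis
  have diff: "integral {a..v} f - integral {a..u} f = integral {u..v} f0" if "a \<le> u" "u \<le> v" "v \<le> b" for u v
  proof -
    have "integral {u..v} f0 = integral {u..v} f"
      by (rule Henstock_Kurzweil_Integration.integral_cong) (use that in \<open>auto simp: f0_def\<close>)
    then show ?thesis using indefinite_integral_diff[OF fi that] by simp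
  qed
  \<comment> \<open>The exceptional set of the left quotients is the reflection of a null set, hence
    null.\<close>
  have "negligible (N1 \<union> uminus ` N2)"
    using N1(1) N2(1) by (intro negligible_Un negligible_differentiable_image_negligible)
      (auto intro!: differentiable_on_minus differentiable_on_ident)
  then show "AE x in lborel. a < x \<and> x < b \<longrightarrow> ((\<lambda>t. integral {a..t} f) has_vector_derivative f x) (at x)"
  proof (rule negligible_imp_AE_lborel, intro impI has_vector_derivative_atI)
    fix x e :: real assume x: "x \<notin> N1 \<union> uminus ` N2" "a < x \<and> x < b" and e: "e > 0"
    have f0x: "f0 x = f x" using x by (simp add: f0_def)
    have "- x \<notin> N2" using x by (metis UnCI imageI minus_minus)
    obtain d1 where d1: "d1 > 0" "\<forall>h. 0 < h \<and> h < d1 \<longrightarrow> norm (integral {x..x + h} f0 /\<^sub>R h - f0 x) < e"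
      using N1(2)[of x e] x e by blast
    obtain d2 where d2: "d2 > 0" "\<forall>h. 0 < h \<and> h < d2 \<longrightarrow> norm (integral {- x..- x + h} (\<lambda>x. f0 (- x)) /\<^sub>R h - f0 x) < e"
      using N2(2)[OF \<open>- x \<notin> N2\<close> e] by auto
    show "\<exists>d>0. \<forall>h. 0 < h \<and> h < d \<longrightarrow> norm ((integral {a..x + h} f - integral {a..x} f) /\<^sub>R h - f x) < e"
      using d1 x by (intro exI[of _ "min d1 (b - x)"]) (auto simp: diff f0x)
    have "integral {- x..- x + h} (\<lambda>x. f0 (- x)) = integral {x - h..x} f0" for h
      using Henstock_Kurzweil_Integration.integral_reflect_real[where f = f0 and a = "x - h" and b = x] by simp
    then show "\<exists>d>0. \<forall>h. 0 < h \<and> h < d \<longrightarrow> norm ((integral {a..x} f - integral {a..x - h} f) /\<^sub>R h - f x) < e"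
      using d2 x by (intro exI[of _ "min d2 (x - a)"]) (auto simp: diff f0x)
  qed
qed

section \<open>Differentiability almost everywhere\<close>

text \<open>Families may leave gaps. Filling the gaps only increases the sum, so the supremum is the
  usual total variation, obtained without handling partitions.\<close>

definition variation :: "(real \<Rightarrow> 'a::real_normed_vector) \<Rightarrow> real \<Rightarrow> real \<Rightarrow> real" where
  "variation f a b = Sup {\<Sum>i\<in>I. norm (f (d i) - f (c i)) | (I :: nat set) c d. nonoverlapping {a..b} I c d}"

lemma variation_bdd:
  assumes "absolutely_continuous_on {a..b} f"
  shows "bdd_above {\<Sum>i\<in>I. norm (f (d i) - f (c i)) | (I :: nat set) c d. nonoverlapping {a..b} I c d}"
proof -
  obtain B where "0 \<le> B" and B: "\<And>(I :: nat set) c d. nonoverlapping {a..b} I c d \<Longrightarrow> (\<Sum>i\<in>I. norm (f (d i) - f (c i))) \<le> B"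
    using absolutely_continuous_on_imp_bounded_variation[OF assms] by blast
  show ?thesis
  proof (rule bdd_aboveI)
    fix s assume "s \<in> {\<Sum>i\<in>I. norm (f (d i) - f (c i)) | (I :: nat set) c d. nonoverlapping {a..b} I c d}"
    then obtain I :: "nat set" and c d where "s = (\<Sum>i\<in>I. norm (f (d i) - f (c i)))" "nonoverlapping {a..b} I c d"
      by (elim CollectE exE conjE)
    then show "s \<le> B" using B by simp
  qed
qed

lemma variation_upper:
  assumes "absolutely_continuous_on {a..b} f" and I: "nonoverlapping {a..b} (I :: nat set) c d"
  shows "(\<Sum>i\<in>I. norm (f (d i) - f (c i))) \<le> variation f a b"
  unfolding variation_def by (rule cSup_upper[OF _ variation_bdd[OF assms(1)]]) (use I in blast)

lemma variation_least:
  assumes "\<And>(I :: nat set) c d. nonoverlapping {a..b} I c d \<Longrightarrow> (\<Sum>i\<in>I. norm (f (d i) - f (c i))) \<le> B"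
  shows "variation f a b \<le> B"
  unfolding variation_def
proof (rule cSup_least)
  have "nonoverlapping {a..b} ({} :: nat set) c d" for c d by (simp add: nonoverlapping_def disjoint_family_on_def)
  then show "{\<Sum>i\<in>I. norm (f (d i) - f (c i)) | (I :: nat set) c d. nonoverlapping {a..b} I c d} \<noteq> {}" by blast
qed (use assms in blast)

lemma variation_approx:
  assumes "0 < \<epsilon>"
  obtains I :: "nat set" and c d where "nonoverlapping {a..b} I c d" "variation f a b - \<epsilon> < (\<Sum>i\<in>I. norm (f (d i) - f (c i)))"
proof -
  have "variation f a b - \<epsilon> < variation f a b" using assms by simp
  moreover have "nonoverlapping {a..b} ({} :: nat set) c d" for c d by (simp add: nonoverlapping_def disjoint_family_on_def)
  ultimately show thesis
    using that unfolding variation_def by (elim less_cSupE) blast+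
qed

text \<open>Any family in [a, x] can be enlarged by the interval [x, y] under a fresh index. For
  real \<open>f\<close> it follows that both the variation and its difference with \<open>f\<close>
  are increasing.\<close>

lemma variation_superadditive:
  assumes f: "absolutely_continuous_on {a..b} f" and xy: "a \<le> x" "x \<le> y" "y \<le> b"
  shows "variation f a x + norm (f y - f x) \<le> variation f a y"
proof -
  have fy: "absolutely_continuous_on {a..y} f" using f by (rule absolutely_continuous_on_subset) (use xy in auto)
  have "variation f a x \<le> variation f a y - norm (f y - f x)"
  proof (rule variation_least)
    fix I :: "nat set" and c d assume I: "nonoverlapping {a..x} I c d"
    then have fin: "finite I" by (simp add: nonoverlapping_def)
    then obtain k where k: "k \<notin> I" by (meson ex_new_if_finite infinite_UNIV_nat)
    define c' where "c' = c(k := x)"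
    define d' where "d' = d(k := y)"
    have same: "c' i = c i" "d' i = d i" if "i \<in> I" for i using that k by (auto simp: c'_def d'_def)
    have "nonoverlapping {a..y} (insert k I) c' d'"
      unfolding nonoverlapping_def
    proof (intro conjI ballI)
      show "finite (insert k I)" using fin by simp
      fix i assume "i \<in> insert k I"
      then show "c' i \<le> d' i" "{c' i..d' i} \<subseteq> {a..y}"
        using nonoverlappingD[OF I, of i] same[of i] xy by (cases "i = k"; simp add: c'_def d'_def)+
    next
      have "{c' k<..<d' k} \<inter> {c i<..<d i} = {}" if "i \<in> I" for i
        unfolding greaterThanLessThan_disjoint_iff using nonoverlappingD(3)[OF I that] by (simp add: c'_def d'_def)
      moreover have "disjoint_family_on (\<lambda>i. {c' i<..<d' i}) I"
        using I same unfolding nonoverlapping_def disjoint_family_on_def by simp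
      ultimately show "disjoint_family_on (\<lambda>i. {c' i<..<d' i}) (insert k I)"
        using k same unfolding disjoint_family_on_def by (simp add: Int_commute del: Int_greaterThanLessThan)
    qed
    from variation_upper[OF fy this]
    have "norm (f (d' k) - f (c' k)) + (\<Sum>i\<in>I. norm (f (d' i) - f (c' i))) \<le> variation f a y"
      using fin k by simp
    then show "(\<Sum>i\<in>I. norm (f (d i) - f (c i))) \<le> variation f a y - norm (f y - f x)"
      by (simp add: c'_def d'_def same cong: sum.cong) (use same in \<open>simp add: c'_def d'_def cong: sum.cong\<close>)
  qed
  then show ?thesis by simp
qed

lemma variation_subadditive:
  assumes f: "absolutely_continuous_on {a..b} f" and xy: "a \<le> x" "x \<le> y" "y \<le> b"
  shows "variation f a y \<le> variation f a x + variation f x y"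
proof (rule variation_least)
  fix I :: "nat set" and c d assume I: "nonoverlapping {a..y} I c d"
  have fs: "absolutely_continuous_on {a..x} f" "absolutely_continuous_on {x..y} f"
    using f by (rule absolutely_continuous_on_subset; use xy in auto)+
  have "(\<Sum>i\<in>I. norm (f (d i) - f (c i))) \<le>
      (\<Sum>i\<in>I. norm (f (min x (d i)) - f (min x (c i))) + norm (f (max x (d i)) - f (max x (c i))))"
    using nonoverlappingD(1)[OF I] by (intro sum_mono norm_diff_split_le)
  also have "\<dots> \<le> variation f a x + variation f x y"
    unfolding sum.distrib
    by (intro add_mono variation_upper fs nonoverlapping_min[OF I] nonoverlapping_max[OF I] xy)
  finally show "(\<Sum>i\<in>I. norm (f (d i) - f (c i))) \<le> variation f a x + variation f x y" .
qed

text \<open>Almost optimal families inside the given intervals are pooled into a single family of no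
  greater total length, to which the absolute continuity of \<open>f\<close> applies.\<close>

lemma variation_absolutely_continuous:
  assumes f: "absolutely_continuous_on {a..b} f"
  shows "absolutely_continuous_on {a..b} (variation f a)"
proof (rule absolutely_continuous_onI)
  fix \<epsilon> :: real assume "\<epsilon> > 0"
  then have "\<epsilon>/2 > 0" by simp
  obtain \<delta> where \<delta>: "\<delta> > 0" "\<And>(I :: (real set \<times> nat) set) c d. nonoverlapping {a..b} I c d \<Longrightarrow> (\<Sum>i\<in>I. d i - c i) < \<delta> \<Longrightarrow>
        (\<Sum>i\<in>I. norm (f (d i) - f (c i))) < \<epsilon>/2"
    using absolutely_continuous_on_families[OF f \<open>\<epsilon>/2 > 0\<close>] by blast
  have "(\<Sum>i\<in>I. norm (variation f a (d i) - variation f a (c i))) < \<epsilon>"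
    if I: "nonoverlapping {a..b} I c d" and small: "(\<Sum>i\<in>I. d i - c i) < \<delta>" for I :: "real set set" and c d
  proof -
    have fin: "finite I" using I by (simp add: nonoverlapping_def)
    \<comment> \<open>The loss \<eta> occurs once per interval and so adds up to at most
      \<epsilon>/2; the summand 1 covers the empty family.\<close>
    define \<eta> where "\<eta> = \<epsilon> / (2 * (real (card I) + 1))"
    have \<eta>: "\<eta> > 0" using \<open>\<epsilon> > 0\<close> by (simp add: \<eta>_def)
    have "\<exists>q. nonoverlapping {c i..d i} (fst q :: nat set) (fst (snd q)) (snd (snd q)) \<and>
        variation f (c i) (d i) - \<eta> < (\<Sum>k\<in>fst q. norm (f (snd (snd q) k) - f (fst (snd q) k)))" for i
    proof -
      obtain J :: "nat set" and u v where "nonoverlapping {c i..d i} J u v"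
        "variation f (c i) (d i) - \<eta> < (\<Sum>k\<in>J. norm (f (v k) - f (u k)))"
        using variation_approx[OF \<eta>, of "c i" "d i" f] by blast
      then show ?thesis by (intro exI[of _ "(J, u, v)"]) simp
    qed
    then have "\<forall>i. \<exists>q. nonoverlapping {c i..d i} (fst q :: nat set) (fst (snd q)) (snd (snd q)) \<and>
        variation f (c i) (d i) - \<eta> < (\<Sum>k\<in>fst q. norm (f (snd (snd q) k) - f (fst (snd q) k)))" ..
    from choice[OF this] obtain q where q: "\<forall>i. nonoverlapping {c i..d i} (fst (q i) :: nat set) (fst (snd (q i))) (snd (snd (q i))) \<and>
        variation f (c i) (d i) - \<eta> < (\<Sum>k\<in>fst (q i). norm (f (snd (snd (q i)) k) - f (fst (snd (q i)) k)))" ..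
    define J where "J = (\<lambda>i. fst (q i))"
    define u where "u = (\<lambda>i. fst (snd (q i)))"
    define v where "v = (\<lambda>i. snd (snd (q i)))"
    have no: "nonoverlapping {c i..d i} (J i) (u i) (v i)"
      and approx: "variation f (c i) (d i) - \<eta> < (\<Sum>k\<in>J i. norm (f (v i k) - f (u i k)))" for i
      using spec[OF q, of i] by (simp_all add: J_def u_def v_def)
    define L where "L = Sigma I J"
    have finL: "finite L" unfolding L_def using fin no by (auto simp: nonoverlapping_def)
    have noL: "nonoverlapping {a..b} L (\<lambda>p. u (fst p) (snd p)) (\<lambda>p. v (fst p) (snd p))"
      unfolding nonoverlapping_def disjoint_family_on_def
    proof (intro conjI ballI impI)
      show "finite L" by (rule finL)
    next
      fix p assume "p \<in> L"
      then have p: "fst p \<in> I" "snd p \<in> J (fst p)" by (auto simp: L_def)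
      show "u (fst p) (snd p) \<le> v (fst p) (snd p)" by (rule nonoverlappingD(1)[OF no p(2)])
      show "{u (fst p) (snd p)..v (fst p) (snd p)} \<subseteq> {a..b}"
        using nonoverlappingD(4)[OF no p(2)] nonoverlappingD(4)[OF I p(1)] by (rule order.trans)
    next
      fix p p' assume "p \<in> L" "p' \<in> L" and ne: "p \<noteq> p'"
      then have p: "fst p \<in> I" "snd p \<in> J (fst p)" "fst p' \<in> I" "snd p' \<in> J (fst p')" by (auto simp: L_def)
      show "{u (fst p) (snd p)<..<v (fst p) (snd p)} \<inter> {u (fst p') (snd p')<..<v (fst p') (snd p')} = {}"
      proof (cases "fst p = fst p'")
        case True
        then have "snd p \<noteq> snd p'" using ne by (auto simp: prod_eq_iff)
        then show ?thesis using no[of "fst p"] p True unfolding nonoverlapping_def disjoint_family_on_def by simp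
      next
        case False
        have "{c (fst p)<..<d (fst p)} \<inter> {c (fst p')<..<d (fst p')} = {}"
          using I p False unfolding nonoverlapping_def disjoint_family_on_def by blast
        moreover have "{u (fst p) (snd p)<..<v (fst p) (snd p)} \<subseteq> {c (fst p)<..<d (fst p)}"
          "{u (fst p') (snd p')<..<v (fst p') (snd p')} \<subseteq> {c (fst p')<..<d (fst p')}"
          using nonoverlappingD(2,3)[OF no p(2)] nonoverlappingD(2,3)[OF no p(4)]
          by (simp_all add: greaterThanLessThan_subseteq_greaterThanLessThan)
        ultimately show ?thesis by blast
      qed
    qed
    have sumL: "(\<Sum>p\<in>L. h (fst p) (snd p)) = (\<Sum>i\<in>I. \<Sum>k\<in>J i. h i k)" for h :: "real set \<Rightarrow> nat \<Rightarrow> real"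
      unfolding L_def using fin no by (subst sum.Sigma) (auto simp: nonoverlapping_def split_beta)
    have "(\<Sum>p\<in>L. v (fst p) (snd p) - u (fst p) (snd p)) \<le> (\<Sum>i\<in>I. d i - c i)"
      unfolding sumL[of "\<lambda>i k. v i k - u i k"]
    proof (rule sum_mono)
      fix i assume i: "i \<in> I"
      \<comment> \<open>The bound on lengths is strict, so it is applied with an arbitrarily small
        surplus \<open>e\<close>.\<close>
      have "(\<Sum>k\<in>J i. v i k - u i k) < (d i - c i) + e" if "e > 0" for e
        using that nonoverlappingD(1)[OF I i]
        by (intro nonoverlapping_sum_length_le[OF no]) (auto simp: ennreal_less_iff emeasure_lborel_Icc_eq)
      then show "(\<Sum>k\<in>J i. v i k - u i k) \<le> d i - c i" by (rule field_le_epsilon[OF less_imp_le])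
    qed
    then have "(\<Sum>p\<in>L. norm (f (v (fst p) (snd p)) - f (u (fst p) (snd p)))) < \<epsilon>/2"
      using small by (intro \<delta>(2)[OF noL]) simp
    then have small2: "(\<Sum>i\<in>I. \<Sum>k\<in>J i. norm (f (v i k) - f (u i k))) < \<epsilon>/2"
      unfolding sumL[of "\<lambda>i k. norm (f (v i k) - f (u i k))"] .
    have "(\<Sum>i\<in>I. norm (variation f a (d i) - variation f a (c i))) \<le> (\<Sum>i\<in>I. (\<Sum>k\<in>J i. norm (f (v i k) - f (u i k))) + \<eta>)"
    proof (rule sum_mono)
      fix i assume i: "i \<in> I"
      have "0 \<le> norm (f (d i) - f (c i))" by simp
      also have "\<dots> \<le> variation f a (d i) - variation f a (c i)"
        using variation_superadditive[OF f, of "c i" "d i"] nonoverlappingD[OF I i] by simp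
      finally have "norm (variation f a (d i) - variation f a (c i)) = variation f a (d i) - variation f a (c i)" by simp
      also have "\<dots> \<le> variation f (c i) (d i)"
        using variation_subadditive[OF f, of "c i" "d i"] nonoverlappingD[OF I i] by simp
      also have "\<dots> \<le> (\<Sum>k\<in>J i. norm (f (v i k) - f (u i k))) + \<eta>" using approx[of i] by simp
      finally show "norm (variation f a (d i) - variation f a (c i)) \<le> \<dots>" .
    qed
    also have "\<dots> = (\<Sum>i\<in>I. \<Sum>k\<in>J i. norm (f (v i k) - f (u i k))) + real (card I) * \<eta>"
      by (simp add: sum.distrib)
    also have "\<dots> < \<epsilon>/2 + \<epsilon>/2"
    proof (rule add_less_le_mono[OF small2])
      show "real (card I) * \<eta> \<le> \<epsilon>/2" using \<open>\<epsilon> > 0\<close> by (simp add: \<eta>_def field_simps)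
    qed
    finally show ?thesis by simp
  qed
  then show "\<exists>\<delta>>0. \<forall>(I :: real set set) c d. nonoverlapping {a..b} I c d \<longrightarrow> (\<Sum>i\<in>I. d i - c i) < \<delta> \<longrightarrow>
        (\<Sum>i\<in>I. norm (variation f a (d i) - variation f a (c i))) < \<epsilon>"
    using \<delta>(1) by (intro exI[of _ \<delta>]) simp
qed

text \<open>A continuous increasing function whose Stieltjes measure is absolutely continuous with respect to
  Lebesgue measure has a Radon--Nikodym density.\<close>

lemma mono_absolutely_continuous_has_derivative:
  fixes h :: "real \<Rightarrow> real"
  assumes ab: "a \<le> b" and h: "absolutely_continuous_on {a..b} h"
    and mono: "\<And>x y. a \<le> x \<Longrightarrow> x \<le> y \<Longrightarrow> y \<le> b \<Longrightarrow> h x \<le> h y"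
  obtains h' where "ac_primitive a b h h'"
proof -
  \<comment> \<open>Freezing \<open>h\<close> outside [a, b] gives a continuous increasing function
    on the whole line, as \<open>interval_measure\<close> requires.\<close>
  define H where "H = (\<lambda>x. h (max a (min b x)))"
  have Hmono: "H x \<le> H y" if "x \<le> y" for x y
    unfolding H_def using ab that by (intro mono) auto
  have hc: "continuous_on {a..b} h"
    by (rule absolutely_continuous_on_imp_continuous_on[OF h]) (simp add: is_interval_1)
  have Hcont: "continuous_on UNIV H"
    unfolding H_def by (rule continuous_on_compose2[OF hc]) (use ab in \<open>auto intro!: continuous_intros\<close>)
  define \<mu> where "\<mu> = interval_measure H"
  have sets\<mu>[simp, measurable_cong]: "sets \<mu> = sets borel" and sp: "space \<mu> = UNIV" by (simp_all add: \<mu>_def)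
  have Icc: "emeasure \<mu> {x..y} = ennreal (H y - H x)" if "x \<le> y" for x y
    unfolding \<mu>_def by (rule emeasure_interval_measure_Icc[OF that Hmono Hcont])
  \<comment> \<open>Absolute continuity of \<open>h\<close>, carried over from finite families of
    intervals to open sets.\<close>
  have small: "\<exists>\<delta>>0. \<forall>U. open U \<longrightarrow> emeasure lborel U < ennreal \<delta> \<longrightarrow> emeasure \<mu> U \<le> ennreal \<epsilon>" if \<epsilon>: "\<epsilon> > 0" for \<epsilon> :: real
  proof -
    obtain \<delta> where \<delta>: "\<delta> > 0" "\<And>(I :: real set set) c d. nonoverlapping {a..b} I c d \<Longrightarrow> (\<Sum>i\<in>I. d i - c i) < \<delta> \<Longrightarrow>
        (\<Sum>i\<in>I. norm (h (d i) - h (c i))) < \<epsilon>"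
      using absolutely_continuous_on_families[OF h \<epsilon>] by blast
    \<comment> \<open>Clamping a family to [a, b] does not increase lengths, and the increments of
      \<open>H\<close> over it are those of \<open>h\<close> over the clamped family.\<close>
    have fam: "(\<Sum>i\<in>I. H (d i) - H (c i)) \<le> \<epsilon>"
      if I: "nonoverlapping {x..y} I c d" and s: "(\<Sum>i\<in>I. d i - c i) < \<delta>" for I :: "real set set" and c d x y
    proof -
      define x' where "x' = min x a"
      define y' where "y' = max y b"
      have I1: "nonoverlapping {x'..y'} I c d" by (rule nonoverlapping_subset[OF I]) (auto simp: x'_def y'_def)
      have I2: "nonoverlapping {x'..b} I (\<lambda>i. min b (c i)) (\<lambda>i. min b (d i))"
        by (rule nonoverlapping_min[OF I1]) (use ab in \<open>auto simp: x'_def\<close>)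
      have I3: "nonoverlapping {a..b} I (\<lambda>i. max a (min b (c i))) (\<lambda>i. max a (min b (d i)))"
        by (rule nonoverlapping_max[OF I2 ab])
      have "(\<Sum>i\<in>I. max a (min b (d i)) - max a (min b (c i))) \<le> (\<Sum>i\<in>I. d i - c i)"
      proof (rule sum_mono)
        fix i assume "i \<in> I"
        from nonoverlappingD(1)[OF I this] ab show "max a (min b (d i)) - max a (min b (c i)) \<le> d i - c i"
          by (simp add: max_def min_def)
      qed
      then have "(\<Sum>i\<in>I. norm (h (max a (min b (d i))) - h (max a (min b (c i))))) < \<epsilon>"
        using s by (intro \<delta>(2)[OF I3]) simp
      moreover have "(\<Sum>i\<in>I. H (d i) - H (c i)) \<le> (\<Sum>i\<in>I. norm (h (max a (min b (d i))) - h (max a (min b (c i)))))"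
        unfolding H_def by (intro sum_mono) simp
      ultimately show ?thesis by simp
    qed
    have "emeasure \<mu> U \<le> ennreal \<epsilon>" if U: "open U" "emeasure lborel U < ennreal \<delta>" for U
    proof -
      obtain \<D> where \<D>: "countable \<D>" "\<D> \<subseteq> Pow U" "\<And>X. X \<in> \<D> \<Longrightarrow> \<exists>a b. X = cbox a b" "\<Union>\<D> = U"
        using open_countable_Union_open_cbox[OF U(1)] by blast
      show ?thesis
      proof (cases "\<D> = {}")
        case False
        define K where "K = from_nat_into \<D>"
        have K: "K n \<in> \<D>" for n unfolding K_def by (rule from_nat_into[OF False])
        have ran: "range K = \<D>" unfolding K_def by (rule range_from_nat_into[OF False \<D>(1)])
        \<comment> \<open>The open set is exhausted by finite unions of boxes, and each finite union
          can be cut anew into a non-overlapping division.\<close>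
        define A where "A = (\<lambda>n. \<Union>(K ` {..n}))"
        have Kset: "K n \<in> sets borel" for n using \<D>(3)[OF K[of n]] by auto
        then have Aset: "A n \<in> sets borel" for n unfolding A_def by (intro sets.finite_UN) auto
        have "incseq A" unfolding A_def incseq_def by (intro allI impI UN_mono) auto
        moreover have "(\<Union>n. A n) = U" using ran \<D>(4) by (auto simp: A_def)
        ultimately have "emeasure \<mu> U = (SUP n. emeasure \<mu> (A n))"
          using SUP_emeasure_incseq[of A \<mu>] Aset by (simp add: image_subset_iff)
        also have "\<dots> \<le> ennreal \<epsilon>"
        proof (rule SUP_least)
          fix n
          obtain D where D: "D division_of (A n)"
          proof (rule elementary_unions_intervals[of "K ` {..n}"])
            fix X assume "X \<in> K ` {..n}"
            then show "\<exists>a b. X = cbox a b" using \<D>(3)[OF K] by auto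
          qed (auto simp: A_def)
          note Ks = division_of_nonoverlapping(1)[OF D order.refl]
          note no = division_of_nonoverlapping(2)[OF D order.refl]
          have AU: "A n \<subseteq> U" using \<D>(2) K unfolding A_def by blast
          have "bounded (A n)" using D by (rule elementary_bounded)
          then obtain y where "A n \<subseteq> cbox (- y) y" using bounded_subset_cbox_symmetric by blast
          then have xy: "A n \<subseteq> {- y..y}" by simp
          have "(\<Sum>X\<in>D. Sup X - Inf X) < \<delta>"
            using U by (intro nonoverlapping_sum_length_le[OF nonoverlapping_subset[OF no AU]]) auto
          then have le: "(\<Sum>X\<in>D. H (Sup X) - H (Inf X)) \<le> \<epsilon>"
            by (rule fam[OF nonoverlapping_subset[OF no xy]])
          have "A n = (\<Union>X\<in>D. X)" using division_ofD(6)[OF D] by simp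
          also have "emeasure \<mu> \<dots> \<le> (\<Sum>X\<in>D. emeasure \<mu> X)"
          proof (rule emeasure_subadditive_finite)
            show "finite D" using D by (rule division_ofD(1))
            have "X \<in> sets borel" if "X \<in> D" for X using division_ofD(4)[OF D that] by auto
            then show "(\<lambda>X. X) ` D \<subseteq> sets \<mu>" by auto
          qed
          also have "\<dots> = (\<Sum>X\<in>D. ennreal (H (Sup X) - H (Inf X)))"
          proof (intro sum.cong refl)
            fix X assume "X \<in> D"
            from Ks[OF this] have X: "X = {Inf X..Sup X}" "Inf X \<le> Sup X" by simp_all
            show "emeasure \<mu> X = ennreal (H (Sup X) - H (Inf X))"
              using arg_cong[OF X(1), of "emeasure \<mu>"] Icc[OF X(2)] by simp
          qed
          also have "\<dots> = ennreal (\<Sum>X\<in>D. H (Sup X) - H (Inf X))"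
            using Ks by (intro sum_ennreal) (simp add: Hmono)
          also have "\<dots> \<le> ennreal \<epsilon>" using le by (rule ennreal_leI)
          finally show "emeasure \<mu> (A n) \<le> ennreal \<epsilon>" .
        qed
        finally show ?thesis .
      qed (use \<D> in auto)
    qed
    then show ?thesis using \<delta>(1) by (intro exI[of _ \<delta>]) simp
  qed
  have "absolutely_continuous lborel \<mu>"
    unfolding absolutely_continuous_def
  proof
    fix N :: "real set" assume N: "N \<in> null_sets lborel"
    then have Nb: "N \<in> sets borel" by (auto simp: null_sets_def)
    have "emeasure \<mu> N \<le> ennreal \<epsilon>" if \<epsilon>: "\<epsilon> > 0" for \<epsilon>
    proof -
      obtain \<delta> where \<delta>: "\<delta> > 0" "\<And>U. open U \<Longrightarrow> emeasure lborel U < ennreal \<delta> \<Longrightarrow> emeasure \<mu> U \<le> ennreal \<epsilon>"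
        using small[OF \<epsilon>] by (elim exE conjE) simp
      have "N \<in> sets lebesgue" using Nb by simp
      from sets_lebesgue_outer_open[OF this \<delta>(1)]
      obtain U where U: "open U" "N \<subseteq> U" "emeasure lebesgue (U - N) < ennreal \<delta>" by blast
      have "emeasure lborel U = emeasure lborel (U - N)"
        using N U(1) by (simp add: emeasure_Diff_null_set)
      also have "\<dots> < ennreal \<delta>" using U Nb by simp
      finally have "emeasure \<mu> U \<le> ennreal \<epsilon>" by (intro \<delta>(2) U)
      moreover have "emeasure \<mu> N \<le> emeasure \<mu> U" using U by (intro emeasure_mono) auto
      ultimately show ?thesis by (rule order.trans[rotated])
    qed
    then have "emeasure \<mu> N \<le> 0" by - (rule ennreal_le_epsilon, simp)
    then show "N \<in> null_sets \<mu>" using Nb by (auto simp: null_sets_def)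
  qed
  then obtain f where f: "f \<in> borel_measurable lborel" "density lborel f = \<mu>"
    using sigma_finite_measure.Radon_Nikodym[OF lborel.sigma_finite_measure_axioms, of \<mu>] by auto
  \<comment> \<open>As the Stieltjes measure of [a, b] is finite, the density is finite almost
    everywhere there, and its real version loses nothing.\<close>
  define g where "g = (\<lambda>x. enn2real (f x))"
  have ftot: "(\<integral>\<^sup>+x. f x * indicator {u..v} x \<partial>lborel) = ennreal (H v - H u)" if "u \<le> v" for u v
    using Icc[OF that, folded f(2)] f(1) by (simp add: emeasure_density)
  have "AE x in lborel. f x * indicator {a..b} x \<noteq> \<infinity>"
    using ftot[OF ab] f(1) by (intro nn_integral_noteq_infinite) auto
  then have fin: "AE x in lborel. x \<in> {a..b} \<longrightarrow> f x = ennreal (g x)"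
    by eventually_elim (auto simp: g_def less_top indicator_def split: if_splits)
  have gint: "(g has_integral (h v - h a)) {a..v}" if v: "v \<in> {a..b}" for v
  proof -
    have "(\<integral>\<^sup>+x. ennreal (indicator {a..v} x * g x) \<partial>lborel) = (\<integral>\<^sup>+x. f x * indicator {a..v} x \<partial>lborel)"
    proof (rule nn_integral_cong_AE)
      show "AE x in lborel. ennreal (indicator {a..v} x * g x) = f x * indicator {a..v} x"
        using fin by eventually_elim (use v in \<open>auto simp: indicator_def\<close>)
    qed
    also have "\<dots> = ennreal (h v - h a)" using ftot[of a v] v by (simp add: H_def)
    finally have "has_bochner_integral lborel (\<lambda>x. indicator {a..v} x * g x) (h v - h a)"
      using f(1) v mono by (intro has_bochner_integral_nn_integral) (auto simp: g_def)
    then have "((\<lambda>x. indicator {a..v} x * g x) has_integral (h v - h a)) UNIV"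
      using has_integral_integral_lborel[of "\<lambda>x. indicator {a..v} x * g x"] by (simp add: has_bochner_integral_iff)
    moreover have "(\<lambda>x. indicator {a..v} x * g x) = (\<lambda>x. if x \<in> {a..v} then g x else 0)"
      by (auto simp: indicator_def)
    ultimately show ?thesis by (simp only: has_integral_restrict_UNIV)
  qed
  have "g absolutely_integrable_on {a..b}"
    using gint[of b] ab by (intro nonnegative_absolutely_integrable_1) (auto simp: g_def)
  from ac_primitive_indefinite_integral[OF this] have G: "ac_primitive a b (\<lambda>t. integral {a..t} g) g" .
  have "(h has_vector_derivative g x) (at x)" if "a < x" "x < b" "((\<lambda>t. integral {a..t} g) has_vector_derivative g x) (at x)" for x
  proof -
    have "((\<lambda>t. h a + integral {a..t} g) has_vector_derivative g x) (at x)"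
      using that(3) by (auto intro!: derivative_eq_intros)
    then show ?thesis
      by (rule has_vector_derivative_transform_within_open[of _ _ _ "{a<..<b}"]) (use that integral_unique[OF gint] in auto)
  qed
  with G h have "ac_primitive a b h g"
    unfolding ac_primitive_def by (intro conjI) (elim conjE, simp, elim conjE eventually_mono, simp)
  then show thesis by (rule that)
qed

text \<open>Jordan decomposition: with V the variation, \<open>f\<close> is the difference of V and
  V - f, which are both increasing and absolutely continuous.\<close>

lemma absolutely_continuous_imp_ac_primitive:
  fixes f :: "real \<Rightarrow> real"
  assumes ab: "a \<le> b" and f: "absolutely_continuous_on {a..b} f"
  obtains f' where "ac_primitive a b f f'"
proof -
  define V where "V = variation f a"
  have V: "absolutely_continuous_on {a..b} V" unfolding V_def by (rule variation_absolutely_continuous[OF f])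
  have diff: "norm (f y - f x) \<le> V y - V x" if "a \<le> x" "x \<le> y" "y \<le> b" for x y
    using variation_superadditive[OF f that] by (simp add: V_def)
  have "V x \<le> V y" if "a \<le> x" "x \<le> y" "y \<le> b" for x y
    using order.trans[OF norm_ge_zero diff[OF that]] by simp
  from mono_absolutely_continuous_has_derivative[OF ab V this]
  obtain V' where V': "ac_primitive a b V V'" by blast
  have W: "absolutely_continuous_on {a..b} (\<lambda>x. V x - f x)"
    by (rule absolutely_continuous_on_dominated[OF V f, of _ 1]) auto
  have "V x - f x \<le> V y - f y" if "a \<le> x" "x \<le> y" "y \<le> b" for x y
    using diff[OF that] by simp
  from mono_absolutely_continuous_has_derivative[OF ab W this]
  obtain W' where W': "ac_primitive a b (\<lambda>x. V x - f x) W'" by blast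
  have "AE x in lborel. a < x \<and> x < b \<longrightarrow> (f has_vector_derivative V' x - W' x) (at x)"
    using conjunct2[OF V'[unfolded ac_primitive_def]] conjunct2[OF W'[unfolded ac_primitive_def]]
  proof eventually_elim
    case (elim x)
    show ?case
    proof
    assume "a < x \<and> x < b"
    with elim have "((\<lambda>x. V x - (V x - f x)) has_vector_derivative V' x - W' x) (at x)"
      by (intro has_vector_derivative_diff) simp_all
    then show "(f has_vector_derivative V' x - W' x) (at x)" by simp
    qed
  qed
  with f have "ac_primitive a b f (\<lambda>x. V' x - W' x)" by (simp add: ac_primitive_def)
  then show thesis by (rule that)
qed

section \<open>Calculus of absolutely continuous primitives\<close>

lemma ac_primitiveD:
  assumes "ac_primitive a b F f"
  shows "absolutely_continuous_on {a..b} F"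
    "AE x in lborel. a < x \<and> x < b \<longrightarrow> (F has_vector_derivative f x) (at x)"
  using assms by (simp_all add: ac_primitive_def)

lemma ac_primitive_subinterval:
  assumes F: "ac_primitive a b F f" and "a \<le> c" "d \<le> b"
  shows "ac_primitive c d F f"
  unfolding ac_primitive_def
proof
  show "absolutely_continuous_on {c..d} F"
    by (rule absolutely_continuous_on_subset[OF ac_primitiveD(1)[OF F]]) (use assms in auto)
  show "AE x in lborel. c < x \<and> x < d \<longrightarrow> (F has_vector_derivative f x) (at x)"
    using ac_primitiveD(2)[OF F] by eventually_elim (use assms in auto)
qed

lemma ac_primitive_cong:
  assumes F: "ac_primitive a b F f" and FG: "\<And>x. a \<le> x \<Longrightarrow> x \<le> b \<Longrightarrow> G x = F x"
    and fg: "AE x in lborel. a < x \<and> x < b \<longrightarrow> g x = f x"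
  shows "ac_primitive a b G g"
  unfolding ac_primitive_def
proof
  show "absolutely_continuous_on {a..b} G"
    by (rule absolutely_continuous_on_dominated[OF ac_primitiveD(1)[OF F] ac_primitiveD(1)[OF F], of _ 1]) (simp add: FG)
  show "AE x in lborel. a < x \<and> x < b \<longrightarrow> (G has_vector_derivative g x) (at x)"
    using ac_primitiveD(2)[OF F] fg
  proof eventually_elim
    case (elim x)
    show ?case
    proof
      assume x: "a < x \<and> x < b"
      with elim have "(F has_vector_derivative g x) (at x)" by simp
      then show "(G has_vector_derivative g x) (at x)"
        by (rule has_vector_derivative_transform_within_open[of _ _ _ "{a<..<b}"]) (use x FG in auto)
    qed
  qed
qed

text \<open>Both functions are integrals of one and the same integrand, read forwards or backwards
  from \<open>c\<close>.\<close>

lemma ac_primitive_unique: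
  fixes F :: "real \<Rightarrow> 'a::banach"
  assumes "ac_primitive a b F f" "ac_primitive a b G g" "a \<le> b" "F c = G c" "c \<in> {a..b}"
    and "AE x in lborel. a < x \<and> x < b \<longrightarrow> f x = g x" and "x \<in> {a..b}"
  shows "F x = G x"
proof -
  have "ac_primitive a b G f"
    by (rule ac_primitive_cong[OF assms(2)]) (use assms(6) in auto)
  note I = ac_primitive_has_integral[OF assms(1)] ac_primitive_has_integral[OF this]
  show ?thesis
  proof (cases "c \<le> x")
    case True
    from has_integral_unique[OF I(1)[of c x] I(2)[of c x]] True assms show ?thesis by simp
  next
    case False
    from has_integral_unique[OF I(1)[of x c] I(2)[of x c]] False assms show ?thesis by simp
  qed
qed

lemma ac_primitive_const: "ac_primitive a b (\<lambda>x. c) (\<lambda>x. 0)"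
  unfolding ac_primitive_def by (intro conjI absolutely_continuous_on_lipschitz[of _ _ 0]) auto

lemma ac_primitive_lipschitz:
  assumes "\<And>x y. x \<in> {a..b} \<Longrightarrow> y \<in> {a..b} \<Longrightarrow> norm (F y - F x) \<le> K * \<bar>y - x\<bar>"
    and "\<And>x. a < x \<Longrightarrow> x < b \<Longrightarrow> (F has_vector_derivative f x) (at x)"
  shows "ac_primitive a b F f"
  unfolding ac_primitive_def
  using absolutely_continuous_on_lipschitz[of "{a..b}" F K] assms by simp

lemma ac_primitive_exp:
  "ac_primitive a b (\<lambda>t. exp (\<i> * of_real (c * (t - a0)))) (\<lambda>t. \<i> * of_real c * exp (\<i> * of_real (c * (t - a0))))"
proof (rule ac_primitive_lipschitz[where K = "\<bar>c\<bar>"])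
  have der: "((\<lambda>t. exp (\<i> * of_real (c * (t - a0)))) has_vector_derivative \<i> * of_real c * exp (\<i> * of_real (c * (x - a0)))) (at x within S)" for x S
    by (auto intro!: derivative_eq_intros has_vector_derivative_real_field simp: algebra_simps)
  then show "((\<lambda>t. exp (\<i> * of_real (c * (t - a0)))) has_vector_derivative \<i> * of_real c * exp (\<i> * of_real (c * (x - a0)))) (at x)" for x .
  have n: "norm (\<i> * of_real c * exp (\<i> * of_real (c * (x - a0)))) = \<bar>c\<bar>" for x
    by (simp add: norm_mult)
  fix x y :: real
  show "norm (exp (\<i> * of_real (c * (y - a0))) - exp (\<i> * of_real (c * (x - a0)))) \<le> \<bar>c\<bar> * \<bar>y - x\<bar>"
    using differentiable_bound[of UNIV "\<lambda>t. exp (\<i> * of_real (c * (t - a0)))" "\<lambda>x h. h *\<^sub>R (\<i> * of_real c * exp (\<i> * of_real (c * (x - a0))))" "\<bar>c\<bar>" y x]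
      der[unfolded has_vector_derivative_def] n
    by (simp add: onorm_scaleR_left onorm_id)
qed

section \<open>Algebraic rules for primitives\<close>

lemma ac_primitive_add:
  assumes F: "ac_primitive a b F f" and G: "ac_primitive a b G g"
  shows "ac_primitive a b (\<lambda>x. F x + G x) (\<lambda>x. f x + g x)"
  unfolding ac_primitive_def
proof
  show "absolutely_continuous_on {a..b} (\<lambda>x. F x + G x)"
    by (rule absolutely_continuous_on_dominated[OF ac_primitiveD(1)[OF F] ac_primitiveD(1)[OF G], of _ 1])
      (simp add: norm_diff_triangle_ineq)
  show "AE x in lborel. a < x \<and> x < b \<longrightarrow> ((\<lambda>x. F x + G x) has_vector_derivative f x + g x) (at x)"
    using ac_primitiveD(2)[OF F] ac_primitiveD(2)[OF G]
    by eventually_elim (simp add: has_vector_derivative_add)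
qed

text \<open>Source of the rules for constant factors, conjugation and the embedding of the
  reals.\<close>

lemma ac_primitive_linear:
  assumes F: "ac_primitive a b F f" and T: "bounded_linear T"
  shows "ac_primitive a b (\<lambda>x. T (F x)) (\<lambda>x. T (f x))"
  unfolding ac_primitive_def
proof
  obtain K where K: "\<And>v. norm (T v) \<le> norm v * K" using bounded_linear.bounded[OF T] by blast
  show "absolutely_continuous_on {a..b} (\<lambda>x. T (F x))"
  proof (rule absolutely_continuous_on_dominated[OF ac_primitiveD(1)[OF F] ac_primitiveD(1)[OF F], of _ "K/2"])
    show "norm (T (F y) - T (F x)) \<le> K / 2 * (norm (F y - F x) + norm (F y - F x))" for x y
      using K[of "F y - F x"] by (simp add: linear_diff[OF bounded_linear.linear[OF T]] mult.commute)
  qed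
  show "AE x in lborel. a < x \<and> x < b \<longrightarrow> ((\<lambda>x. T (F x)) has_vector_derivative T (f x)) (at x)"
    using ac_primitiveD(2)[OF F] by eventually_elim (simp add: bounded_linear.has_vector_derivative[OF T])
qed

lemma ac_primitive_cmult:
  fixes F :: "real \<Rightarrow> 'a::real_normed_algebra"
  shows "ac_primitive a b F f \<Longrightarrow> ac_primitive a b (\<lambda>x. c * F x) (\<lambda>x. c * f x)"
  using ac_primitive_linear[OF _ bounded_linear_mult_right] .

lemma ac_primitive_cnj: "ac_primitive a b F f \<Longrightarrow> ac_primitive a b (\<lambda>x. cnj (F x)) (\<lambda>x. cnj (f x))"
  using ac_primitive_linear[OF _ bounded_linear_cnj] .

lemma ac_primitive_of_real:
  "ac_primitive a b F f \<Longrightarrow> ac_primitive a b (\<lambda>x. of_real (F x) :: complex) (\<lambda>x. of_real (f x))"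
  using ac_primitive_linear[OF _ bounded_linear_of_real] .

lemma ac_primitive_diff:
  fixes F :: "real \<Rightarrow> 'a::real_normed_algebra_1"
  assumes "ac_primitive a b F f" and "ac_primitive a b G g"
  shows "ac_primitive a b (\<lambda>x. F x - G x) (\<lambda>x. f x - g x)"
  using ac_primitive_add[OF assms(1) ac_primitive_cmult[OF assms(2), of "-1"]] by simp

lemma ac_primitive_mult:
  fixes F :: "real \<Rightarrow> 'a::real_normed_algebra"
  assumes F: "ac_primitive a b F f" and G: "ac_primitive a b G g"
  shows "ac_primitive a b (\<lambda>x. F x * G x) (\<lambda>x. F x * g x + f x * G x)"
  unfolding ac_primitive_def
proof
  have "bounded (F ` {a..b})" "bounded (G ` {a..b})"
    using ac_primitive_continuous_on[OF F] ac_primitive_continuous_on[OF G]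
    by (auto intro!: compact_imp_bounded compact_continuous_image)
  then obtain M1 M2 where "\<forall>x\<in>{a..b}. norm (F x) \<le> M1" "\<forall>x\<in>{a..b}. norm (G x) \<le> M2"
    unfolding bounded_iff by auto
  then have M: "norm (F x) \<le> M1" "norm (G x) \<le> M2" if "x \<in> {a..b}" for x
    using that by simp_all
  show "absolutely_continuous_on {a..b} (\<lambda>x. F x * G x)"
  proof (rule absolutely_continuous_on_dominated[OF ac_primitiveD(1)[OF F] ac_primitiveD(1)[OF G]])
    fix x y assume xy: "x \<in> {a..b}" "y \<in> {a..b}"
    have "F y * G y - F x * G x = (F y - F x) * G y + F x * (G y - G x)" by (simp add: algebra_simps)
    also have "norm \<dots> \<le> norm (F y - F x) * norm (G y) + norm (F x) * norm (G y - G x)"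
      by (intro norm_triangle_le add_mono norm_mult_ineq)
    also have "\<dots> \<le> norm (F y - F x) * max M1 M2 + max M1 M2 * norm (G y - G x)"
      using M(1)[OF xy(1)] M(2)[OF xy(2)] by (intro add_mono mult_left_mono mult_right_mono) auto
    finally show "norm (F y * G y - F x * G x) \<le> max M1 M2 * (norm (F y - F x) + norm (G y - G x))"
      by (simp add: algebra_simps)
  qed
  show "AE x in lborel. a < x \<and> x < b \<longrightarrow> ((\<lambda>x. F x * G x) has_vector_derivative F x * g x + f x * G x) (at x)"
    using ac_primitiveD(2)[OF F] ac_primitiveD(2)[OF G]
    by eventually_elim (simp add: has_vector_derivative_mult)
qed

text \<open>The Lipschitz bound and the derivative concern only the values taken by
  \<open>F\<close>; square root and inverse qualify once these values stay away from 0.\<close>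

lemma ac_primitive_compose:
  fixes F :: "real \<Rightarrow> real"
  assumes F: "ac_primitive a b F f"
    and lip: "\<And>x y. x \<in> {a..b} \<Longrightarrow> y \<in> {a..b} \<Longrightarrow> \<bar>\<phi> (F y) - \<phi> (F x)\<bar> \<le> K * \<bar>F y - F x\<bar>"
    and der: "\<And>x. x \<in> {a..b} \<Longrightarrow> (\<phi> has_real_derivative \<phi>' (F x)) (at (F x))"
  shows "ac_primitive a b (\<lambda>x. \<phi> (F x)) (\<lambda>x. \<phi>' (F x) * f x)"
  unfolding ac_primitive_def
proof
  show "absolutely_continuous_on {a..b} (\<lambda>x. \<phi> (F x))"
    by (rule absolutely_continuous_on_dominated[OF ac_primitiveD(1)[OF F] ac_primitiveD(1)[OF F], of _ "K/2"])
      (use lip in auto)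
  show "AE x in lborel. a < x \<and> x < b \<longrightarrow> ((\<lambda>x. \<phi> (F x)) has_vector_derivative \<phi>' (F x) * f x) (at x)"
    using ac_primitiveD(2)[OF F]
  proof eventually_elim
    case (elim x)
    then show ?case
      using DERIV_chain2[of \<phi> "\<phi>' (F x)" F x "f x"] der[of x]
      by (auto simp: has_real_derivative_iff_has_vector_derivative[symmetric])
  qed
qed

section \<open>Joining adjacent intervals\<close>

lemma absolutely_continuous_on_join:
  fixes f :: "real \<Rightarrow> 'a::real_normed_vector"
  assumes f: "absolutely_continuous_on {a..b} f" "absolutely_continuous_on {b..c} f" and abc: "a \<le> b" "b \<le> c"
  shows "absolutely_continuous_on {a..c} f"
proof (rule absolutely_continuous_onI)
  fix \<epsilon> :: real assume "\<epsilon> > 0"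
  then have e: "\<epsilon>/2 > 0" by simp
  obtain \<delta>1 where 1: "\<delta>1 > 0" "\<And>(I :: real set set) c d. nonoverlapping {a..b} I c d \<Longrightarrow> (\<Sum>i\<in>I. d i - c i) < \<delta>1 \<Longrightarrow>
        (\<Sum>i\<in>I. norm (f (d i) - f (c i))) < \<epsilon>/2"
    using absolutely_continuous_on_families[OF f(1) e] by blast
  obtain \<delta>2 where 2: "\<delta>2 > 0" "\<And>(I :: real set set) u d. nonoverlapping {b..c} I u d \<Longrightarrow> (\<Sum>i\<in>I. d i - u i) < \<delta>2 \<Longrightarrow>
        (\<Sum>i\<in>I. norm (f (d i) - f (u i))) < \<epsilon>/2"
    using absolutely_continuous_on_families[OF f(2) e] by blast
  have "(\<Sum>i\<in>I. norm (f (v i) - f (u i))) < \<epsilon>"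
    if I: "nonoverlapping {a..c} I u v" and small: "(\<Sum>i\<in>I. v i - u i) < min \<delta>1 \<delta>2" for I :: "real set set" and u v
  proof -
    note uv = nonoverlappingD(1)[OF I]
    have "(\<Sum>i\<in>I. norm (f (v i) - f (u i))) \<le>
      (\<Sum>i\<in>I. norm (f (min b (v i)) - f (min b (u i))) + norm (f (max b (v i)) - f (max b (u i))))"
      using uv by (intro sum_mono norm_diff_split_le)
    also have "\<dots> = (\<Sum>i\<in>I. norm (f (min b (v i)) - f (min b (u i)))) + (\<Sum>i\<in>I. norm (f (max b (v i)) - f (max b (u i))))"
      by (rule sum.distrib)
    also have "\<dots> < \<epsilon>/2 + \<epsilon>/2"
    proof (rule add_strict_mono)
      have "(\<Sum>i\<in>I. min b (v i) - min b (u i)) \<le> (\<Sum>i\<in>I. v i - u i)"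
        "(\<Sum>i\<in>I. max b (v i) - max b (u i)) \<le> (\<Sum>i\<in>I. v i - u i)"
        using uv by (intro sum_mono; force simp: min_def max_def)+
      with small show "(\<Sum>i\<in>I. norm (f (min b (v i)) - f (min b (u i)))) < \<epsilon>/2"
        "(\<Sum>i\<in>I. norm (f (max b (v i)) - f (max b (u i)))) < \<epsilon>/2"
        by (intro 1(2)[OF nonoverlapping_min[OF I abc(1)]] 2(2)[OF nonoverlapping_max[OF I abc(2)]]; simp)+
    qed
    finally show ?thesis by simp
  qed
  then show "\<exists>\<delta>>0. \<forall>(I :: real set set) u v. nonoverlapping {a..c} I u v \<longrightarrow> (\<Sum>i\<in>I. v i - u i) < \<delta> \<longrightarrow>
        (\<Sum>i\<in>I. norm (f (v i) - f (u i))) < \<epsilon>"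
    using 1(1) 2(1) by (intro exI[of _ "min \<delta>1 \<delta>2"]) simp
qed

lemma ac_primitive_join:
  assumes F: "ac_primitive a b F f" and G: "ac_primitive b c F f" and abc: "a \<le> b" "b \<le> c"
  shows "ac_primitive a c F f"
  unfolding ac_primitive_def
proof
  show "absolutely_continuous_on {a..c} F"
    by (rule absolutely_continuous_on_join[OF ac_primitiveD(1)[OF F] ac_primitiveD(1)[OF G] abc])
  show "AE x in lborel. a < x \<and> x < c \<longrightarrow> (F has_vector_derivative f x) (at x)"
    using ac_primitiveD(2)[OF F] ac_primitiveD(2)[OF G] AE_lborel_singleton[of b]
    by eventually_elim auto
qed

text \<open>The partition of \<open>\<zeta>\<close> into absolutely continuous pieces may be finer than its set of
  discontinuities.\<close>

lemma piecewise_absolutely_continuous_extension: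
  fixes f :: "real \<Rightarrow> real"
  assumes p: "interval_partition x0 x1 N p" and ac: "\<And>i. i < N \<Longrightarrow> absolutely_continuous_on {p i<..<p (Suc i)} f"
    and lr: "x0 \<le> l" "l < r" "r \<le> x1" and cont: "continuous_on {l<..<r} f"
  obtains g where "ac_primitive l r g (deriv f)" "\<And>x. l < x \<Longrightarrow> x < r \<Longrightarrow> g x = f x"
    "(f \<longlongrightarrow> g l) (at_right l)" "(f \<longlongrightarrow> g r) (at_left r)"
proof -
  have p0: "p 0 = x0" "p N = x1" "\<And>i. i < N \<Longrightarrow> p i < p (Suc i)" using p by (auto simp: interval_partition_def)
  have "\<exists>L. (f \<longlongrightarrow> L) (at_right l)"
  proof -
    \<comment> \<open>\<open>p (Suc i)\<close> is the first partition point beyond \<open>l\<close>.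
      On the cell before it \<open>f\<close> is absolutely continuous, so the right limit at
      \<open>l\<close> exists.\<close>
    define i where "i = (LEAST k. l < p (Suc k))"
    have "\<exists>k. N = Suc k" using lr p0 by (cases N) auto
    then obtain k where "N = Suc k" by blast
    then have k: "l < p (Suc k)" "k < N" using lr p0 by auto
    then have i: "l < p (Suc i)" "i \<le> k" unfolding i_def by (auto intro: LeastI Least_le)
    have "p i \<le> l"
    proof (cases i)
      case (Suc m)
      then have "\<not> l < p (Suc m)" using not_less_Least[of m "\<lambda>k. l < p (Suc k)"] i_def by simp
      then show ?thesis using Suc by simp
    qed (use lr p0 in simp)
    have "absolutely_continuous_on {l<..<p (Suc i)} f"
      by (rule absolutely_continuous_on_subset[OF ac[of i]]) (use i k \<open>p i \<le> l\<close> in auto)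
    then show ?thesis by (metis absolutely_continuous_on_extend i(1))
  qed
  then obtain L where L: "(f \<longlongrightarrow> L) (at_right l)" by blast
  have "\<exists>R. (f \<longlongrightarrow> R) (at_left r)"
  proof -
    define i where "i = (LEAST k. r \<le> p k)"
    have N: "r \<le> p N" using lr p0 by simp
    then have i: "r \<le> p i" "i \<le> N" unfolding i_def by (auto intro: LeastI Least_le)
    then obtain m where m: "i = Suc m" using lr p0 by (cases i) auto
    then have "\<not> r \<le> p m" using not_less_Least[of m "\<lambda>k. r \<le> p k"] i_def by simp
    then have pm: "p m < r" by simp
    have "absolutely_continuous_on {p m<..<r} f"
      by (rule absolutely_continuous_on_subset[OF ac[of m]]) (use i m in auto)
    then show ?thesis by (metis absolutely_continuous_on_extend pm)
  qed
  then obtain R where R: "(f \<longlongrightarrow> R) (at_left r)" by blast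
  define g where "g = (\<lambda>x. if x = l then L else if x = r then R else f x)"
  have gf: "g x = f x" if "l < x" "x < r" for x using that by (simp add: g_def)
  have glr: "g l = L" "g r = R" using lr by (auto simp: g_def)
  have gcont: "continuous_on {l..r} g"
  proof (rule continuous_on_IccI)
    have "\<forall>\<^sub>F x in at_right l. f x = g x"
      using eventually_at_right_real[OF lr(2)] by eventually_elim (simp add: gf)
    then show "(g \<longlongrightarrow> g l) (at_right l)" using L glr Lim_transform_eventually by metis
    have "\<forall>\<^sub>F x in at_left r. f x = g x"
      using eventually_at_left_real[OF lr(2)] by eventually_elim (simp add: gf)
    then show "(g \<longlongrightarrow> g r) (at_left r)" using R glr Lim_transform_eventually by metis
    fix x assume x: "l < x" "x < r"
    have "isCont f x" using cont x by (simp add: continuous_on_eq_continuous_at)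
    then have "(f \<longlongrightarrow> g x) (at x)" using gf[OF x] by (simp add: isCont_def)
    moreover have "\<forall>\<^sub>F y in at x. f y = g y"
      unfolding eventually_at_topological using x gf by (intro exI[of _ "{l<..<r}"]) auto
    ultimately show "(g \<longlongrightarrow> g x) (at x)" using Lim_transform_eventually by metis
  qed (rule lr)
  \<comment> \<open>The partition clamped to [l, r]: cells outside collapse to points, where there
    is nothing to prove.\<close>
  define q where "q = (\<lambda>i. max l (min r (p i)))"
  have q0: "q 0 = l" "q N = r" using lr p0 by (auto simp: q_def)
  have qlr: "l \<le> q i" "q i \<le> r" for i using lr by (auto simp: q_def)
  have qmono: "q i \<le> q (Suc i)" if "i < N" for i using p0(3)[OF that] by (auto simp: q_def)
  have cell: "absolutely_continuous_on {q i..q (Suc i)} g" if i: "i < N" for i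
  proof (cases "q i < q (Suc i)")
    case True
    show ?thesis
    proof (rule absolutely_continuous_on_closure[OF True])
      show "absolutely_continuous_on {q i<..<q (Suc i)} f"
      proof (rule absolutely_continuous_on_subset[OF ac[OF i]])
        have "p i \<le> q i" "q (Suc i) \<le> p (Suc i)" using True unfolding q_def by (auto simp: max_def min_def split: if_splits)
        then show "{q i<..<q (Suc i)} \<subseteq> {p i<..<p (Suc i)}" by auto
      qed
      show "continuous_on {q i..q (Suc i)} g"
        by (rule continuous_on_subset[OF gcont]) (use qlr[of i] qlr[of "Suc i"] in auto)
      show "g x = f x" if "x \<in> {q i<..<q (Suc i)}" for x
        using that qlr[of i] qlr[of "Suc i"] by (intro gf) auto
    qed
  next
    case False
    then show ?thesis using qmono[OF i] by (intro absolutely_continuous_on_lipschitz[of _ _ 0]) auto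
  qed
  have "i \<le> N \<Longrightarrow> l \<le> q i \<and> absolutely_continuous_on {l..q i} g" for i
  proof (induction i)
    case 0
    then show ?case using q0 by (auto intro!: absolutely_continuous_on_lipschitz[of _ _ 0])
  next
    case (Suc i)
    then have "absolutely_continuous_on {l..q (Suc i)} g"
      by (intro absolutely_continuous_on_join[of l "q i" g "q (Suc i)"] cell qmono) auto
    then show ?case using qlr by simp
  qed
  from this[of N] have gac: "absolutely_continuous_on {l..r} g" using q0 by simp
  then obtain g' where g': "ac_primitive l r g g'"
    using absolutely_continuous_imp_ac_primitive[of l r g] lr by (meson less_imp_le)
  \<comment> \<open>The abstract derivative \<open>g'\<close> is exchanged for
    \<open>deriv f\<close>, to which \<open>alpha\<close> refers. At almost every point
    \<open>g'\<close> is an actual derivative, so the two agree there.\<close>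
  have "AE x in lborel. l < x \<and> x < r \<longrightarrow> deriv f x = g' x"
    using ac_primitiveD(2)[OF g']
  proof eventually_elim
    case (elim x)
    show ?case
    proof
      assume x: "l < x \<and> x < r"
      with elim have "(g has_vector_derivative g' x) (at x)" by simp
      then have "(f has_vector_derivative g' x) (at x)"
        by (rule has_vector_derivative_transform_within_open[of _ _ _ "{l<..<r}"]) (use x gf in auto)
      then show "deriv f x = g' x"
        by (intro DERIV_imp_deriv) (simp add: has_real_derivative_iff_has_vector_derivative)
    qed
  qed
  then have "ac_primitive l r g (deriv f)" by (intro ac_primitive_cong[OF g']) auto
  then show thesis using that gf L R glr by simp
qed

section \<open>Harmonic exponentials\<close>

lemma sigma_finite_lebesgue: "sigma_finite_measure (lebesgue :: 'a::euclidean_space measure)"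
proof
  obtain A :: "'a set set" where A: "countable A" "A \<subseteq> sets lborel" "\<Union>A = space lborel" "\<forall>a\<in>A. emeasure lborel a \<noteq> \<infinity>"
    using lborel.sigma_finite_countable by blast
  have "a \<in> sets lebesgue \<and> emeasure lebesgue a \<noteq> \<infinity>" if "a \<in> A" for a
    using A(2,4) that by (auto dest!: subsetD)
  then have "\<forall>a\<in>A. emeasure lebesgue a \<noteq> \<infinity>" "A \<subseteq> sets lebesgue" by blast+
  then show "\<exists>A. countable A \<and> A \<subseteq> sets lebesgue \<and> \<Union>A = space lebesgue \<and> (\<forall>a\<in>A. emeasure (lebesgue :: 'a measure) a \<noteq> \<infinity>)"
    using A by (intro exI[of _ A]) simp
qed

interpretation lebesgue_product: product_sigma_finite "\<lambda>_ :: nat. lebesgue :: real measure"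
  by (simp add: product_sigma_finite_def sigma_finite_lebesgue)

definition ordered_simplex :: "real \<Rightarrow> real \<Rightarrow> nat \<Rightarrow> (nat \<Rightarrow> real) set" where
  "ordered_simplex a b j = {s. (\<forall>\<nu>\<in>{1..j}. a < s \<nu> \<and> s \<nu> < b) \<and> (\<forall>\<nu>\<in>{1..<j}. s \<nu> < s (Suc \<nu>))}"

definition alternating_sum :: "real \<Rightarrow> nat \<Rightarrow> (nat \<Rightarrow> real) \<Rightarrow> real" where
  "alternating_sum a j s = (\<Sum>\<nu>=1..j. (- 1) ^ (j - \<nu>) * (s \<nu> - a))"

text \<open>The frequency is complex here in view of the analytic continuation.\<close>

definition harmonic_integrand :: "real \<Rightarrow> real \<Rightarrow> (real \<Rightarrow> real) \<Rightarrow> complex \<Rightarrow> nat \<Rightarrow> (nat \<Rightarrow> real) \<Rightarrow> complex" where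
  "harmonic_integrand a b \<beta> z j s =
     indicator (ordered_simplex a b j) s * exp (2 * \<i> * z * of_real (alternating_sum a j s)) * of_real (\<Prod>\<nu>=1..j. \<beta> (s \<nu>))"

lemma harmonic_exp_term_eq:
  "harmonic_exp_term a b \<beta> \<omega> j = (\<integral>s. harmonic_integrand a b \<beta> (of_real \<omega>) j s \<partial>PiM {1..j} (\<lambda>_. lebesgue))"
  unfolding harmonic_exp_term_def set_lebesgue_integral_def harmonic_integrand_def ordered_simplex_def alternating_sum_def
  by (intro Bochner_Integration.integral_cong refl) (simp add: scaleR_conv_of_real indicator_def)

lemma coordinate_measurable [measurable (raw)]:
  "\<nu> \<in> I \<Longrightarrow> (\<lambda>s. s \<nu>) \<in> borel_measurable (PiM I (\<lambda>_ :: nat. lebesgue :: real measure))"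
  by (rule measurable_compose[OF measurable_component_singleton]) (auto simp: measurable_completion)

lemma ordered_simplexD:
  assumes "s \<in> ordered_simplex a b j" "\<nu> \<in> {1..j}"
  shows "a < s \<nu>" "s \<nu> < b"
  using assms unfolding ordered_simplex_def by blast+

lemma ordered_simplex_indicator_measurable:
  "(indicator (ordered_simplex a b j) :: (nat \<Rightarrow> real) \<Rightarrow> complex) \<in> borel_measurable (PiM {1..j} (\<lambda>_. lebesgue))"
proof -
  have ind: "(\<lambda>s. indicator S (f s) :: complex) \<in> borel_measurable N"
    if "f \<in> borel_measurable N" "S \<in> sets borel" for f :: "(nat \<Rightarrow> real) \<Rightarrow> real" and S N
    by (rule measurable_compose[OF that(1) borel_measurable_indicator[OF that(2)]])
  have "(\<lambda>s. (\<Prod>\<nu>=1..j. indicator {a<..<b} (s \<nu>)) * (\<Prod>\<nu>\<in>{1..<j}. indicator {0<..} (s (Suc \<nu>) - s \<nu>)) :: complex)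
    \<in> borel_measurable (PiM {1..j} (\<lambda>_. lebesgue))"
    by (intro borel_measurable_times borel_measurable_prod ind borel_measurable_diff coordinate_measurable) auto
  moreover have "(\<lambda>s. (\<Prod>\<nu>=1..j. indicator {a<..<b} (s \<nu>)) * (\<Prod>\<nu>\<in>{1..<j}. indicator {0<..} (s (Suc \<nu>) - s \<nu>)) :: complex)
     = indicator (ordered_simplex a b j)"
  proof
    fix s :: "nat \<Rightarrow> real"
    show "(\<Prod>\<nu>=1..j. indicator {a<..<b} (s \<nu>)) * (\<Prod>\<nu>\<in>{1..<j}. indicator {0<..} (s (Suc \<nu>) - s \<nu>)) = (indicator (ordered_simplex a b j) s :: complex)"
    proof (cases "s \<in> ordered_simplex a b j")
      case True
      then show ?thesis by (auto simp: ordered_simplex_def intro!: prod.neutral)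
    next
      case False
      then show ?thesis by (auto simp: ordered_simplex_def indicator_def)
    qed
  qed
  ultimately show ?thesis by (simp only:)
qed

lemma alternating_sum_measurable:
  "alternating_sum a j \<in> borel_measurable (PiM {1..j} (\<lambda>_. lebesgue))"
  unfolding alternating_sum_def[abs_def]
  by (intro borel_measurable_sum borel_measurable_times borel_measurable_diff coordinate_measurable) auto

text \<open>On the simplex the cut-off changes nothing, but it turns \<beta> into a function
  integrable on the whole line, so that products over the coordinates are integrable for the product
  measure.\<close>

lemma harmonic_integrand_restrict:
  assumes "b \<le> c"
  shows "harmonic_integrand a b \<beta> z j s = harmonic_integrand a b (\<lambda>x. indicator {a<..<c} x * \<beta> x) z j s"
proof (cases "s \<in> ordered_simplex a b j")
  case True
  then have "(\<Prod>\<nu>=1..j. \<beta> (s \<nu>)) = (\<Prod>\<nu>=1..j. indicator {a<..<c} (s \<nu>) * \<beta> (s \<nu>))"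
    using assms by (intro prod.cong refl) (force dest: ordered_simplexD simp: indicator_def)
  then show ?thesis by (simp only: harmonic_integrand_def)
qed (simp add: harmonic_integrand_def)

lemma absolutely_integrable_imp_integrable_indicator:
  fixes \<beta> :: "real \<Rightarrow> real"
  assumes "\<beta> absolutely_integrable_on {a..b}"
  shows "integrable lebesgue (\<lambda>x. indicator {a<..<b} x * \<beta> x)"
proof -
  have "\<beta> absolutely_integrable_on {a<..<b}"
    using assms by (rule set_integrable_subset) auto
  then show ?thesis by (simp add: set_integrable_def)
qed

text \<open>Growth linear in \<open>j\<close> is harmless: exponentiated, it becomes a j-th power,
  which the factorial of \<open>j\<close> absorbs.\<close>

lemma abs_alternating_sum_le:
  assumes "s \<in> ordered_simplex a b j"
  shows "\<bar>alternating_sum a j s\<bar> \<le> real j * (b - a)"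
proof -
  have "\<bar>alternating_sum a j s\<bar> \<le> (\<Sum>\<nu>=1..j. \<bar>(- 1) ^ (j - \<nu>) * (s \<nu> - a)\<bar>)"
    unfolding alternating_sum_def by (rule sum_abs)
  also have "\<dots> \<le> (\<Sum>\<nu>=1..j. b - a)"
  proof (rule sum_mono)
    fix \<nu> assume "\<nu> \<in> {1..j}"
    from ordered_simplexD[OF assms this] show "\<bar>(- 1) ^ (j - \<nu>) * (s \<nu> - a)\<bar> \<le> b - a"
      by (simp add: abs_mult power_abs)
  qed
  finally show ?thesis by simp
qed

lemma norm_exp_ii_le: "norm (exp (2 * \<i> * z * of_real t)) \<le> exp (2 * norm z * \<bar>t\<bar>)"
  using norm_exp[of "2 * \<i> * z * of_real t"] by (simp add: norm_mult)

text \<open>The majorant is a constant, which bounds the exponential on the simplex, times a product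
  of integrable functions of one variable each.\<close>

lemma harmonic_integrand_integrable:
  fixes \<beta> :: "real \<Rightarrow> real"
  assumes \<beta>: "\<beta> absolutely_integrable_on {a..c}" and bc: "b \<le> c"
  shows "integrable (PiM {1..j} (\<lambda>_. lebesgue)) (harmonic_integrand a b \<beta> z j)"
proof -
  define \<gamma> where "\<gamma> = (\<lambda>x. indicator {a<..<c} x * \<beta> x)"
  have \<gamma>: "integrable lebesgue \<gamma>"
    unfolding \<gamma>_def by (rule absolutely_integrable_imp_integrable_indicator[OF \<beta>])
  then have \<gamma>c: "integrable lebesgue (\<lambda>x. of_real (\<gamma> x) :: complex)" by simp
  have "integrable (PiM {1..j} (\<lambda>_. lebesgue)) (\<lambda>s. \<Prod>\<nu>=1..j. of_real (\<gamma> (s \<nu>)) :: complex)"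
    by (rule lebesgue_product.product_integrable_prod) (use \<gamma>c in auto)
  then have I: "integrable (PiM {1..j} (\<lambda>_. lebesgue)) (\<lambda>s. of_real (exp (2 * norm z * (real j * (b - a)))) * (\<Prod>\<nu>=1..j. of_real (\<gamma> (s \<nu>)) :: complex))"
    by (rule integrable_mult_right)
  have eq: "harmonic_integrand a b \<beta> z j = harmonic_integrand a b \<gamma> z j"
    unfolding \<gamma>_def by (intro ext harmonic_integrand_restrict bc)
  show ?thesis
    unfolding eq
  proof (rule Bochner_Integration.integrable_bound[OF I])
    have "(\<lambda>s. of_real (\<Prod>\<nu>=1..j. \<gamma> (s \<nu>)) :: complex) \<in> borel_measurable (PiM {1..j} (\<lambda>_. lebesgue))"
      unfolding of_real_prod
    proof (rule borel_measurable_prod)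
      fix \<nu> assume "\<nu> \<in> {1..j}"
      from measurable_compose[OF measurable_component_singleton[OF this, of "\<lambda>_. lebesgue"] borel_measurable_integrable[OF \<gamma>c]]
      show "(\<lambda>s. of_real (\<gamma> (s \<nu>)) :: complex) \<in> borel_measurable (PiM {1..j} (\<lambda>_. lebesgue))" .
    qed
    then show "harmonic_integrand a b \<gamma> z j \<in> borel_measurable (PiM {1..j} (\<lambda>_. lebesgue))"
      unfolding harmonic_integrand_def[abs_def]
      by (intro borel_measurable_times ordered_simplex_indicator_measurable measurable_compose[OF _ borel_measurable_exp]
        borel_measurable_const measurable_compose[OF alternating_sum_measurable borel_measurable_of_real])
    have "norm (harmonic_integrand a b \<gamma> z j s) \<le> norm (of_real (exp (2 * norm z * (real j * (b - a)))) * (\<Prod>\<nu>=1..j. of_real (\<gamma> (s \<nu>)) :: complex))" for s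
    proof (cases "s \<in> ordered_simplex a b j")
      case True
      have "norm (exp (2 * \<i> * z * of_real (alternating_sum a j s))) \<le> exp (2 * norm z * \<bar>alternating_sum a j s\<bar>)"
        by (rule norm_exp_ii_le)
      also have "\<dots> \<le> exp (2 * norm z * (real j * (b - a)))"
        using abs_alternating_sum_le[OF True] by (intro exp_le_cancel_iff[THEN iffD2] mult_left_mono) auto
      finally have le: "norm (exp (2 * \<i> * z * of_real (alternating_sum a j s))) \<le> exp (2 * norm z * (real j * (b - a)))" .
      have "norm (harmonic_integrand a b \<gamma> z j s) = norm (exp (2 * \<i> * z * of_real (alternating_sum a j s))) * \<bar>\<Prod>\<nu>=1..j. \<gamma> (s \<nu>)\<bar>"
        using True by (simp only: harmonic_integrand_def norm_mult norm_of_real indicator_simps norm_one mult_1_left)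
      also have "\<dots> \<le> exp (2 * norm z * (real j * (b - a))) * \<bar>\<Prod>\<nu>=1..j. \<gamma> (s \<nu>)\<bar>"
        by (rule mult_right_mono[OF le]) simp
      also have "\<dots> = norm (of_real (exp (2 * norm z * (real j * (b - a)))) * (\<Prod>\<nu>=1..j. of_real (\<gamma> (s \<nu>)) :: complex))"
        by (simp only: norm_mult norm_of_real of_real_prod[symmetric] abs_exp_cancel)
      finally show ?thesis .
    qed (simp add: harmonic_integrand_def)
    then show "AE s in PiM {1..j} (\<lambda>_. lebesgue). norm (harmonic_integrand a b \<gamma> z j s) \<le> norm (of_real (exp (2 * norm z * (real j * (b - a)))) * (\<Prod>\<nu>=1..j. of_real (\<gamma> (s \<nu>)) :: complex))"
      by (rule AE_I2)
  qed
qed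

text \<open>The product over no coordinates is a single point of mass 1. So the leading 1 of the
  harmonic exponential is its term of index 0.\<close>

lemma harmonic_exp_term_0 [simp]: "harmonic_exp_term a b \<beta> \<omega> 0 = 1"
  unfolding harmonic_exp_term_eq
  by (simp add: harmonic_integrand_def ordered_simplex_def alternating_sum_def PiM_empty lebesgue_integral_count_space_finite)

text \<open>The last variable of the simplex is split off; conjugation accounts for the alternation of
  signs.\<close>

lemma harmonic_integrand_Suc:
  "harmonic_integrand a t \<beta> (of_real \<omega>) (Suc j) (y(Suc j := s)) =
    indicator {a<..<t} s * exp (2 * \<i> * of_real (\<omega> * (s - a))) * of_real (\<beta> s) * cnj (harmonic_integrand a s \<beta> (of_real \<omega>) j y)"
proof -
  have mem: "y(Suc j := s) \<in> ordered_simplex a t (Suc j) \<longleftrightarrow> s \<in> {a<..<t} \<and> y \<in> ordered_simplex a s j"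
  proof
    assume L: "y(Suc j := s) \<in> ordered_simplex a t (Suc j)"
    have s: "a < s" "s < t" using L unfolding ordered_simplex_def by (auto dest!: bspec[of _ _ "Suc j"])
    have ya: "a < y \<nu>" if "\<nu> \<in> {1..j}" for \<nu>
      using L that unfolding ordered_simplex_def by (auto dest!: bspec[of _ _ \<nu>])
    have inc: "y \<nu> < (if \<nu> = j then s else y (Suc \<nu>))" if "\<nu> \<in> {1..j}" for \<nu>
      using L that unfolding ordered_simplex_def by (auto dest!: bspec[of _ _ \<nu>])
    \<comment> \<open>Descending from the last index, because the chain of inequalities ends at
      \<open>s\<close>.\<close>
    have ys: "y (j - k) < s" if "k < j" for k
      using that
    proof (induction k)
      case 0 then show ?case using inc[of j] by simp
    next
      case (Suc k)
      have "y (j - Suc k) < y (Suc (j - Suc k))" 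
      proof -
        have "j - Suc k \<in> {1..j}" "j - Suc k \<noteq> j" using Suc.prems by auto
        from inc[OF this(1)] this(2) show ?thesis by simp
      qed
      also have "Suc (j - Suc k) = j - k" using Suc by simp
      finally show ?case using Suc by simp
    qed
    have "y \<nu> < s" if "\<nu> \<in> {1..j}" for \<nu> using ys[of "j - \<nu>"] that by simp
    moreover have "y \<nu> < y (Suc \<nu>)" if "\<nu> \<in> {1..<j}" for \<nu> using inc[of \<nu>] that by simp
    ultimately show "s \<in> {a<..<t} \<and> y \<in> ordered_simplex a s j" using s ya by (simp add: ordered_simplex_def)
  next
    assume R: "s \<in> {a<..<t} \<and> y \<in> ordered_simplex a s j"
    then have y: "a < y \<nu>" "y \<nu> < s" if "\<nu> \<in> {1..j}" for \<nu> using that by (auto simp: ordered_simplex_def)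
    have inc: "y \<nu> < y (Suc \<nu>)" if "\<nu> \<in> {1..<j}" for \<nu> using R that by (auto simp: ordered_simplex_def)
    show "y(Suc j := s) \<in> ordered_simplex a t (Suc j)"
      unfolding ordered_simplex_def mem_Collect_eq
    proof (intro conjI ballI)
      fix \<nu> assume \<nu>: "\<nu> \<in> {1..Suc j}"
      show "a < (y(Suc j := s)) \<nu>" "(y(Suc j := s)) \<nu> < t"
        using R \<nu> y[of \<nu>] by (cases "\<nu> = Suc j"; force)+
    next
      fix \<nu> assume \<nu>: "\<nu> \<in> {1..<Suc j}"
      then show "(y(Suc j := s)) \<nu> < (y(Suc j := s)) (Suc \<nu>)"
        using y[of \<nu>] inc[of \<nu>] by (cases "\<nu> = j") auto
    qed
  qed
  have alt: "alternating_sum a (Suc j) (y(Suc j := s)) = (s - a) - alternating_sum a j y"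
  proof -
    have "alternating_sum a (Suc j) (y(Suc j := s)) = (\<Sum>\<nu>=1..j. (- 1) ^ (Suc j - \<nu>) * ((y(Suc j := s)) \<nu> - a)) + (s - a)"
      by (simp add: alternating_sum_def)
    also have "(\<Sum>\<nu>=1..j. (- 1) ^ (Suc j - \<nu>) * ((y(Suc j := s)) \<nu> - a)) = (\<Sum>\<nu>=1..j. - ((- 1) ^ (j - \<nu>) * (y \<nu> - a)))"
      by (intro sum.cong refl) (simp add: Suc_diff_le)
    finally show ?thesis by (simp add: alternating_sum_def sum_negf)
  qed
  have "(\<Prod>\<nu>=1..Suc j. \<beta> ((y(Suc j := s)) \<nu>)) = (\<Prod>\<nu>=1..j. \<beta> ((y(Suc j := s)) \<nu>)) * \<beta> s" by simp
  also have "(\<Prod>\<nu>=1..j. \<beta> ((y(Suc j := s)) \<nu>)) = (\<Prod>\<nu>=1..j. \<beta> (y \<nu>))" by (intro prod.cong) auto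
  finally have pr: "(\<Prod>\<nu>=1..Suc j. \<beta> ((y(Suc j := s)) \<nu>)) = (\<Prod>\<nu>=1..j. \<beta> (y \<nu>)) * \<beta> s" .
  have ex: "exp (2 * \<i> * of_real \<omega> * of_real (s - a - alternating_sum a j y)) =
      exp (2 * \<i> * of_real (\<omega> * (s - a))) * cnj (exp (2 * \<i> * of_real \<omega> * of_real (alternating_sum a j y)))"
  proof -
    have "cnj (exp (2 * \<i> * of_real \<omega> * of_real (alternating_sum a j y))) = exp (- (2 * \<i> * of_real \<omega> * of_real (alternating_sum a j y)))"
      by (simp add: exp_cnj)
    then show ?thesis by (simp add: exp_add[symmetric] algebra_simps)
  qed
  show ?thesis
    unfolding harmonic_integrand_def alt pr ex using mem by (simp add: indicator_def)
qed

text \<open>Fubini with the last variable outermost. Continuity of the j-th term in the upper limit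
  is a hypothesis because it comes out of this very recursion, by induction on
  \<open>j\<close>.\<close>

lemma harmonic_exp_term_Suc:
  fixes \<beta> :: "real \<Rightarrow> real"
  assumes \<beta>: "\<beta> absolutely_integrable_on {a..b}" and t: "t \<in> {a..b}"
    and cont: "continuous_on {a..b} (\<lambda>s. harmonic_exp_term a s \<beta> \<omega> j)"
  shows "(\<lambda>s. exp (2 * \<i> * of_real (\<omega> * (s - a))) * of_real (\<beta> s) * cnj (harmonic_exp_term a s \<beta> \<omega> j)) absolutely_integrable_on {a..b}" (is ?A)
    and "harmonic_exp_term a t \<beta> \<omega> (Suc j) =
      integral {a..t} (\<lambda>s. exp (2 * \<i> * of_real (\<omega> * (s - a))) * of_real (\<beta> s) * cnj (harmonic_exp_term a s \<beta> \<omega> j))" (is ?B)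
proof -
  define G where "G = (\<lambda>s. exp (2 * \<i> * of_real (\<omega> * (s - a))) * of_real (\<beta> s) * cnj (harmonic_exp_term a s \<beta> \<omega> j))"
  have "(\<lambda>s. (exp (2 * \<i> * of_real (\<omega> * (s - a))) * cnj (harmonic_exp_term a s \<beta> \<omega> j)) * of_real (\<beta> s)) absolutely_integrable_on {a..b}"
  proof (rule absolutely_integrable_bounded_measurable_product[OF bilinear_times])
    have c: "continuous_on {a..b} (\<lambda>s. exp (2 * \<i> * of_real (\<omega> * (s - a))) * cnj (harmonic_exp_term a s \<beta> \<omega> j))"
      by (intro continuous_intros cont)
    show "(\<lambda>s. exp (2 * \<i> * of_real (\<omega> * (s - a))) * cnj (harmonic_exp_term a s \<beta> \<omega> j)) \<in> borel_measurable (lebesgue_on {a..b})"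
      by (rule continuous_imp_measurable_on_sets_lebesgue[OF c]) simp
    show "bounded ((\<lambda>s. exp (2 * \<i> * of_real (\<omega> * (s - a))) * cnj (harmonic_exp_term a s \<beta> \<omega> j)) ` {a..b})"
      by (intro compact_imp_bounded compact_continuous_image c) simp
    show "(\<lambda>s. of_real (\<beta> s) :: complex) absolutely_integrable_on {a..b}"
      using absolutely_integrable_linear[OF \<beta> bounded_linear_of_real] by (simp add: o_def)
  qed simp
  then have G: "G absolutely_integrable_on {a..b}" by (simp add: G_def mult_ac)
  then show ?A by (simp only: G_def)
  have Gt: "G absolutely_integrable_on {a<..<t}"
    using G by (rule set_integrable_subset) (use t in auto)
  define F where "F = harmonic_integrand a t \<beta> (of_real \<omega>) (Suc j)"
  have un: "{Suc j} \<union> {1..j} = {1..Suc j}" by auto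
  have "integrable (PiM {1..Suc j} (\<lambda>_. lebesgue)) F"
    unfolding F_def by (rule harmonic_integrand_integrable[OF \<beta>]) (use t in auto)
  then have "harmonic_exp_term a t \<beta> \<omega> (Suc j) =
      (\<integral>x. (\<integral>y. F (merge {Suc j} {1..j} (x, y)) \<partial>PiM {1..j} (\<lambda>_. lebesgue)) \<partial>PiM {Suc j} (\<lambda>_. lebesgue))"
    unfolding harmonic_exp_term_eq F_def[symmetric]
    by (subst lebesgue_product.product_integral_fold[of "{Suc j}" "{1..j}", unfolded un, symmetric]) auto
  also have "\<dots> = (\<integral>x. indicator {a<..<t} (x (Suc j)) * G (x (Suc j)) \<partial>PiM {Suc j} (\<lambda>_. lebesgue))"
  proof (rule Bochner_Integration.integral_cong[OF refl])
    fix x :: "nat \<Rightarrow> real"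
    have "(\<integral>y. F (merge {Suc j} {1..j} (x, y)) \<partial>PiM {1..j} (\<lambda>_. lebesgue)) =
        (\<integral>y. indicator {a<..<t} (x (Suc j)) * exp (2 * \<i> * of_real (\<omega> * (x (Suc j) - a))) * of_real (\<beta> (x (Suc j)))
          * cnj (harmonic_integrand a (x (Suc j)) \<beta> (of_real \<omega>) j y) \<partial>PiM {1..j} (\<lambda>_. lebesgue))"
    proof (rule Bochner_Integration.integral_cong[OF refl])
      fix y assume "y \<in> space (PiM {1..j} (\<lambda>_. lebesgue :: real measure))"
      then have "merge {Suc j} {1..j} (x, y) = y(Suc j := x (Suc j))"
        by (auto simp: merge_def space_PiM PiE_def extensional_def fun_eq_iff)
      then show "F (merge {Suc j} {1..j} (x, y)) = indicator {a<..<t} (x (Suc j)) * exp (2 * \<i> * of_real (\<omega> * (x (Suc j) - a))) * of_real (\<beta> (x (Suc j)))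
          * cnj (harmonic_integrand a (x (Suc j)) \<beta> (of_real \<omega>) j y)"
        by (simp add: F_def harmonic_integrand_Suc)
    qed
    also have "\<dots> = indicator {a<..<t} (x (Suc j)) * G (x (Suc j))"
      by (simp add: G_def harmonic_exp_term_eq mult.assoc)
    finally show "(\<integral>y. F (merge {Suc j} {1..j} (x, y)) \<partial>PiM {1..j} (\<lambda>_. lebesgue)) = indicator {a<..<t} (x (Suc j)) * G (x (Suc j))" .
  qed
  also have "\<dots> = (\<integral>s. indicator {a<..<t} s * G s \<partial>lebesgue)"
  proof (rule lebesgue_product.product_integral_singleton[of "\<lambda>s. indicator {a<..<t} s * G s" "Suc j"])
    show "(\<lambda>s. indicator {a<..<t} s * G s) \<in> borel_measurable lebesgue"
      using borel_measurable_integrable[OF Gt[unfolded set_integrable_def]]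
      by (simp add: scaleR_conv_of_real of_real_indicator)
  qed
  also have "\<dots> = (LINT s:{a<..<t}|lebesgue. G s)"
    by (simp add: set_lebesgue_integral_def scaleR_conv_of_real of_real_indicator)
  also have "\<dots> = integral {a<..<t} G" by (rule set_lebesgue_integral_eq_integral(2)[OF Gt])
  also have "\<dots> = integral {a..t} G" by (simp add: integral_open_interval_real)
  finally show ?B by (simp only: G_def)
qed

lemma continuous_on_harmonic_exp_term:
  fixes \<beta> :: "real \<Rightarrow> real"
  assumes \<beta>: "\<beta> absolutely_integrable_on {a..b}"
  shows "continuous_on {a..b} (\<lambda>t. harmonic_exp_term a t \<beta> \<omega> j)"
proof (induction j)
  case (Suc j)
  have "(\<lambda>s. exp (2 * \<i> * of_real (\<omega> * (s - a))) * of_real (\<beta> s) * cnj (harmonic_exp_term a s \<beta> \<omega> j)) integrable_on {a..b}"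
  proof (cases "{a..b} = {}")
    case False
    then obtain t where "t \<in> {a..b}" by blast
    from harmonic_exp_term_Suc(1)[OF \<beta> this Suc] show ?thesis using absolutely_integrable_on_def by blast
  qed (simp only: integrable_on_empty)
  then have "continuous_on {a..b} (\<lambda>t. integral {a..t} (\<lambda>s. exp (2 * \<i> * of_real (\<omega> * (s - a))) * of_real (\<beta> s) * cnj (harmonic_exp_term a s \<beta> \<omega> j)))"
    by (rule indefinite_integral_continuous_1)
  then show ?case
    by (rule continuous_on_eq) (use harmonic_exp_term_Suc(2)[OF \<beta> _ Suc] in simp)
qed simp

section \<open>Factorial bounds and convergence of the series\<close>

lemma ac_primitive_power:
  fixes F :: "real \<Rightarrow> real"
  assumes F: "ac_primitive a b F f"
  shows "ac_primitive a b (\<lambda>t. F t ^ Suc n) (\<lambda>t. real (Suc n) * F t ^ n * f t)"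
proof (induction n)
  case (Suc n)
  have "ac_primitive a b (\<lambda>t. F t * F t ^ Suc n) (\<lambda>t. F t * (real (Suc n) * F t ^ n * f t) + f t * F t ^ Suc n)"
    by (rule ac_primitive_mult[OF F Suc])
  then show ?case by (rule ac_primitive_cong) (auto simp: algebra_simps)
qed (use F in simp)

lemma absolutely_integrable_on_subset_Icc:
  fixes f :: "real \<Rightarrow> 'a::euclidean_space"
  assumes "f absolutely_integrable_on {a..b}" "a \<le> c" "d \<le> b"
  shows "f absolutely_integrable_on {c..d}"
  using assms(1) by (rule set_integrable_subset) (use assms in auto)

text \<open>At frequency 0 and with a nonnegative function, the recursion integrates B' B^j / j! for
  B the integral of |\<beta>|. The result is the mass of the ordered simplex and serves as a
  majorant for all terms.\<close>

lemma harmonic_exp_term_abs: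
  fixes \<beta> :: "real \<Rightarrow> real"
  assumes \<beta>: "\<beta> absolutely_integrable_on {a..b}" and t: "t \<in> {a..b}"
  shows "harmonic_exp_term a t (\<lambda>s. \<bar>\<beta> s\<bar>) 0 j = of_real (integral {a..t} (\<lambda>s. \<bar>\<beta> s\<bar>) ^ j / fact j)"
  using t
proof (induction j arbitrary: t)
  case (Suc j)
  have \<beta>': "(\<lambda>s. \<bar>\<beta> s\<bar>) absolutely_integrable_on {a..b}"
    using absolutely_integrable_norm[OF \<beta>] by (simp add: o_def)
  define B where "B = (\<lambda>t. integral {a..t} (\<lambda>s. \<bar>\<beta> s\<bar>))"
  have "ac_primitive a b B (\<lambda>s. \<bar>\<beta> s\<bar>)"
    unfolding B_def by (rule ac_primitive_indefinite_integral[OF \<beta>'])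
  have "\<bar>\<beta> s\<bar> * (B s ^ j / fact j) = 1 / fact (Suc j) * (real (Suc j) * B s ^ j * \<bar>\<beta> s\<bar>)" for s
    unfolding fact_Suc by (simp add: field_simps del: of_nat_Suc)
  with ac_primitive_cmult[OF ac_primitive_power[OF \<open>ac_primitive a b B (\<lambda>s. \<bar>\<beta> s\<bar>)\<close>], of "1 / fact (Suc j)" j]
  have P: "ac_primitive a b (\<lambda>t. B t ^ Suc j / fact (Suc j)) (\<lambda>s. \<bar>\<beta> s\<bar> * (B s ^ j / fact j))"
    by (simp add: mult_ac)
  have "harmonic_exp_term a t (\<lambda>s. \<bar>\<beta> s\<bar>) 0 (Suc j) =
      integral {a..t} (\<lambda>s. exp (2 * \<i> * of_real (0 * (s - a))) * of_real \<bar>\<beta> s\<bar> * cnj (harmonic_exp_term a s (\<lambda>s. \<bar>\<beta> s\<bar>) 0 j))"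
    by (rule harmonic_exp_term_Suc(2)[OF \<beta>' Suc.prems continuous_on_harmonic_exp_term[OF \<beta>']])
  also have "\<dots> = integral {a..t} (\<lambda>s. of_real (\<bar>\<beta> s\<bar> * (B s ^ j / fact j)))"
    using Suc by (intro Henstock_Kurzweil_Integration.integral_cong) (simp add: B_def)
  also have "\<dots> = of_real (B t ^ Suc j / fact (Suc j) - B a ^ Suc j / fact (Suc j))"
    using ac_primitive_has_integral[OF P, of a t] Suc.prems
    by (intro integral_unique has_integral_of_real) auto
  finally show ?case by (simp add: B_def)
qed simp

lemma norm_harmonic_integrand:
  "norm (harmonic_integrand a b \<beta> z j s) =
    indicator (ordered_simplex a b j) s * exp (- (2 * Im z * alternating_sum a j s)) * \<bar>\<Prod>\<nu>=1..j. \<beta> (s \<nu>)\<bar>"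
  unfolding harmonic_integrand_def norm_mult norm_of_real by (simp add: norm_exp_eq_Re indicator_def)

text \<open>The real part of the frequency only rotates the integrand; only the imaginary part costs
  a factor.\<close>

lemma norm_harmonic_integrand_le:
  "norm (harmonic_integrand a b \<beta> z j s) \<le>
    exp (2 * \<bar>Im z\<bar> * (b - a)) ^ j * norm (harmonic_integrand a b (\<lambda>s. \<bar>\<beta> s\<bar>) 0 j s)"
proof (cases "s \<in> ordered_simplex a b j")
  case True
  have "- (2 * Im z * alternating_sum a j s) \<le> \<bar>2 * Im z * alternating_sum a j s\<bar>" by (rule abs_ge_minus_self)
  also have "\<dots> = 2 * \<bar>Im z\<bar> * \<bar>alternating_sum a j s\<bar>" by (simp add: abs_mult)
  also have "\<dots> \<le> 2 * \<bar>Im z\<bar> * (real j * (b - a))"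
    by (rule mult_left_mono[OF abs_alternating_sum_le[OF True]]) simp
  also have "\<dots> = real j * (2 * \<bar>Im z\<bar> * (b - a))" by (simp only: mult_ac)
  finally have "exp (- (2 * Im z * alternating_sum a j s)) \<le> exp (real j * (2 * \<bar>Im z\<bar> * (b - a)))"
    by (simp only: exp_le_cancel_iff)
  then have "exp (- (2 * Im z * alternating_sum a j s)) \<le> exp (2 * \<bar>Im z\<bar> * (b - a)) ^ j"
    unfolding exp_of_nat_mult .
  then have "exp (- (2 * Im z * alternating_sum a j s)) * \<bar>\<Prod>\<nu>=1..j. \<beta> (s \<nu>)\<bar> \<le>
      exp (2 * \<bar>Im z\<bar> * (b - a)) ^ j * \<bar>\<Prod>\<nu>=1..j. \<beta> (s \<nu>)\<bar>"
    by (rule mult_right_mono) simp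
  moreover have "\<bar>\<Prod>\<nu>=1..j. \<bar>\<beta> (s \<nu>)\<bar>\<bar> = \<bar>\<Prod>\<nu>=1..j. \<beta> (s \<nu>)\<bar>"
    unfolding abs_prod abs_idempotent ..
  ultimately show ?thesis
    unfolding norm_harmonic_integrand using True
    by (simp only: indicator_simps mult_1_left zero_complex.simps mult_zero_left mult_zero_right minus_zero exp_zero)
qed (simp add: harmonic_integrand_def)

text \<open>Being uniform in \<open>t\<close> and on strips around the real axis, the bound serves
  convergence, continuity in \<open>t\<close> and holomorphy alike.\<close>

lemma norm_integral_harmonic_integrand_le:
  fixes \<beta> :: "real \<Rightarrow> real"
  assumes \<beta>: "\<beta> absolutely_integrable_on {a..b}" and t: "t \<in> {a..b}"
  shows "norm (\<integral>s. harmonic_integrand a t \<beta> z j s \<partial>PiM {1..j} (\<lambda>_. lebesgue)) \<le>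
    (exp (2 * \<bar>Im z\<bar> * (b - a)) * integral {a..b} (\<lambda>s. \<bar>\<beta> s\<bar>)) ^ j / fact j"
proof -
  let ?M = "PiM {1..j} (\<lambda>_. lebesgue :: real measure)"
  let ?B = "\<lambda>t. integral {a..t} (\<lambda>s. \<bar>\<beta> s\<bar>)"
  have \<beta>': "(\<lambda>s. \<bar>\<beta> s\<bar>) absolutely_integrable_on {a..b}"
    using absolutely_integrable_norm[OF \<beta>] by (simp add: o_def)
  have i: "integrable ?M (harmonic_integrand a t (\<lambda>s. \<bar>\<beta> s\<bar>) 0 j)"
    by (rule harmonic_integrand_integrable[OF \<beta>']) (use t in auto)
  \<comment> \<open>At frequency 0 and with |\<beta>| the integrand is its own modulus, so the
    integral of the modulus is a term already computed.\<close>
  have pos: "of_real (norm (harmonic_integrand a t (\<lambda>s. \<bar>\<beta> s\<bar>) 0 j s)) = harmonic_integrand a t (\<lambda>s. \<bar>\<beta> s\<bar>) 0 j s" for s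
  proof (cases "s \<in> ordered_simplex a t j")
    case True
    have "harmonic_integrand a t (\<lambda>s. \<bar>\<beta> s\<bar>) 0 j s = of_real (\<Prod>\<nu>=1..j. \<bar>\<beta> (s \<nu>)\<bar>)"
      using True by (simp only: harmonic_integrand_def indicator_simps mult_zero_right mult_zero_left exp_zero mult_1_left)
    moreover have "0 \<le> (\<Prod>\<nu>=1..j. \<bar>\<beta> (s \<nu>)\<bar>)" by (intro prod_nonneg) simp
    ultimately show ?thesis by (simp only: norm_of_real abs_of_nonneg)
  qed (simp add: harmonic_integrand_def)
  have "(\<integral>s. norm (harmonic_integrand a t (\<lambda>s. \<bar>\<beta> s\<bar>) 0 j s) \<partial>?M) = ?B t ^ j / fact j"
  proof -
    have "complex_of_real (\<integral>s. norm (harmonic_integrand a t (\<lambda>s. \<bar>\<beta> s\<bar>) 0 j s) \<partial>?M) = harmonic_exp_term a t (\<lambda>s. \<bar>\<beta> s\<bar>) 0 j"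
      unfolding harmonic_exp_term_eq of_real_0 by (subst integral_complex_of_real[symmetric]) (simp only: pos)
    then show ?thesis unfolding harmonic_exp_term_abs[OF \<beta> t] of_real_eq_iff .
  qed
  moreover have "norm (\<integral>s. harmonic_integrand a t \<beta> z j s \<partial>?M) \<le>
      (\<integral>s. exp (2 * \<bar>Im z\<bar> * (t - a)) ^ j * norm (harmonic_integrand a t (\<lambda>s. \<bar>\<beta> s\<bar>) 0 j s) \<partial>?M)"
  proof (rule order.trans[OF integral_norm_bound integral_mono])
    show "integrable ?M (\<lambda>s. norm (harmonic_integrand a t \<beta> z j s))"
      by (rule integrable_norm[OF harmonic_integrand_integrable[OF \<beta>]]) (use t in auto)
    show "integrable ?M (\<lambda>s. exp (2 * \<bar>Im z\<bar> * (t - a)) ^ j * norm (harmonic_integrand a t (\<lambda>s. \<bar>\<beta> s\<bar>) 0 j s))"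
      using i by (intro integrable_mult_right integrable_norm)
  qed (rule norm_harmonic_integrand_le)
  ultimately have "norm (\<integral>s. harmonic_integrand a t \<beta> z j s \<partial>?M) \<le> exp (2 * \<bar>Im z\<bar> * (t - a)) ^ j * (?B t ^ j / fact j)"
    by simp
  also have "\<dots> = (exp (2 * \<bar>Im z\<bar> * (t - a)) * ?B t) ^ j / fact j" by (simp only: power_mult_distrib times_divide_eq_right)
  also have "\<dots> \<le> (exp (2 * \<bar>Im z\<bar> * (b - a)) * ?B b) ^ j / fact j"
  proof (intro divide_right_mono power_mono mult_mono)
    have ii: "(\<lambda>s. \<bar>\<beta> s\<bar>) integrable_on {a..c}" if "c \<le> b" for c
      using absolutely_integrable_on_subset_Icc[OF \<beta>' order.refl that] absolutely_integrable_on_def by blast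
    show "?B t \<le> ?B b" using t by (intro integral_subset_le ii) auto
    show "0 \<le> ?B t" using t by (intro Henstock_Kurzweil_Integration.integral_nonneg ii) auto
    then show "0 \<le> exp (2 * \<bar>Im z\<bar> * (t - a)) * ?B t" by simp
    have "2 * \<bar>Im z\<bar> * (t - a) \<le> 2 * \<bar>Im z\<bar> * (b - a)" using t by (intro mult_left_mono) auto
    then show "exp (2 * \<bar>Im z\<bar> * (t - a)) \<le> exp (2 * \<bar>Im z\<bar> * (b - a))" by (simp only: exp_le_cancel_iff)
  qed auto
  finally show ?thesis .
qed

lemma norm_harmonic_exp_term_le:
  fixes \<beta> :: "real \<Rightarrow> real"
  assumes "\<beta> absolutely_integrable_on {a..b}" and "t \<in> {a..b}"
  shows "norm (harmonic_exp_term a t \<beta> \<omega> j) \<le> integral {a..b} (\<lambda>s. \<bar>\<beta> s\<bar>) ^ j / fact j"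
  using norm_integral_harmonic_integrand_le[OF assms, where z = "of_real \<omega>" and j = j] by (simp add: harmonic_exp_term_eq)

lemma summable_power_div_fact: "summable (\<lambda>j. x ^ j / fact j :: real)"
  using summable_exp[of x] by (simp add: field_simps)

lemma harmonic_exp_sums:
  fixes \<beta> :: "real \<Rightarrow> real"
  assumes "\<beta> absolutely_integrable_on {a..b}" and "t \<in> {a..b}"
  shows "(\<lambda>j. harmonic_exp_term a t \<beta> \<omega> j) sums harmonic_exp a t \<beta> \<omega>"
proof -
  have "summable (\<lambda>j. harmonic_exp_term a t \<beta> \<omega> j)"
    by (rule summable_comparison_test'[OF summable_power_div_fact norm_harmonic_exp_term_le[OF assms]])
  then have "(\<lambda>j. harmonic_exp_term a t \<beta> \<omega> (Suc j)) sums (\<Sum>j. harmonic_exp_term a t \<beta> \<omega> (Suc j))"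
    by (intro summable_sums summable_Suc_iff[THEN iffD2])
  from sums_Suc[OF this] show ?thesis by (simp add: harmonic_exp_def add.commute)
qed

text \<open>The factorial bounds are uniform in \<open>t\<close>, so the Weierstrass test
  applies.\<close>

lemma continuous_on_harmonic_exp:
  fixes \<beta> :: "real \<Rightarrow> real"
  assumes \<beta>: "\<beta> absolutely_integrable_on {a..b}"
  shows "continuous_on {a..b} (\<lambda>t. harmonic_exp a t \<beta> \<omega>)"
proof -
  have ul: "uniform_limit {a..b} (\<lambda>n t. \<Sum>j<n. harmonic_exp_term a t \<beta> \<omega> j) (\<lambda>t. \<Sum>j. harmonic_exp_term a t \<beta> \<omega> j) sequentially"
    by (rule Weierstrass_m_test[OF norm_harmonic_exp_term_le[OF \<beta>] summable_power_div_fact])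
  have "continuous_on {a..b} (\<lambda>t. \<Sum>j<n. harmonic_exp_term a t \<beta> \<omega> j)" for n
    by (rule continuous_on_sum) (rule continuous_on_harmonic_exp_term[OF \<beta>])
  from uniform_limit_theorem[OF always_eventually[OF allI[OF this]] ul]
  have "continuous_on {a..b} (\<lambda>t. \<Sum>j. harmonic_exp_term a t \<beta> \<omega> j)" by simp
  then show ?thesis
    by (rule continuous_on_eq) (use sums_unique[OF harmonic_exp_sums[OF \<beta>]] in simp)
qed

section \<open>Integral and differential equation of the harmonic exponential\<close>

lemma harmonic_kernel_absolutely_integrable:
  fixes \<beta> :: "real \<Rightarrow> real" and h :: "real \<Rightarrow> complex"
  assumes \<beta>: "\<beta> absolutely_integrable_on {a..b}" and h: "continuous_on {a..b} h"
  shows "(\<lambda>s. exp (2 * \<i> * of_real (\<omega> * (s - a))) * of_real (\<beta> s) * h s) absolutely_integrable_on {a..b}"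
proof -
  have c: "continuous_on {a..b} (\<lambda>s. exp (2 * \<i> * of_real (\<omega> * (s - a))) * h s)"
    by (intro continuous_intros h)
  have "(\<lambda>s. (exp (2 * \<i> * of_real (\<omega> * (s - a))) * h s) * of_real (\<beta> s)) absolutely_integrable_on {a..b}"
  proof (rule absolutely_integrable_bounded_measurable_product[OF bilinear_times])
    show "(\<lambda>s. exp (2 * \<i> * of_real (\<omega> * (s - a))) * h s) \<in> borel_measurable (lebesgue_on {a..b})"
      by (rule continuous_imp_measurable_on_sets_lebesgue[OF c]) simp
    show "bounded ((\<lambda>s. exp (2 * \<i> * of_real (\<omega> * (s - a))) * h s) ` {a..b})"
      by (intro compact_imp_bounded compact_continuous_image c) simp
    show "(\<lambda>s. of_real (\<beta> s) :: complex) absolutely_integrable_on {a..b}"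
      using absolutely_integrable_linear[OF \<beta> bounded_linear_of_real] by (simp add: o_def)
  qed simp
  then show ?thesis by (simp add: mult_ac)
qed

text \<open>The recursion summed over all terms. Sum and integral are interchanged by dominated
  convergence, with |\<beta>| times the sum of the bounds as majorant.\<close>

lemma harmonic_exp_integral_equation:
  fixes \<beta> :: "real \<Rightarrow> real"
  assumes \<beta>: "\<beta> absolutely_integrable_on {a..b}" and t: "t \<in> {a..b}"
  shows "harmonic_exp a t \<beta> \<omega> = 1 +
    integral {a..t} (\<lambda>s. exp (2 * \<i> * of_real (\<omega> * (s - a))) * of_real (\<beta> s) * cnj (harmonic_exp a s \<beta> \<omega>))"
proof -
  define e where "e = (\<lambda>s. exp (2 * \<i> * of_real (\<omega> * (s - a))) * of_real (\<beta> s))"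
  have ne: "norm (e s) = \<bar>\<beta> s\<bar>" for s by (simp add: e_def norm_mult norm_exp_eq_Re)
  define S where "S = (\<lambda>n s. \<Sum>j<n. harmonic_exp_term a s \<beta> \<omega> j)"
  define C where "C = (\<Sum>j. integral {a..b} (\<lambda>s. \<bar>\<beta> s\<bar>) ^ j / fact j)"
  have \<beta>t: "\<beta> absolutely_integrable_on {a..t}"
    by (rule absolutely_integrable_on_subset_Icc[OF \<beta>]) (use t in auto)
  have Bpos: "0 \<le> integral {a..b} (\<lambda>s. \<bar>\<beta> s\<bar>)"
    using absolutely_integrable_norm[OF \<beta>] by (intro Henstock_Kurzweil_Integration.integral_nonneg) (auto simp: o_def absolutely_integrable_on_def)
  have Sb: "norm (S n s) \<le> C" if "s \<in> {a..t}" for n s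
  proof -
    have "norm (S n s) \<le> (\<Sum>j<n. integral {a..b} (\<lambda>s. \<bar>\<beta> s\<bar>) ^ j / fact j)"
      unfolding S_def by (rule order.trans[OF norm_sum]) (use that t in \<open>intro sum_mono norm_harmonic_exp_term_le[OF \<beta>]; simp\<close>)
    also have "\<dots> \<le> C" unfolding C_def by (rule sum_le_suminf[OF summable_power_div_fact]) (use Bpos in auto)
    finally show ?thesis .
  qed
  have ct: "continuous_on {a..t} (\<lambda>s. harmonic_exp_term a s \<beta> \<omega> j)" for j
    by (rule continuous_on_subset[OF continuous_on_harmonic_exp_term[OF \<beta>]]) (use t in auto)
  have intj: "(\<lambda>s. e s * cnj (harmonic_exp_term a s \<beta> \<omega> j)) integrable_on {a..t}" for j
    using harmonic_kernel_absolutely_integrable[OF \<beta>t continuous_on_cnj[OF ct]] unfolding e_def absolutely_integrable_on_def by blast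
  \<comment> \<open>The partial sums are Picard iterates: one more term amounts to one more
    application of the integral operator.\<close>
  have step: "S (Suc n) t = 1 + integral {a..t} (\<lambda>s. e s * cnj (S n s))" for n
  proof -
    have "S (Suc n) t = 1 + (\<Sum>j<n. harmonic_exp_term a t \<beta> \<omega> (Suc j))"
      unfolding S_def by (subst sum.lessThan_Suc_shift) simp
    also have "(\<Sum>j<n. harmonic_exp_term a t \<beta> \<omega> (Suc j)) = (\<Sum>j<n. integral {a..t} (\<lambda>s. e s * cnj (harmonic_exp_term a s \<beta> \<omega> j)))"
      unfolding e_def by (intro sum.cong refl harmonic_exp_term_Suc(2)[OF \<beta> t continuous_on_harmonic_exp_term[OF \<beta>]])
    also have "\<dots> = integral {a..t} (\<lambda>s. \<Sum>j<n. e s * cnj (harmonic_exp_term a s \<beta> \<omega> j))"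
      using intj by (intro Henstock_Kurzweil_Integration.integral_sum[symmetric]) auto
    finally show ?thesis by (simp add: S_def sum_distrib_left)
  qed
  have lim: "(\<lambda>n. S n s) \<longlonglongrightarrow> harmonic_exp a s \<beta> \<omega>" if "s \<in> {a..b}" for s
    using harmonic_exp_sums[OF \<beta> that] by (simp add: sums_def S_def)
  have "(\<lambda>n. integral {a..t} (\<lambda>s. e s * cnj (S n s))) \<longlonglongrightarrow> integral {a..t} (\<lambda>s. e s * cnj (harmonic_exp a s \<beta> \<omega>))"
  proof (rule dominated_convergence(2)[where h = "\<lambda>s. \<bar>\<beta> s\<bar> * C"])
    have cS: "continuous_on {a..t} (\<lambda>s. cnj (S n s))" for n unfolding S_def by (intro continuous_intros ct)
    show "(\<lambda>s. e s * cnj (S n s)) integrable_on {a..t}" for n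
      using harmonic_kernel_absolutely_integrable[OF \<beta>t cS] unfolding e_def absolutely_integrable_on_def by blast
    show "(\<lambda>s. \<bar>\<beta> s\<bar> * C) integrable_on {a..t}"
      using absolutely_integrable_norm[OF \<beta>t] by (intro integrable_on_mult_left) (simp add: o_def absolutely_integrable_on_def)
    show "norm (e s * cnj (S n s)) \<le> \<bar>\<beta> s\<bar> * C" if "s \<in> {a..t}" for n s
      using Sb[OF that] by (simp add: norm_mult ne mult_left_mono)
    show "(\<lambda>n. e s * cnj (S n s)) \<longlonglongrightarrow> e s * cnj (harmonic_exp a s \<beta> \<omega>)" if "s \<in> {a..t}" for s
      using lim[of s] that t by (intro tendsto_intros) auto
  qed
  then have "(\<lambda>n. S (Suc n) t) \<longlonglongrightarrow> 1 + integral {a..t} (\<lambda>s. e s * cnj (harmonic_exp a s \<beta> \<omega>))"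
    unfolding step by (intro tendsto_intros)
  moreover have "(\<lambda>n. S (Suc n) t) \<longlonglongrightarrow> harmonic_exp a t \<beta> \<omega>"
    by (rule LIMSEQ_Suc[OF lim[OF t]])
  ultimately show ?thesis unfolding e_def by (rule LIMSEQ_unique[rotated])
qed

lemma harmonic_exp_ac_primitive:
  fixes \<beta> :: "real \<Rightarrow> real"
  assumes \<beta>: "\<beta> absolutely_integrable_on {a..b}" and ab: "a \<le> b"
  shows "ac_primitive a b (\<lambda>t. harmonic_exp a t \<beta> \<omega>)
      (\<lambda>t. exp (2 * \<i> * of_real (\<omega> * (t - a))) * of_real (\<beta> t) * cnj (harmonic_exp a t \<beta> \<omega>))"
    and "harmonic_exp a a \<beta> \<omega> = 1"
proof -
  have "(\<lambda>t. exp (2 * \<i> * of_real (\<omega> * (t - a))) * of_real (\<beta> t) * cnj (harmonic_exp a t \<beta> \<omega>)) absolutely_integrable_on {a..b}"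
    by (intro harmonic_kernel_absolutely_integrable[OF \<beta>] continuous_on_cnj continuous_on_harmonic_exp[OF \<beta>])
  from ac_primitive_add[OF ac_primitive_const[of a b 1] ac_primitive_indefinite_integral[OF this]]
  show "ac_primitive a b (\<lambda>t. harmonic_exp a t \<beta> \<omega>)
      (\<lambda>t. exp (2 * \<i> * of_real (\<omega> * (t - a))) * of_real (\<beta> t) * cnj (harmonic_exp a t \<beta> \<omega>))"
    by (rule ac_primitive_cong) (rule harmonic_exp_integral_equation[OF \<beta>], simp_all)
  show "harmonic_exp a a \<beta> \<omega> = 1"
    using harmonic_exp_integral_equation[OF \<beta>, of a] ab by simp
qed

section \<open>Analytic continuation in the frequency\<close>

lemma integral_exp_holomorphic:
  fixes h :: "'a \<Rightarrow> complex" and \<phi> :: "'a \<Rightarrow> real"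
  assumes h: "integrable M h" and \<phi>: "\<phi> \<in> borel_measurable M" and C: "\<And>s. \<bar>\<phi> s\<bar> \<le> C"
  shows "(\<lambda>z. \<integral>s. exp (z * of_real (\<phi> s)) * h s \<partial>M) holomorphic_on UNIV"
proof -
  have [measurable]: "h \<in> borel_measurable M" "\<phi> \<in> borel_measurable M" using h \<phi> by auto
  have C0: "0 \<le> C" using C[of undefined] by (rule order.trans[OF abs_ge_zero])
  \<comment> \<open>Coefficients of the power series that results from expanding the exponential and
    integrating term by term. It converges everywhere because \<phi> is bounded.\<close>
  define a where "a = (\<lambda>n. (\<integral>s. of_real (\<phi> s) ^ n * h s \<partial>M) / fact n)"
  have int: "integrable M (\<lambda>s. of_real (\<phi> s) ^ n * h s)" for n
  proof (rule Bochner_Integration.integrable_bound[OF integrable_mult_right[OF h, of "of_real (C ^ n)"]])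
    have "\<bar>\<phi> s\<bar> ^ n \<le> C ^ n" for s using C by (intro power_mono) auto
    then show "AE s in M. norm (of_real (\<phi> s) ^ n * h s) \<le> norm (of_real (C ^ n) * h s)"
      using C0 by (intro AE_I2) (simp add: norm_mult norm_power mult_right_mono)
  qed simp
  have sums: "(\<lambda>n. a n * w ^ n) sums (\<integral>s. exp (w * of_real (\<phi> s)) * h s \<partial>M)" for w
  proof -
    define f where "f = (\<lambda>n s. (w ^ n / fact n) * (of_real (\<phi> s) ^ n * h s))"
    have fi: "integrable M (f n)" for n unfolding f_def by (intro integrable_mult_right int)
    have fn: "norm (f n s) = (norm w * \<bar>\<phi> s\<bar>) ^ n / fact n * norm (h s)" for n s
      by (simp add: f_def norm_mult norm_power norm_divide power_mult_distrib)
    have fs: "(\<lambda>n. f n s) sums (exp (w * of_real (\<phi> s)) * h s)" for s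
    proof -
      have "(\<lambda>n. (w * of_real (\<phi> s)) ^ n /\<^sub>R fact n * h s) sums (exp (w * of_real (\<phi> s)) * h s)"
        by (intro sums_mult2 exp_converges)
      then show ?thesis by (simp add: f_def power_mult_distrib scaleR_conv_of_real field_simps)
    qed
    have S: "(\<lambda>n. integral\<^sup>L M (f n)) sums (\<integral>s. (\<Sum>n. f n s) \<partial>M)"
    proof (rule sums_integral[OF fi])
      show "AE s in M. summable (\<lambda>n. norm (f n s))"
        unfolding fn by (intro AE_I2 summable_mult2 summable_power_div_fact)
      show "summable (\<lambda>n. \<integral>s. norm (f n s) \<partial>M)"
      proof (rule summable_comparison_test')
        show "summable (\<lambda>n. (norm w * C) ^ n / fact n * (\<integral>s. norm (h s) \<partial>M))"
          by (intro summable_mult2 summable_power_div_fact)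
        fix n
        have "(\<integral>s. norm (f n s) \<partial>M) \<le> (\<integral>s. (norm w * C) ^ n / fact n * norm (h s) \<partial>M)"
        proof (rule integral_mono)
          show "integrable M (\<lambda>s. norm (f n s))" by (rule integrable_norm[OF fi])
          show "integrable M (\<lambda>s. (norm w * C) ^ n / fact n * norm (h s))" using h by (intro integrable_mult_right integrable_norm)
          show "norm (f n s) \<le> (norm w * C) ^ n / fact n * norm (h s)" for s
            unfolding fn using C by (intro mult_right_mono divide_right_mono power_mono mult_left_mono) auto
        qed
        then show "norm (\<integral>s. norm (f n s) \<partial>M) \<le> (norm w * C) ^ n / fact n * (\<integral>s. norm (h s) \<partial>M)"
          by (simp add: integral_nonneg_AE)
      qed
    qed
    have "(\<lambda>s. \<Sum>n. f n s) = (\<lambda>s. exp (w * of_real (\<phi> s)) * h s)"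
      using sums_unique[OF fs] by auto
    moreover have "integral\<^sup>L M (f n) = a n * w ^ n" for n
      unfolding f_def a_def by simp
    ultimately show ?thesis using S by (simp only:)
  qed
  have hol: "(\<lambda>z. \<integral>s. exp (z * of_real (\<phi> s)) * h s \<partial>M) holomorphic_on ball 0 r" for r
    by (rule power_series_holomorphic[where a = a]) (use sums in simp)
  have "(\<lambda>z. \<integral>s. exp (z * of_real (\<phi> s)) * h s \<partial>M) holomorphic_on (\<Union>n. ball 0 (real n))"
    by (rule holomorphic_on_UN_open) (use hol in auto)
  moreover have "(\<Union>n. ball 0 (real n)) = (UNIV :: complex set)"
    using reals_Archimedean2 by (auto simp: dist_norm)
  ultimately show ?thesis by (simp only:)
qed

definition harmonic_exp_complex :: "real \<Rightarrow> real \<Rightarrow> (real \<Rightarrow> real) \<Rightarrow> complex \<Rightarrow> complex" where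
  "harmonic_exp_complex a b \<beta> z = (\<Sum>j. \<integral>s. harmonic_integrand a b \<beta> z j s \<partial>PiM {1..j} (\<lambda>_. lebesgue))"

lemma harmonic_exp_complex_of_real:
  fixes \<beta> :: "real \<Rightarrow> real"
  assumes "\<beta> absolutely_integrable_on {a..b}" "a \<le> b"
  shows "harmonic_exp_complex a b \<beta> (of_real \<omega>) = harmonic_exp a b \<beta> \<omega>"
  using sums_unique[OF harmonic_exp_sums[OF assms(1), of b \<omega>]] assms(2)
  by (simp add: harmonic_exp_complex_def harmonic_exp_term_eq)

lemma harmonic_exp_complex_holomorphic:
  fixes \<beta> :: "real \<Rightarrow> real"
  assumes \<beta>: "\<beta> absolutely_integrable_on {a..b}" and ab: "a \<le> b"
  shows "harmonic_exp_complex a b \<beta> holomorphic_on UNIV"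
proof -
  define T where "T = (\<lambda>j z. \<integral>s. harmonic_integrand a b \<beta> z j s \<partial>PiM {1..j} (\<lambda>_. lebesgue))"
  define B where "B = integral {a..b} (\<lambda>s. \<bar>\<beta> s\<bar>)"
  have Tb: "norm (T j z) \<le> (exp (2 * \<bar>Im z\<bar> * (b - a)) * B) ^ j / fact j" for j z
    unfolding T_def B_def using norm_integral_harmonic_integrand_le[OF \<beta>, of b] ab by simp
  have Bpos: "0 \<le> B" unfolding B_def
    using absolutely_integrable_norm[OF \<beta>] by (intro Henstock_Kurzweil_Integration.integral_nonneg) (auto simp: o_def absolutely_integrable_on_def)
  have hol: "T j holomorphic_on UNIV" for j
  proof -
    \<comment> \<open>The alternating sum is cut off outside the simplex, since a bound is demanded
      at every point; \<open>Re\<close> turns the complex indicator into a real one.\<close>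
    define \<phi> where "\<phi> = (\<lambda>s. Re (indicator (ordered_simplex a b j) s) * alternating_sum a j s)"
    have "(\<lambda>z. \<integral>s. exp (z * of_real (\<phi> s)) * harmonic_integrand a b \<beta> 0 j s \<partial>PiM {1..j} (\<lambda>_. lebesgue)) holomorphic_on UNIV"
    proof (rule integral_exp_holomorphic)
      show "integrable (PiM {1..j} (\<lambda>_. lebesgue)) (harmonic_integrand a b \<beta> 0 j)"
        by (rule harmonic_integrand_integrable[OF \<beta>]) simp
      show "\<phi> \<in> borel_measurable (PiM {1..j} (\<lambda>_. lebesgue))"
        unfolding \<phi>_def by (intro borel_measurable_times alternating_sum_measurable
          measurable_compose[OF ordered_simplex_indicator_measurable borel_measurable_Re])
      show "\<bar>\<phi> s\<bar> \<le> real j * (b - a)" for s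
        using abs_alternating_sum_le[of s a b j] ab by (cases "s \<in> ordered_simplex a b j") (auto simp: \<phi>_def)
    qed
    then have "((\<lambda>z. \<integral>s. exp (z * of_real (\<phi> s)) * harmonic_integrand a b \<beta> 0 j s \<partial>PiM {1..j} (\<lambda>_. lebesgue)) \<circ> (\<lambda>z. 2 * \<i> * z)) holomorphic_on UNIV"
      by (intro holomorphic_on_compose_gen[where t = UNIV]) (auto intro!: holomorphic_intros)
    moreover have "exp (2 * \<i> * z * of_real (\<phi> s)) * harmonic_integrand a b \<beta> 0 j s = harmonic_integrand a b \<beta> z j s" for z s
      by (cases "s \<in> ordered_simplex a b j") (simp_all add: harmonic_integrand_def \<phi>_def)
    ultimately show ?thesis by (simp add: T_def[abs_def] o_def)
  qed
  have "(\<lambda>z. \<Sum>j. T j z) holomorphic_on UNIV"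
  proof (rule holomorphic_uniform_sequence[where f = "\<lambda>n z. \<Sum>j<n. T j z"])
    show "(\<lambda>z. \<Sum>j<n. T j z) holomorphic_on UNIV" for n by (intro holomorphic_on_sum hol)
    fix z0 :: complex
    have "uniform_limit (cball z0 1) (\<lambda>n z. \<Sum>j<n. T j z) (\<lambda>z. \<Sum>j. T j z) sequentially"
    proof (rule Weierstrass_m_test)
      \<comment> \<open>On the closed disk of radius 1 about \<open>z0\<close> the modulus of the
        imaginary part is at most |Im z0| + 1, which gives a majorant independent of
        \<open>z\<close>.\<close>
      show "summable (\<lambda>j. (exp (2 * (\<bar>Im z0\<bar> + 1) * (b - a)) * B) ^ j / fact j)" by (rule summable_power_div_fact)
      fix j z assume z: "z \<in> cball z0 1"
      have "\<bar>Im z - Im z0\<bar> \<le> 1" using z abs_Im_le_cmod[of "z - z0"] by (simp add: dist_norm norm_minus_commute)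
      then have "2 * \<bar>Im z\<bar> * (b - a) \<le> 2 * (\<bar>Im z0\<bar> + 1) * (b - a)" using ab by (intro mult_right_mono) auto
      then have "exp (2 * \<bar>Im z\<bar> * (b - a)) \<le> exp (2 * (\<bar>Im z0\<bar> + 1) * (b - a))" by (simp only: exp_le_cancel_iff)
      then have "(exp (2 * \<bar>Im z\<bar> * (b - a)) * B) ^ j / fact j \<le> (exp (2 * (\<bar>Im z0\<bar> + 1) * (b - a)) * B) ^ j / fact j"
        using Bpos by (intro divide_right_mono power_mono mult_right_mono) auto
      with Tb[of j z] show "norm (T j z) \<le> (exp (2 * (\<bar>Im z0\<bar> + 1) * (b - a)) * B) ^ j / fact j" by (rule order.trans)
    qed
    then show "\<exists>d>0. cball z0 d \<subseteq> UNIV \<and> uniform_limit (cball z0 d) (\<lambda>n z. \<Sum>j<n. T j z) (\<lambda>z. \<Sum>j. T j z) sequentially"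
      by (intro exI[of _ 1]) simp
  qed simp
  then show ?thesis by (simp add: harmonic_exp_complex_def[abs_def] T_def)
qed

section \<open>Conjugation and large frequencies\<close>

lemma cnj_harmonic_exp_term: "cnj (harmonic_exp_term a b \<beta> \<omega> j) = harmonic_exp_term a b \<beta> (- \<omega>) j"
proof -
  have "cnj (harmonic_integrand a b \<beta> (of_real \<omega>) j s) = harmonic_integrand a b \<beta> (of_real (- \<omega>)) j s" for s
    by (cases "s \<in> ordered_simplex a b j") (simp_all add: harmonic_integrand_def exp_cnj)
  then have "(\<integral>s. cnj (harmonic_integrand a b \<beta> (of_real \<omega>) j s) \<partial>PiM {1..j} (\<lambda>_. lebesgue)) =
      (\<integral>s. harmonic_integrand a b \<beta> (of_real (- \<omega>)) j s \<partial>PiM {1..j} (\<lambda>_. lebesgue))"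
    by (intro Bochner_Integration.integral_cong) auto
  then show ?thesis
    unfolding harmonic_exp_term_eq by simp
qed

text \<open>Conjugation at real frequencies becomes reflection of the frequency, which does extend
  holomorphically. It also carries limits from plus infinity to minus infinity.\<close>

lemma cnj_harmonic_exp:
  fixes \<beta> :: "real \<Rightarrow> real"
  assumes \<beta>: "\<beta> absolutely_integrable_on {a..b}" and ab: "a \<le> b"
  shows "cnj (harmonic_exp a b \<beta> \<omega>) = harmonic_exp a b \<beta> (- \<omega>)"
proof (rule sums_unique2)
  show "(\<lambda>j. harmonic_exp_term a b \<beta> (- \<omega>) j) sums harmonic_exp a b \<beta> (- \<omega>)"
    by (rule harmonic_exp_sums[OF \<beta>]) (use ab in simp)
  have "(\<lambda>j. cnj (harmonic_exp_term a b \<beta> \<omega> j)) sums cnj (harmonic_exp a b \<beta> \<omega>)"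
    unfolding sums_cnj by (rule harmonic_exp_sums[OF \<beta>]) (use ab in simp)
  then show "(\<lambda>j. harmonic_exp_term a b \<beta> (- \<omega>) j) sums cnj (harmonic_exp a b \<beta> \<omega>)"
    by (simp only: cnj_harmonic_exp_term)
qed

text \<open>Riemann--Lebesgue: up to an \<open>L\<^sup>1\<close> error, \<open>\<beta>\<close> is a polynomial, for which one integrates by parts.\<close>

lemma riemann_lebesgue:
  fixes \<beta> :: "real \<Rightarrow> real"
  assumes \<beta>: "\<beta> absolutely_integrable_on {a..b}" and ab: "a \<le> b"
  shows "((\<lambda>\<omega>. integral {a..b} (\<lambda>s. exp (2 * \<i> * of_real (\<omega> * (s - a))) * of_real (\<beta> s))) \<longlongrightarrow> 0) at_top"
proof (rule tendstoI)
  fix e :: real assume "e > 0"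
  then have e4: "e/4 > 0" by simp
  obtain g where g: "continuous_on UNIV g" "(\<lambda>x. norm (\<beta> x - g x)) integrable_on {a..b}" "integral {a..b} (\<lambda>x. norm (\<beta> x - g x)) < e/4"
    using absolutely_integrable_approximate_continuous[OF \<beta> e4] by blast
  \<comment> \<open>Three errors of at most e/4 each: the mean error of the continuous
    \<open>g\<close>, the uniform error of the polynomial \<open>q\<close> integrated over [a, b],
    and the oscillatory integral of \<open>q\<close>.\<close>
  define \<eta> where "\<eta> = e / (4 * (b - a + 1))"
  have \<eta>: "\<eta> > 0" using \<open>e > 0\<close> ab by (simp add: \<eta>_def)
  have gc: "continuous_on {a..b} g" by (rule continuous_on_subset[OF g(1)]) simp
  obtain q where q: "real_polynomial_function q" "\<And>x. x \<in> {a..b} \<Longrightarrow> \<bar>g x - q x\<bar> < \<eta>"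
    using Stone_Weierstrass_real_polynomial_function[OF _ gc \<eta>] by auto
  obtain q' where q': "real_polynomial_function q'" "\<And>x. (q has_real_derivative q' x) (at x)"
    using has_real_derivative_polynomial_function[OF q(1)] by blast
  have qc: "continuous_on {a..b} q" "continuous_on {a..b} q'"
    using q(1) q'(1) by (simp_all only: real_polynomial_function_eq continuous_on_polymonial_function)
  define E where "E = (\<lambda>\<omega> s. exp (2 * \<i> * of_real (\<omega> * (s - a))))"
  have nE: "norm (E \<omega> s) = 1" for \<omega> s by (simp add: E_def norm_exp_eq_Re)
  have Ec: "continuous_on {a..b} (E \<omega>)" for \<omega> unfolding E_def by (intro continuous_intros)
  \<comment> \<open>The boundary terms and the remaining integral of one integration by parts; each
    of them carries the factor 1 / (2 \<omega>).\<close>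
  define K where "K = \<bar>q b\<bar> + \<bar>q a\<bar> + integral {a..b} (\<lambda>s. \<bar>q' s\<bar>)"
  have bound: "norm (integral {a..b} (\<lambda>s. E \<omega> s * of_real (q s))) \<le> K / (2 * \<omega>)" if \<omega>: "\<omega> > 0" for \<omega>
  proof -
    define c where "c = 1 / (2 * \<i> * of_real \<omega>)"
    have nc: "norm c = 1 / (2 * \<omega>)" using \<omega> by (simp add: c_def norm_divide norm_mult)
    have "((\<lambda>s. E \<omega> s * of_real (q s) * c) has_vector_derivative E \<omega> x * of_real (q x) + E \<omega> x * of_real (q' x) * c) (at x within {a..b})" for x
    proof -
      have "(E \<omega> has_vector_derivative 2 * \<i> * of_real \<omega> * E \<omega> x) (at x within {a..b})"
      proof -
        have "((\<lambda>z. exp (2 * \<i> * (of_real \<omega> * (z - of_real a)))) has_field_derivative 2 * \<i> * of_real \<omega> * E \<omega> x) (at (of_real x))"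
          unfolding E_def by (rule derivative_eq_intros refl | simp)+
        from has_vector_derivative_real_field[OF this] show ?thesis by (simp add: E_def[abs_def])
      qed
      moreover have "((\<lambda>s. of_real (q s) :: complex) has_vector_derivative of_real (q' x)) (at x within {a..b})"
        using q'(2)[of x] by (intro has_vector_derivative_of_real) (simp add: has_field_derivative_at_within)
      ultimately have "((\<lambda>s. E \<omega> s * of_real (q s) * c) has_vector_derivative
          (E \<omega> x * of_real (q' x) + 2 * \<i> * of_real \<omega> * E \<omega> x * of_real (q x)) * c) (at x within {a..b})"
        by (intro has_vector_derivative_mult_left has_vector_derivative_mult)
      moreover have "(E \<omega> x * of_real (q' x) + 2 * \<i> * of_real \<omega> * E \<omega> x * of_real (q x)) * c
          = E \<omega> x * of_real (q x) + E \<omega> x * of_real (q' x) * c"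
        using \<omega> by (simp add: c_def field_simps)
      ultimately show ?thesis by (simp only:)
    qed
    then have I: "((\<lambda>s. E \<omega> s * of_real (q s) + E \<omega> s * of_real (q' s) * c) has_integral (E \<omega> b * of_real (q b) * c - E \<omega> a * of_real (q a) * c)) {a..b}"
      by (intro fundamental_theorem_of_calculus[OF ab])
    have i1: "(\<lambda>s. E \<omega> s * of_real (q s)) integrable_on {a..b}"
      by (intro integrable_continuous_real continuous_intros Ec qc)
    have i2: "(\<lambda>s. E \<omega> s * of_real (q' s) * c) integrable_on {a..b}"
      by (intro integrable_continuous_real continuous_intros Ec qc)
    have "integral {a..b} (\<lambda>s. E \<omega> s * of_real (q s)) = E \<omega> b * of_real (q b) * c - E \<omega> a * of_real (q a) * c - integral {a..b} (\<lambda>s. E \<omega> s * of_real (q' s) * c)"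
      using integral_unique[OF I] Henstock_Kurzweil_Integration.integral_add[OF i1 i2] by (simp add: algebra_simps)
    also have "norm \<dots> \<le> norm (E \<omega> b * of_real (q b) * c) + norm (E \<omega> a * of_real (q a) * c) + norm (integral {a..b} (\<lambda>s. E \<omega> s * of_real (q' s) * c))"
      by (rule order.trans[OF norm_triangle_ineq4 add_right_mono[OF norm_triangle_ineq4]])
    also have "norm (integral {a..b} (\<lambda>s. E \<omega> s * of_real (q' s) * c)) \<le> integral {a..b} (\<lambda>s. \<bar>q' s\<bar> * (1 / (2 * \<omega>)))"
      by (intro Henstock_Kurzweil_Integration.integral_norm_bound_integral i2 integrable_continuous_real continuous_intros qc)
        (simp add: norm_mult nE nc)
    finally show ?thesis by (simp add: norm_mult nE nc K_def add_divide_distrib)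
  qed
  have "\<forall>\<^sub>F \<omega> in at_top. \<omega> > max 0 (2 * K / e)" by (rule eventually_gt_at_top)
  then show "\<forall>\<^sub>F \<omega> in at_top. dist (integral {a..b} (\<lambda>s. exp (2 * \<i> * of_real (\<omega> * (s - a))) * of_real (\<beta> s))) 0 < e"
  proof eventually_elim
    case (elim \<omega>)
    then have \<omega>: "\<omega> > 0" "2 * K / e < \<omega>" by auto
    have i0: "(\<lambda>s. E \<omega> s * of_real (\<beta> s)) integrable_on {a..b}"
      using harmonic_kernel_absolutely_integrable[OF \<beta>, of "\<lambda>_. 1" \<omega>] by (simp add: absolutely_integrable_on_def E_def)
    have i1: "(\<lambda>s. E \<omega> s * of_real (q s)) integrable_on {a..b}"
      by (intro integrable_continuous_real continuous_intros Ec qc)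
    define D where "D = integral {a..b} (\<lambda>s. E \<omega> s * of_real (\<beta> s) - E \<omega> s * of_real (q s))"
    define Q where "Q = integral {a..b} (\<lambda>s. E \<omega> s * of_real (q s))"
    have "integral {a..b} (\<lambda>s. E \<omega> s * of_real (\<beta> s)) = D + Q"
      unfolding D_def Q_def Henstock_Kurzweil_Integration.integral_diff[OF i0 i1] by (rule diff_add_cancel[symmetric])
    then have split: "norm (integral {a..b} (\<lambda>s. E \<omega> s * of_real (\<beta> s))) \<le> norm D + norm Q"
      by (simp only: norm_triangle_ineq)
    have "norm D \<le> integral {a..b} (\<lambda>s. norm (\<beta> s - g s) + \<eta>)"
      unfolding D_def
    proof (rule Henstock_Kurzweil_Integration.integral_norm_bound_integral[OF integrable_diff[OF i0 i1]])
      show "(\<lambda>s. norm (\<beta> s - g s) + \<eta>) integrable_on {a..b}" using g(2) by (intro integrable_add) auto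
      fix s assume s: "s \<in> {a..b}"
      have "E \<omega> s * of_real (\<beta> s) - E \<omega> s * of_real (q s) = E \<omega> s * of_real (\<beta> s - q s)"
        by (simp only: of_real_diff right_diff_distrib)
      then have "norm (E \<omega> s * of_real (\<beta> s) - E \<omega> s * of_real (q s)) = \<bar>\<beta> s - q s\<bar>" by (simp only: norm_mult nE norm_of_real mult_1_left)
      also have "\<dots> \<le> norm (\<beta> s - g s) + \<eta>" using q(2)[OF s] unfolding real_norm_def by linarith
      finally show "norm (E \<omega> s * of_real (\<beta> s) - E \<omega> s * of_real (q s)) \<le> norm (\<beta> s - g s) + \<eta>" .
    qed
    also have "\<dots> = integral {a..b} (\<lambda>s. norm (\<beta> s - g s)) + \<eta> * (b - a)"
      using g(2) ab by (subst Henstock_Kurzweil_Integration.integral_add) auto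
    finally have D: "norm D < e/4 + \<eta> * (b - a)" using g(3) by linarith
    have "norm Q \<le> K / (2 * \<omega>)" unfolding Q_def by (rule bound[OF \<omega>(1)])
    moreover have "K / (2 * \<omega>) < e/4"
    proof -
      have "2 * K < \<omega> * e" using \<omega> \<open>e > 0\<close> by (simp only: pos_divide_less_eq)
      moreover have "e/4 * (2 * \<omega>) = \<omega> * e / 2" by simp
      ultimately have "K < e/4 * (2 * \<omega>)" by linarith
      then show ?thesis using \<omega> by (simp only: pos_divide_less_eq)
    qed
    moreover have "\<eta> * (b - a) \<le> e/4"
    proof -
      have "\<eta> * (b - a) \<le> \<eta> * (b - a + 1)" using \<eta> by (intro mult_left_mono) auto
      also have "\<dots> = e/4"
      proof -
        have *: "e / (4 * d) * d = e / 4" if "d \<noteq> 0" for d :: real using that by simp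
        show ?thesis unfolding \<eta>_def by (rule *) (use ab in simp)
      qed
      finally show ?thesis .
    qed
    ultimately have "norm (integral {a..b} (\<lambda>s. E \<omega> s * of_real (\<beta> s))) < e" using split D \<open>e > 0\<close> by linarith
    then show ?case unfolding E_def dist_0_norm dist_commute[of _ "0 :: complex"] .
  qed
qed

text \<open>Only the first term needs the Riemann--Lebesgue lemma. The integrand of each later term
  contains the preceding term, so it tends to 0 pointwise, under a majorant independent of
  \<omega>.\<close>

lemma harmonic_exp_term_tendsto_0:
  fixes \<beta> :: "real \<Rightarrow> real"
  assumes \<beta>: "\<beta> absolutely_integrable_on {a..b}" and t: "t \<in> {a..b}"
  shows "((\<lambda>\<omega>. harmonic_exp_term a t \<beta> \<omega> (Suc j)) \<longlongrightarrow> 0) at_top"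
  using t
proof (induction j arbitrary: t)
  case 0
  have "((\<lambda>\<omega>. integral {a..t} (\<lambda>s. exp (2 * \<i> * of_real (\<omega> * (s - a))) * of_real (\<beta> s))) \<longlongrightarrow> 0) at_top"
    by (rule riemann_lebesgue[OF absolutely_integrable_on_subset_Icc[OF \<beta>]]) (use 0 in auto)
  moreover have "harmonic_exp_term a t \<beta> \<omega> (Suc 0) = integral {a..t} (\<lambda>s. exp (2 * \<i> * of_real (\<omega> * (s - a))) * of_real (\<beta> s))" for \<omega>
    unfolding harmonic_exp_term_Suc(2)[OF \<beta> 0 continuous_on_harmonic_exp_term[OF \<beta>]]
    by (simp only: harmonic_exp_term_0 complex_cnj_one mult_1_right)
  ultimately show ?case by (simp only:)
next
  case (Suc j)
  define B where "B = integral {a..b} (\<lambda>s. \<bar>\<beta> s\<bar>) ^ Suc j / fact (Suc j)"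
  define f where "f = (\<lambda>\<omega> s. exp (2 * \<i> * of_real (\<omega> * (s - a))) * of_real (\<beta> s) * cnj (harmonic_exp_term a s \<beta> \<omega> (Suc j)))"
  have \<beta>t: "\<beta> absolutely_integrable_on {a..t}"
    by (rule absolutely_integrable_on_subset_Icc[OF \<beta>]) (use Suc.prems in auto)
  have S: "{a..t} \<in> sets lebesgue" by simp
  have fi: "f \<omega> absolutely_integrable_on {a..t}" for \<omega>
    unfolding f_def
    by (intro harmonic_kernel_absolutely_integrable[OF \<beta>t] continuous_on_cnj
      continuous_on_subset[OF continuous_on_harmonic_exp_term[OF \<beta>]]) (use Suc.prems in auto)
  have fl: "integrable (lebesgue_on {a..t}) (f \<omega>)" for \<omega>
    by (rule absolutely_integrable_imp_integrable[OF fi S])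
  have "((\<lambda>\<omega>. integral\<^sup>L (lebesgue_on {a..t}) (f \<omega>)) \<longlongrightarrow> integral\<^sup>L (lebesgue_on {a..t}) (\<lambda>_. 0)) at_top"
  proof (rule integral_dominated_convergence_at_top[where w = "\<lambda>s. \<bar>\<beta> s\<bar> * B"])
    show "integrable (lebesgue_on {a..t}) (\<lambda>s. \<bar>\<beta> s\<bar> * B)"
      using absolutely_integrable_imp_integrable[OF \<beta>t S] by (intro integrable_mult_left integrable_abs)
    show "AE s in lebesgue_on {a..t}. ((\<lambda>\<omega>. f \<omega> s) \<longlongrightarrow> 0) at_top"
    proof (rule AE_I2)
      fix s assume "s \<in> space (lebesgue_on {a..t})"
      then have s: "s \<in> {a..b}" using Suc.prems by auto
      have "((\<lambda>\<omega>. \<bar>\<beta> s\<bar> * norm (harmonic_exp_term a s \<beta> \<omega> (Suc j))) \<longlongrightarrow> \<bar>\<beta> s\<bar> * norm (0::complex)) at_top"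
        by (intro tendsto_mult tendsto_const tendsto_norm Suc.IH[OF s])
      moreover have "\<bar>\<beta> s\<bar> * norm (harmonic_exp_term a s \<beta> \<omega> (Suc j)) = norm (f \<omega> s)" for \<omega>
        by (simp add: f_def norm_mult norm_exp_eq_Re)
      ultimately have "((\<lambda>\<omega>. norm (f \<omega> s)) \<longlongrightarrow> 0) at_top" by (simp only: norm_zero mult_zero_right)
      then show "((\<lambda>\<omega>. f \<omega> s) \<longlongrightarrow> 0) at_top" by (rule tendsto_norm_zero_cancel)
    qed
    show "\<forall>\<^sub>F \<omega> in at_top. AE s in lebesgue_on {a..t}. norm (f \<omega> s) \<le> \<bar>\<beta> s\<bar> * B"
    proof (rule always_eventually, rule allI, rule AE_I2)
      fix \<omega> s assume "s \<in> space (lebesgue_on {a..t})"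
      then have s: "s \<in> {a..b}" using Suc.prems by auto
      have "norm (f \<omega> s) = \<bar>\<beta> s\<bar> * norm (harmonic_exp_term a s \<beta> \<omega> (Suc j))"
        by (simp add: f_def norm_mult norm_exp_eq_Re)
      also have "\<dots> \<le> \<bar>\<beta> s\<bar> * B"
        unfolding B_def by (rule mult_left_mono[OF norm_harmonic_exp_term_le[OF \<beta> s] abs_ge_zero])
      finally show "norm (f \<omega> s) \<le> \<bar>\<beta> s\<bar> * B" .
    qed
  qed (rule borel_measurable_const, rule borel_measurable_integrable[OF fl])
  moreover have "harmonic_exp_term a t \<beta> \<omega> (Suc (Suc j)) = integral\<^sup>L (lebesgue_on {a..t}) (f \<omega>)" for \<omega>
    unfolding lebesgue_integral_eq_integral[OF fl S] unfolding f_def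
    by (rule harmonic_exp_term_Suc(2)[OF \<beta> Suc.prems continuous_on_harmonic_exp_term[OF \<beta>]])
  ultimately show ?case by (simp only: Bochner_Integration.integral_zero)
qed

text \<open>Tannery's theorem passes from the terms to the sum at plus infinity; conjugation takes
  care of minus infinity.\<close>

lemma harmonic_exp_tendsto_1:
  fixes \<beta> :: "real \<Rightarrow> real"
  assumes \<beta>: "\<beta> absolutely_integrable_on {a..b}" and ab: "a \<le> b"
  shows "((\<lambda>\<omega>. harmonic_exp a b \<beta> \<omega>) \<longlongrightarrow> 1) at_infinity"
proof -
  have b: "b \<in> {a..b}" using ab by simp
  have "((\<lambda>\<omega>. \<Sum>j. harmonic_exp_term a b \<beta> \<omega> j) \<longlongrightarrow> (\<Sum>j. if j = 0 then 1 else 0)) at_top"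
  proof (rule tannerys_theorem[THEN conjunct2, THEN conjunct2])
    show "((\<lambda>\<omega>. harmonic_exp_term a b \<beta> \<omega> j) \<longlongrightarrow> (if j = 0 then 1 else 0)) at_top" for j
      using harmonic_exp_term_tendsto_0[OF \<beta> b] by (cases j) auto
    show "\<forall>\<^sub>F (j, \<omega>) in at_top \<times>\<^sub>F at_top. norm (harmonic_exp_term a b \<beta> \<omega> j) \<le> integral {a..b} (\<lambda>s. \<bar>\<beta> s\<bar>) ^ j / fact j"
      using norm_harmonic_exp_term_le[OF \<beta> b] by (intro always_eventually) auto
  qed (auto intro: summable_power_div_fact)
  moreover have "(\<Sum>j. if j = 0 then 1 else 0) = (1 :: complex)"
    using sums_unique[OF sums_single[of 0 "\<lambda>_. 1 :: complex"]] by simp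
  ultimately have top: "((\<lambda>\<omega>. harmonic_exp a b \<beta> \<omega>) \<longlongrightarrow> 1) at_top"
    using sums_unique[OF harmonic_exp_sums[OF \<beta> b]] by simp
  have "((\<lambda>\<omega>. cnj (harmonic_exp a b \<beta> (- \<omega>))) \<longlongrightarrow> cnj 1) at_bot"
    using tendsto_cnj[OF filterlim_compose[OF top filterlim_uminus_at_top_at_bot]] .
  then have "((\<lambda>\<omega>. harmonic_exp a b \<beta> \<omega>) \<longlongrightarrow> 1) at_bot"
    by (simp add: cnj_harmonic_exp[OF \<beta> ab])
  with top show ?thesis unfolding at_infinity_eq_at_top_bot by (rule filterlim_sup)
qed

section \<open>The wave equation between jumps\<close>

text \<open>A first order system for \<open>u\<close> and the flux p = z u', in which the
  coefficient is never differentiated.\<close>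

definition wave_ac :: "(real \<Rightarrow> real) \<Rightarrow> real \<Rightarrow> real \<Rightarrow> real \<Rightarrow> (real \<Rightarrow> complex) \<Rightarrow> (real \<Rightarrow> complex) \<Rightarrow> bool" where
  "wave_ac z a b \<omega> u p \<longleftrightarrow> ac_primitive a b u (\<lambda>x. p x / of_real (z x)) \<and>
     ac_primitive a b p (\<lambda>x. - (of_real (\<omega>\<^sup>2 * z x) * u x))"

text \<open>The going parts as functions of the values of \<open>u\<close> and of the flux, because
  these two, unlike the derivative of \<open>u\<close>, are continuous across jumps.\<close>

definition lpart :: "real \<Rightarrow> real \<Rightarrow> complex \<Rightarrow> complex \<Rightarrow> complex" where
  "lpart \<omega> z u p = (u - p / (\<i> * of_real (\<omega> * z))) / 2"

definition rpart :: "real \<Rightarrow> real \<Rightarrow> complex \<Rightarrow> complex \<Rightarrow> complex" where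
  "rpart \<omega> z u p = (u + p / (\<i> * of_real (\<omega> * z))) / 2"

text \<open>One piece of constant regularity. The functions \<open>P\<close>, \<open>Q\<close> are half the sum and half the
  difference of the harmonic exponentials of \<open>\<alpha>\<close> and \<open>-\<alpha>\<close>; \<open>(P, - cnj Q)\<close> and \<open>(Q, - cnj P)\<close> form a
  fundamental system for the left and right going waves in the rotating frame.\<close>

locale wave_piece =
  fixes l r \<epsilon> \<omega> :: real and z z' :: "real \<Rightarrow> real"
  assumes lr: "l < r" and \<epsilon>: "0 < \<epsilon>" and z_ge: "\<And>x. x \<in> {l..r} \<Longrightarrow> \<epsilon> \<le> z x"
    and z: "ac_primitive l r z z'"
begin

definition \<alpha> :: "real \<Rightarrow> real" where "\<alpha> t = - z' t / (2 * z t)"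
definition \<sigma> :: "real \<Rightarrow> real" where "\<sigma> t = sqrt (z t)"
definition \<tau> :: "real \<Rightarrow> real" where "\<tau> t = 1 / sqrt (z t)"
definition P :: "real \<Rightarrow> complex" where "P t = (harmonic_exp l t \<alpha> \<omega> + harmonic_exp l t (\<lambda>s. - \<alpha> s) \<omega>) / 2"
definition Q :: "real \<Rightarrow> complex" where "Q t = (harmonic_exp l t \<alpha> \<omega> - harmonic_exp l t (\<lambda>s. - \<alpha> s) \<omega>) / 2"
definition e :: "real \<Rightarrow> complex" where "e t = exp (\<i> * of_real (\<omega> * (t - l)))"
definition f :: "real \<Rightarrow> complex" where "f t = exp (\<i> * of_real (- \<omega> * (t - l)))"

section \<open>Square root of the coefficient and its logarithmic derivative\<close>

lemma z_pos: "x \<in> {l..r} \<Longrightarrow> 0 < z x"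
  using z_ge[of x] \<epsilon> by simp

lemma ef: "e t * f t = 1" "cnj (e t) = f t" "cnj (f t) = e t" "e l = 1" "f l = 1"
  by (simp_all add: e_def f_def exp_cnj flip: exp_add)

lemma e2: "exp (2 * \<i> * of_real (\<omega> * (t - l))) = e t * e t"
  by (simp add: e_def mult.assoc flip: exp_add)

lemma ac_e: "ac_primitive l r e (\<lambda>t. \<i> * of_real \<omega> * e t)"
  unfolding e_def by (rule ac_primitive_exp)

lemma ac_f: "ac_primitive l r f (\<lambda>t. - (\<i> * of_real \<omega> * f t))"
  using ac_primitive_exp[of l r "- \<omega>" l] unfolding f_def by simp

lemma \<sigma>\<tau>: assumes "x \<in> {l..r}" shows "\<sigma> x * \<sigma> x = z x" "\<sigma> x * \<tau> x = 1" "0 < \<sigma> x" "0 < \<tau> x" "\<tau> x * z x = \<sigma> x" "\<sigma> x / z x = \<tau> x"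
proof -
  have "0 < z x" using z_pos[OF assms] .
  then show "\<sigma> x * \<sigma> x = z x" "\<sigma> x * \<tau> x = 1" "0 < \<sigma> x" "0 < \<tau> x" by (simp_all add: \<sigma>_def \<tau>_def)
  then show "\<tau> x * z x = \<sigma> x" by (metis mult.assoc mult.commute mult_1)
  then show "\<sigma> x / z x = \<tau> x" using \<open>0 < z x\<close> by (simp add: field_simps)
qed

text \<open>The lower bound \<epsilon> keeps the values away from the point where the slope of the
  square root blows up.\<close>

lemma sqrt_lipschitz:
  assumes "x \<in> {l..r}" "y \<in> {l..r}"
  shows "\<bar>sqrt (z y) - sqrt (z x)\<bar> \<le> 1 / sqrt \<epsilon> * \<bar>z y - z x\<bar>"
proof -
  have s: "sqrt \<epsilon> \<le> sqrt (z x)" "sqrt \<epsilon> \<le> sqrt (z y)" "0 < sqrt \<epsilon>" using z_ge assms \<epsilon> by auto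
  have "z y - z x = (sqrt (z y) - sqrt (z x)) * (sqrt (z y) + sqrt (z x))"
    using z_pos[OF assms(1)] z_pos[OF assms(2)] by (simp add: algebra_simps)
  then have "\<bar>z y - z x\<bar> = \<bar>sqrt (z y) - sqrt (z x)\<bar> * (sqrt (z y) + sqrt (z x))"
    using s by (simp add: abs_mult)
  moreover have "\<bar>sqrt (z y) - sqrt (z x)\<bar> * sqrt \<epsilon> \<le> \<bar>sqrt (z y) - sqrt (z x)\<bar> * (sqrt (z y) + sqrt (z x))"
    by (rule mult_left_mono) (use s in linarith, simp)
  ultimately show ?thesis using s(3) by (simp add: field_simps)
qed

text \<open>\<alpha> is minus the logarithmic derivative of \<sigma>.\<close>

lemma ac_\<sigma>: "ac_primitive l r \<sigma> (\<lambda>t. - \<alpha> t * \<sigma> t)"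
proof -
  have "ac_primitive l r (\<lambda>x. sqrt (z x)) (\<lambda>x. (inverse (sqrt (z x)) / 2) * z' x)"
    by (rule ac_primitive_compose[OF z sqrt_lipschitz]) (auto intro!: DERIV_real_sqrt z_pos)
  then show ?thesis
  proof (rule ac_primitive_cong)
    have "- \<alpha> x * \<sigma> x = inverse (sqrt (z x)) / 2 * z' x" if "x \<in> {l..r}" for x
    proof -
      have "- \<alpha> x * \<sigma> x = z' x / 2 * (\<sigma> x / z x)" by (simp add: \<alpha>_def)
      also have "\<dots> = inverse (sqrt (z x)) / 2 * z' x" unfolding \<sigma>\<tau>(6)[OF that] by (simp add: \<tau>_def inverse_eq_divide)
      finally show ?thesis .
    qed
    then show "AE x in lborel. l < x \<and> x < r \<longrightarrow> - \<alpha> x * \<sigma> x = inverse (sqrt (z x)) / 2 * z' x"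
      by (intro AE_I2) auto
  qed (simp add: \<sigma>_def)
qed

lemma inverse_lipschitz:
  assumes "x \<in> {l..r}" "y \<in> {l..r}"
  shows "\<bar>inverse (\<sigma> y) - inverse (\<sigma> x)\<bar> \<le> 1 / \<epsilon> * \<bar>\<sigma> y - \<sigma> x\<bar>"
proof -
  have s: "0 < \<sigma> x" "0 < \<sigma> y" using \<sigma>\<tau>(3) assms by auto
  have "sqrt \<epsilon> * sqrt \<epsilon> \<le> \<sigma> x * \<sigma> y"
    unfolding \<sigma>_def using z_ge[OF assms(1)] z_ge[OF assms(2)] z_pos[OF assms(1)] \<epsilon> by (intro mult_mono) auto
  then have "\<epsilon> \<le> \<sigma> x * \<sigma> y" using \<epsilon> by simp
  have "inverse (\<sigma> y) - inverse (\<sigma> x) = (\<sigma> x - \<sigma> y) / (\<sigma> x * \<sigma> y)" using s by (simp add: field_simps)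
  then have "\<bar>inverse (\<sigma> y) - inverse (\<sigma> x)\<bar> = \<bar>\<sigma> y - \<sigma> x\<bar> / (\<sigma> x * \<sigma> y)" using s by (simp add: abs_minus_commute)
  also have "\<dots> \<le> \<bar>\<sigma> y - \<sigma> x\<bar> / \<epsilon>" using \<open>\<epsilon> \<le> \<sigma> x * \<sigma> y\<close> \<epsilon> by (intro divide_left_mono) auto
  finally show ?thesis by simp
qed

lemma ac_\<tau>: "ac_primitive l r \<tau> (\<lambda>t. \<alpha> t * \<tau> t)"
proof -
  have "ac_primitive l r (\<lambda>x. inverse (\<sigma> x)) (\<lambda>x. - (inverse (\<sigma> x) ^ Suc (Suc 0)) * (- \<alpha> x * \<sigma> x))"
  proof (rule ac_primitive_compose[OF ac_\<sigma> inverse_lipschitz])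
    show "(inverse has_real_derivative - (inverse (\<sigma> x) ^ Suc (Suc 0))) (at (\<sigma> x))" if "x \<in> {l..r}" for x
      using \<sigma>\<tau>(3)[OF that] by (intro DERIV_inverse) simp
  qed
  then show ?thesis
  proof (rule ac_primitive_cong)
    have "\<alpha> x * \<tau> x = - (inverse (\<sigma> x) ^ Suc (Suc 0)) * (- \<alpha> x * \<sigma> x)" if "x \<in> {l..r}" for x
      using \<sigma>\<tau>(3)[OF that] by (simp add: \<tau>_def \<sigma>_def[symmetric] field_simps)
    then show "AE x in lborel. l < x \<and> x < r \<longrightarrow> \<alpha> x * \<tau> x = - (inverse (\<sigma> x) ^ Suc (Suc 0)) * (- \<alpha> x * \<sigma> x)"
      by (intro AE_I2) auto
  qed (simp add: \<tau>_def \<sigma>_def inverse_eq_divide)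
qed

text \<open>The derivative of \<sigma> is integrable because \<sigma> is absolutely continuous;
  dividing it by the continuous positive \<sigma> recovers -\<alpha>.\<close>

lemma \<alpha>_integrable: "\<alpha> absolutely_integrable_on {l..r}" "(\<lambda>s. - \<alpha> s) absolutely_integrable_on {l..r}"
proof -
  have "(\<lambda>t. inverse (\<sigma> t) * (- \<alpha> t * \<sigma> t)) absolutely_integrable_on {l..r}"
  proof (rule absolutely_integrable_bounded_measurable_product[OF bilinear_times])
    have c: "continuous_on {l..r} (\<lambda>t. inverse (\<sigma> t))"
      by (intro continuous_on_inverse ac_primitive_continuous_on[OF ac_\<sigma>]) (use \<sigma>\<tau>(3) in force)
    show "(\<lambda>t. inverse (\<sigma> t)) \<in> borel_measurable (lebesgue_on {l..r})"
      by (rule continuous_imp_measurable_on_sets_lebesgue[OF c]) simp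
    show "bounded ((\<lambda>t. inverse (\<sigma> t)) ` {l..r})"
      by (intro compact_imp_bounded compact_continuous_image c) simp
    show "(\<lambda>t. - \<alpha> t * \<sigma> t) absolutely_integrable_on {l..r}"
      using lr by (intro ac_primitive_absolutely_integrable[OF _ ac_\<sigma>]) simp
  qed simp
  then show *: "(\<lambda>s. - \<alpha> s) absolutely_integrable_on {l..r}"
  proof (rule absolutely_integrable_spike[of _ _ "{}"])
    show "- \<alpha> x = inverse (\<sigma> x) * (- \<alpha> x * \<sigma> x)" if "x \<in> {l..r} - {}" for x
      using \<sigma>\<tau>(3)[of x] that by simp
  qed simp
  then show "\<alpha> absolutely_integrable_on {l..r}"
    using absolutely_integrable_linear[OF * bounded_linear_minus[OF bounded_linear_ident]] by (simp add: o_def)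
qed

text \<open>Adding and subtracting the equations for \<alpha> and -\<alpha> couples each half
  combination to the conjugate of the other.\<close>

lemma ac_P: "ac_primitive l r P (\<lambda>t. of_real (\<alpha> t) * (e t * e t) * cnj (Q t))"
  and ac_Q: "ac_primitive l r Q (\<lambda>t. of_real (\<alpha> t) * (e t * e t) * cnj (P t))"
  and PQ_l: "P l = 1" "Q l = 0"
proof -
  note h1 = harmonic_exp_ac_primitive[OF \<alpha>_integrable(1) less_imp_le[OF lr], of \<omega>, unfolded e2]
  note h2 = harmonic_exp_ac_primitive[OF \<alpha>_integrable(2) less_imp_le[OF lr], of \<omega>, unfolded e2]
  have "ac_primitive l r (\<lambda>t. 1/2 * (harmonic_exp l t \<alpha> \<omega> + harmonic_exp l t (\<lambda>s. - \<alpha> s) \<omega>)) (\<lambda>t. of_real (\<alpha> t) * (e t * e t) * cnj (Q t))"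
    by (rule ac_primitive_cong[OF ac_primitive_cmult[OF ac_primitive_add[OF h1(1) h2(1)], of "1/2"]])
      (auto simp: Q_def algebra_simps diff_divide_distrib add_divide_distrib)
  then show "ac_primitive l r P (\<lambda>t. of_real (\<alpha> t) * (e t * e t) * cnj (Q t))"
    by (rule ac_primitive_cong) (auto simp: P_def)
  have "ac_primitive l r (\<lambda>t. 1/2 * (harmonic_exp l t \<alpha> \<omega> - harmonic_exp l t (\<lambda>s. - \<alpha> s) \<omega>)) (\<lambda>t. of_real (\<alpha> t) * (e t * e t) * cnj (P t))"
    by (rule ac_primitive_cong[OF ac_primitive_cmult[OF ac_primitive_diff[OF h1(1) h2(1)], of "1/2"]])
      (auto simp: P_def algebra_simps diff_divide_distrib add_divide_distrib)
  then show "ac_primitive l r Q (\<lambda>t. of_real (\<alpha> t) * (e t * e t) * cnj (P t))"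
    by (rule ac_primitive_cong) (auto simp: Q_def)
  show "P l = 1" "Q l = 0" by (simp_all add: P_def Q_def h1(2) h2(2))
qed

lemma ac_primitive_0_constant:
  fixes F :: "real \<Rightarrow> complex"
  assumes "ac_primitive l r F F'" "\<And>x. x \<in> {l<..<r} \<Longrightarrow> F' x = 0" "t \<in> {l..r}"
  shows "F t = F l"
proof -
  have "AE x in lborel. l < x \<and> x < r \<longrightarrow> F' x = 0" using assms(2) by (intro AE_I2) simp
  then show ?thesis
    using ac_primitive_unique[OF assms(1) ac_primitive_const[of l r "F l"], of l t] assms(3) lr by simp
qed

text \<open>P cnj P and Q cnj Q have the same derivative, so their difference keeps its value at
  \<open>l\<close>.\<close>

lemma PQ_det: assumes "t \<in> {l..r}" shows "P t * cnj (P t) - Q t * cnj (Q t) = 1"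
proof -
  have "P t * cnj (P t) - Q t * cnj (Q t) = P l * cnj (P l) - Q l * cnj (Q l)"
    by (rule ac_primitive_0_constant[OF ac_primitive_diff[OF ac_primitive_mult[OF ac_P ac_primitive_cnj[OF ac_P]]
      ac_primitive_mult[OF ac_Q ac_primitive_cnj[OF ac_Q]]]]) (use assms in \<open>simp_all add: ef algebra_simps\<close>)
  then show ?thesis by (simp add: PQ_l)
qed

text \<open>Pairing a solution with the fundamental system yields two constants of motion, which at
  \<open>l\<close> are the components themselves. The last two equations invert the first two, the
  determinant being 1.\<close>

lemma frame_invariants:
  assumes A: "ac_primitive l r A (\<lambda>t. - of_real (\<alpha> t) * (e t * e t) * B t)"
    and B: "ac_primitive l r B (\<lambda>t. - of_real (\<alpha> t) * (f t * f t) * A t)"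
    and t: "t \<in> {l..r}"
  shows "A l = cnj (P t) * A t + Q t * B t" "B l = cnj (Q t) * A t + P t * B t"
    "A t = P t * A l - Q t * B l" "B t = cnj (P t) * B l - cnj (Q t) * A l"
proof -
  have "cnj (P t) * A t + Q t * B t = cnj (P l) * A l + Q l * B l"
    by (rule ac_primitive_0_constant[OF ac_primitive_add[OF ac_primitive_mult[OF ac_primitive_cnj[OF ac_P] A]
      ac_primitive_mult[OF ac_Q B]] _ t]) (simp add: ef algebra_simps; simp add: ef(1) mult.assoc[symmetric])
  then show 1: "A l = cnj (P t) * A t + Q t * B t" by (simp add: PQ_l)
  have "cnj (Q t) * A t + P t * B t = cnj (Q l) * A l + P l * B l"
    by (rule ac_primitive_0_constant[OF ac_primitive_add[OF ac_primitive_mult[OF ac_primitive_cnj[OF ac_Q] A]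
      ac_primitive_mult[OF ac_P B]] _ t]) (simp add: ef algebra_simps)
  then show 2: "B l = cnj (Q t) * A t + P t * B t" by (simp add: PQ_l)
  have "P t * A l - Q t * B l = (P t * cnj (P t) - Q t * cnj (Q t)) * A t"
    unfolding 1 2 by (simp add: algebra_simps)
  then show "A t = P t * A l - Q t * B l" by (simp add: PQ_det[OF t])
  have "cnj (P t) * B l - cnj (Q t) * A l = (P t * cnj (P t) - Q t * cnj (Q t)) * B t"
    unfolding 1 2 by (simp add: algebra_simps)
  then show "B t = cnj (P t) * B l - cnj (Q t) * A l" by (simp add: PQ_det[OF t])
qed

end

section \<open>Solutions of the wave equation on one piece\<close>

locale wave_piece_nonzero = wave_piece +
  assumes \<omega>: "\<omega> \<noteq> 0"
begin

definition A :: "(real \<Rightarrow> complex) \<Rightarrow> (real \<Rightarrow> complex) \<Rightarrow> real \<Rightarrow> complex" where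
  "A u p t = e t * (1/2 * (of_real (\<sigma> t) * u t - 1 / (\<i> * of_real \<omega>) * (of_real (\<tau> t) * p t)))"

definition B :: "(real \<Rightarrow> complex) \<Rightarrow> (real \<Rightarrow> complex) \<Rightarrow> real \<Rightarrow> complex" where
  "B u p t = f t * (1/2 * (of_real (\<sigma> t) * u t + 1 / (\<i> * of_real \<omega>) * (of_real (\<tau> t) * p t)))"

lemma \<omega>c: "\<i> * of_real \<omega> * (1 / (\<i> * of_real \<omega>)) = 1" "of_real (\<omega>\<^sup>2) * (1 / (\<i> * of_real \<omega>)) = - (\<i> * of_real \<omega>)"
  using \<omega> by (simp_all add: field_simps power2_eq_square)

text \<open>For v = \<sigma> u and w = \<tau> p the coefficient survives only through \<alpha>. The
  rest is an oscillator of constant frequency \<omega>, which the rotating frame removes.\<close>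

lemma ac_vw:
  assumes "wave_ac z l r \<omega> u p"
  shows "ac_primitive l r (\<lambda>t. of_real (\<sigma> t) * u t) (\<lambda>t. of_real (\<tau> t) * p t - of_real (\<alpha> t) * (of_real (\<sigma> t) * u t))"
    and "ac_primitive l r (\<lambda>t. of_real (\<tau> t) * p t) (\<lambda>t. of_real (\<alpha> t) * (of_real (\<tau> t) * p t) - of_real (\<omega>\<^sup>2) * (of_real (\<sigma> t) * u t))"
proof -
  have u: "ac_primitive l r u (\<lambda>x. p x / of_real (z x))" and p: "ac_primitive l r p (\<lambda>x. - (of_real (\<omega>\<^sup>2 * z x) * u x))"
    using assms by (simp_all add: wave_ac_def)
  have "of_real (\<tau> t) * p t - of_real (\<alpha> t) * (of_real (\<sigma> t) * u t) = of_real (\<sigma> t) * (p t / of_real (z t)) + of_real (- \<alpha> t * \<sigma> t) * u t"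
    if "t \<in> {l..r}" for t
    by (simp add: \<sigma>\<tau>(6)[OF that, symmetric])
  then show "ac_primitive l r (\<lambda>t. of_real (\<sigma> t) * u t) (\<lambda>t. of_real (\<tau> t) * p t - of_real (\<alpha> t) * (of_real (\<sigma> t) * u t))"
    by (intro ac_primitive_cong[OF ac_primitive_mult[OF ac_primitive_of_real[OF ac_\<sigma>] u]] AE_I2) auto
  have "of_real (\<alpha> t) * (of_real (\<tau> t) * p t) - of_real (\<omega>\<^sup>2) * (of_real (\<sigma> t) * u t) =
      of_real (\<tau> t) * (- (of_real (\<omega>\<^sup>2 * z t) * u t)) + of_real (\<alpha> t * \<tau> t) * p t" if "t \<in> {l..r}" for t
    by (simp add: \<sigma>\<tau>(5)[OF that, symmetric])
  then show "ac_primitive l r (\<lambda>t. of_real (\<tau> t) * p t) (\<lambda>t. of_real (\<alpha> t) * (of_real (\<tau> t) * p t) - of_real (\<omega>\<^sup>2) * (of_real (\<sigma> t) * u t))"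
    by (intro ac_primitive_cong[OF ac_primitive_mult[OF ac_primitive_of_real[OF ac_\<tau>] p]] AE_I2) auto
qed

lemma ac_AB:
  assumes "wave_ac z l r \<omega> u p"
  shows "ac_primitive l r (A u p) (\<lambda>t. - of_real (\<alpha> t) * (e t * e t) * B u p t)"
    and "ac_primitive l r (B u p) (\<lambda>t. - of_real (\<alpha> t) * (f t * f t) * A u p t)"
proof -
  define c where "c = 1 / (\<i> * of_real \<omega>)"
  note c = \<omega>c[folded c_def]
  \<comment> \<open>Algebra in abstract symbols: I stands for i \<omega>, c for its inverse, W for
    \<omega>^2, and E, F for the two phases. By the three relations all terms without the factor
    \<open>a\<close> cancel.\<close>
  have alg1: "E * (h * ((w - a * v) - c * (a * w - W * v))) + I * E * (h * (v - c * w)) = - a * (E * E) * (F * (h * (v + c * w)))"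
    if "I * c = 1" "W * c = - I" "E * F = 1" for E F I W a v w h :: complex
  proof -
    have "E * (h * ((w - a * v) - c * (a * w - W * v))) + I * E * (h * (v - c * w)) =
        E * (h * (w - a * v - c * a * w + (W * c) * v + I * v - (I * c) * w))" by (simp add: algebra_simps)
    also have "\<dots> = - a * E * (h * (v + c * w))" unfolding that by (simp add: algebra_simps)
    also have "\<dots> = - a * (E * (E * F)) * (h * (v + c * w))" unfolding that by simp
    finally show ?thesis by (simp only: mult_ac)
  qed
  have alg2: "F * (h * ((w - a * v) + c * (a * w - W * v))) + - (I * F) * (h * (v + c * w)) = - a * (F * F) * (E * (h * (v - c * w)))"
    if "I * c = 1" "W * c = - I" "E * F = 1" for E F I W a v w h :: complex
  proof -
    have "F * (h * ((w - a * v) + c * (a * w - W * v))) + - (I * F) * (h * (v + c * w)) =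
        F * (h * (w - a * v + c * a * w - (W * c) * v - I * v - (I * c) * w))" by (simp add: algebra_simps)
    also have "\<dots> = - a * F * (h * (v - c * w))" unfolding that by (simp add: algebra_simps)
    also have "\<dots> = - a * (F * (E * F)) * (h * (v - c * w))" unfolding that by simp
    finally show ?thesis by (simp only: mult_ac)
  qed
  note vw = ac_vw[OF assms]
  show "ac_primitive l r (A u p) (\<lambda>t. - of_real (\<alpha> t) * (e t * e t) * B u p t)"
    unfolding A_def[abs_def] B_def c_def[symmetric]
    by (rule ac_primitive_cong[OF ac_primitive_mult[OF ac_e ac_primitive_cmult[OF ac_primitive_diff[OF vw(1) ac_primitive_cmult[OF vw(2), of c]], of "1/2"]]])
      (simp, intro AE_I2 impI alg1[symmetric] c ef)
  show "ac_primitive l r (B u p) (\<lambda>t. - of_real (\<alpha> t) * (f t * f t) * A u p t)"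
    unfolding B_def[abs_def] A_def c_def[symmetric]
    by (rule ac_primitive_cong[OF ac_primitive_mult[OF ac_f ac_primitive_cmult[OF ac_primitive_add[OF vw(1) ac_primitive_cmult[OF vw(2), of c]], of "1/2"]]])
      (simp, intro AE_I2 impI alg2[symmetric] c ef)
qed

lemma cancel_ef: "f t * (e t * x) = x" "e t * (f t * x) = x"
proof -
  have "f t * (e t * x) = (e t * f t) * x" "e t * (f t * x) = (e t * f t) * x" by (simp_all only: mult_ac)
  then show "f t * (e t * x) = x" "e t * (f t * x) = x" by (simp_all only: ef(1) mult_1_left)
qed

lemma cancel_\<sigma>\<tau>:
  assumes "t \<in> {l..r}"
  shows "of_real (\<tau> t) * (of_real (\<sigma> t) * x) = (x :: complex)" "of_real (\<sigma> t) * (of_real (\<tau> t) * x) = (x :: complex)"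
proof -
  have "of_real (\<tau> t) * (of_real (\<sigma> t) * x) = of_real (\<sigma> t * \<tau> t) * x"
    "of_real (\<sigma> t) * (of_real (\<tau> t) * x) = of_real (\<sigma> t * \<tau> t) * x" for x :: complex
    by (simp_all only: of_real_mult mult_ac)
  then show "of_real (\<tau> t) * (of_real (\<sigma> t) * x) = x" "of_real (\<sigma> t) * (of_real (\<tau> t) * x) = x"
    by (simp_all only: \<sigma>\<tau>(2)[OF assms] of_real_1 mult_1_left)
qed

lemma u_p_from_AB:
  assumes t: "t \<in> {l..r}"
  shows "u t = of_real (\<tau> t) * (f t * A u p t + e t * B u p t)"
    "p t = of_real (\<sigma> t) * (\<i> * of_real \<omega> * (e t * B u p t - f t * A u p t))"
proof -
  have fA: "f t * A u p t = 1/2 * (of_real (\<sigma> t) * u t - 1 / (\<i> * of_real \<omega>) * (of_real (\<tau> t) * p t))"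
    unfolding A_def by (rule cancel_ef)
  have eB: "e t * B u p t = 1/2 * (of_real (\<sigma> t) * u t + 1 / (\<i> * of_real \<omega>) * (of_real (\<tau> t) * p t))"
    unfolding B_def by (rule cancel_ef)
  have half: "1/2 * (x - y) + 1/2 * (x + y) = x" "1/2 * (x + y) - 1/2 * (x - y) = y" for x y :: complex
    by (simp_all add: field_simps)
  show "u t = of_real (\<tau> t) * (f t * A u p t + e t * B u p t)"
    unfolding fA eB half cancel_\<sigma>\<tau>[OF t] ..
  have "\<i> * of_real \<omega> * (1 / (\<i> * of_real \<omega>) * x) = x" for x using \<omega> by simp
  then show "p t = of_real (\<sigma> t) * (\<i> * of_real \<omega> * (e t * B u p t - f t * A u p t))"
    unfolding fA eB half by (simp only: cancel_\<sigma>\<tau>[OF t])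
qed

lemma parts_from_AB:
  assumes t: "t \<in> {l..r}"
  shows "lpart \<omega> (z t) (u t) (p t) = of_real (\<tau> t) * (f t * A u p t)"
    "rpart \<omega> (z t) (u t) (p t) = of_real (\<tau> t) * (e t * B u p t)"
proof -
  have "z t = \<sigma> t * \<sigma> t" using \<sigma>\<tau>(1)[OF t] by simp
  then have tz: "1 / z t = \<tau> t * \<tau> t" by (simp add: \<tau>_def \<sigma>_def)
  have pz: "p t / (\<i> * of_real (\<omega> * z t)) = 1 / (\<i> * of_real \<omega>) * (of_real (\<tau> t) * (of_real (\<tau> t) * p t))"
  proof -
    have "p t / (\<i> * of_real (\<omega> * z t)) = 1 / (\<i> * of_real \<omega>) * (of_real (1 / z t) * p t)" by simp
    then show ?thesis unfolding tz by (simp only: of_real_mult mult.assoc)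
  qed
  have half: "(a - b * (T * x)) / 2 = T * (1/2 * (S * a - b * x))" "(a + b * (T * x)) / 2 = T * (1/2 * (S * a + b * x))"
    if "T * (S * a) = a" for a b x S T :: complex
  proof -
    have "T * (1/2 * (S * a - b * x)) = (T * (S * a) - b * (T * x)) / 2"
      "T * (1/2 * (S * a + b * x)) = (T * (S * a) + b * (T * x)) / 2"
      by (simp_all add: algebra_simps add_divide_distrib diff_divide_distrib)
    then show "(a - b * (T * x)) / 2 = T * (1/2 * (S * a - b * x))" "(a + b * (T * x)) / 2 = T * (1/2 * (S * a + b * x))"
      unfolding that by simp_all
  qed
  show "lpart \<omega> (z t) (u t) (p t) = of_real (\<tau> t) * (f t * A u p t)"
    unfolding lpart_def A_def cancel_ef pz by (rule half[OF cancel_\<sigma>\<tau>(1)[OF t]])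
  show "rpart \<omega> (z t) (u t) (p t) = of_real (\<tau> t) * (e t * B u p t)"
    unfolding rpart_def B_def cancel_ef pz by (rule half[OF cancel_\<sigma>\<tau>(1)[OF t]])
qed

text \<open>The values at \<open>r\<close> determine the constants of motion, and these determine
  the solution.\<close>

lemma wave_unique:
  assumes "wave_ac z l r \<omega> u p" "wave_ac z l r \<omega> v q" "u r = v r" "p r = q r" and t: "t \<in> {l..r}"
  shows "u t = v t" "p t = q t"
proof -
  have r: "r \<in> {l..r}" using lr by simp
  have "A u p r = A v q r" "B u p r = B v q r" using assms(3,4) by (simp_all add: A_def B_def)
  then have l: "A u p l = A v q l" "B u p l = B v q l"
    using frame_invariants(1,2)[OF ac_AB[OF assms(1)] r] frame_invariants(1,2)[OF ac_AB[OF assms(2)] r] by simp_all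
  have "A u p t = A v q t" "B u p t = B v q t"
    using frame_invariants(3,4)[OF ac_AB[OF assms(1)] t] frame_invariants(3,4)[OF ac_AB[OF assms(2)] t] l by simp_all
  then show "u t = v t" "p t = q t"
    using u_p_from_AB[OF t, where u = u and p = p] u_p_from_AB[OF t, where u = v and p = q] by simp_all
qed

lemma wave_exists:
  obtains u p where "wave_ac z l r \<omega> u p" "u r = U" "p r = V"
proof -
  have r: "r \<in> {l..r}" using lr by simp
  define Ar where "Ar = A (\<lambda>_. U) (\<lambda>_. V) r"
  define Br where "Br = B (\<lambda>_. U) (\<lambda>_. V) r"
  \<comment> \<open>The values that the frame components must have at \<open>l\<close>, read off
    from the constants of motion at \<open>r\<close>.\<close>
  define c1 where "c1 = cnj (P r) * Ar + Q r * Br"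
  define c2 where "c2 = cnj (Q r) * Ar + P r * Br"
  define a where "a = (\<lambda>t. c1 * P t - c2 * Q t)"
  define b where "b = (\<lambda>t. c2 * cnj (P t) - c1 * cnj (Q t))"
  have ac_a: "ac_primitive l r a (\<lambda>t. - of_real (\<alpha> t) * (e t * e t) * b t)"
    unfolding a_def b_def
    by (rule ac_primitive_cong[OF ac_primitive_diff[OF ac_primitive_cmult[OF ac_P, of c1] ac_primitive_cmult[OF ac_Q, of c2]]])
      (auto simp: algebra_simps)
  have ac_b: "ac_primitive l r b (\<lambda>t. - of_real (\<alpha> t) * (f t * f t) * a t)"
    unfolding a_def b_def
    by (rule ac_primitive_cong[OF ac_primitive_diff[OF ac_primitive_cmult[OF ac_primitive_cnj[OF ac_P], of c2] ac_primitive_cmult[OF ac_primitive_cnj[OF ac_Q], of c1]]])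
      (auto simp: algebra_simps ef)
  define I where "I = \<i> * of_real \<omega>"
  have II: "I * I = - of_real (\<omega>\<^sup>2)" by (simp add: I_def power2_eq_square algebra_simps)
  \<comment> \<open>Leaving the rotating frame: \<open>v\<close> and \<open>w\<close> are going to
    be \<sigma> u and \<tau> p.\<close>
  define v where "v = (\<lambda>t. f t * a t + e t * b t)"
  define w where "w = (\<lambda>t. I * (e t * b t - f t * a t))"
  have cancel: "F * (- A' * (E * E) * X) + Y = - A' * (E * X) + Y" if "E * F = 1" for A' E F X Y :: complex
  proof -
    have "F * (- A' * (E * E) * X) = - A' * (E * F) * (E * X)" by (simp only: minus_mult_left[symmetric] minus_mult_right[symmetric] mult_ac)
    then show ?thesis unfolding that by simp
  qed
  have fa: "ac_primitive l r (\<lambda>t. f t * a t) (\<lambda>t. - of_real (\<alpha> t) * (e t * b t) + - (I * f t) * a t)"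
    by (rule ac_primitive_cong[OF ac_primitive_mult[OF ac_f ac_a]])
      (simp, intro AE_I2 impI, simp only: cancel[OF ef(1)] I_def)
  have eb: "ac_primitive l r (\<lambda>t. e t * b t) (\<lambda>t. - of_real (\<alpha> t) * (f t * a t) + I * e t * b t)"
    by (rule ac_primitive_cong[OF ac_primitive_mult[OF ac_e ac_b]])
      (simp, intro AE_I2 impI, simp only: cancel[OF trans[OF mult.commute ef(1)]] I_def)
  have ac_v: "ac_primitive l r v (\<lambda>t. w t - of_real (\<alpha> t) * v t)"
    unfolding v_def w_def
    by (rule ac_primitive_cong[OF ac_primitive_add[OF fa eb]]) (auto simp: algebra_simps)
  have alg: "I * ((- A' * (F * X) + I * E * Y) - (- A' * (E * Y) + - (I * F) * X)) =
      A' * (I * (E * Y - F * X)) - of_real (\<omega>\<^sup>2) * (F * X + E * Y)" for A' E F X Y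
  proof -
    have "I * ((- A' * (F * X) + I * E * Y) - (- A' * (E * Y) + - (I * F) * X)) =
        A' * (I * (E * Y - F * X)) + (I * I) * (F * X + E * Y)" by (simp add: algebra_simps)
    then show ?thesis unfolding II by simp
  qed
  have ac_w: "ac_primitive l r w (\<lambda>t. of_real (\<alpha> t) * w t - of_real (\<omega>\<^sup>2) * v t)"
    unfolding v_def w_def
    by (rule ac_primitive_cong[OF ac_primitive_cmult[OF ac_primitive_diff[OF eb fa], of I]]) (simp, intro AE_I2 impI alg[symmetric])
  define u where "u = (\<lambda>t. of_real (\<tau> t) * v t)"
  define p where "p = (\<lambda>t. of_real (\<sigma> t) * w t)"
  have "wave_ac z l r \<omega> u p"
    unfolding wave_ac_def
  proof
    have "p t / of_real (z t) = of_real (\<tau> t) * (w t - of_real (\<alpha> t) * v t) + of_real (\<alpha> t * \<tau> t) * v t" if "t \<in> {l..r}" for t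
    proof -
      have "p t / of_real (z t) = of_real (\<sigma> t / z t) * w t" by (simp add: p_def)
      then show ?thesis unfolding \<sigma>\<tau>(6)[OF that] by (simp add: algebra_simps)
    qed
    then show "ac_primitive l r u (\<lambda>x. p x / of_real (z x))"
      unfolding u_def by (intro ac_primitive_cong[OF ac_primitive_mult[OF ac_primitive_of_real[OF ac_\<tau>] ac_v]] AE_I2) auto
    have "- (of_real (\<omega>\<^sup>2 * z t) * u t) = of_real (\<sigma> t) * (of_real (\<alpha> t) * w t - of_real (\<omega>\<^sup>2) * v t) + of_real (- \<alpha> t * \<sigma> t) * w t" if "t \<in> {l..r}" for t
    proof -
      have "of_real (\<omega>\<^sup>2 * z t) * u t = of_real (\<omega>\<^sup>2) * of_real (\<tau> t * z t) * v t" by (simp add: u_def)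
      then show ?thesis unfolding \<sigma>\<tau>(5)[OF that] by (simp add: algebra_simps)
    qed
    then show "ac_primitive l r p (\<lambda>x. - (of_real (\<omega>\<^sup>2 * z x) * u x))"
      unfolding p_def by (intro ac_primitive_cong[OF ac_primitive_mult[OF ac_primitive_of_real[OF ac_\<sigma>] ac_w]] AE_I2) auto
  qed
  moreover have "a r = Ar" "b r = Br"
  proof -
    have "a r = (P r * cnj (P r) - Q r * cnj (Q r)) * Ar" by (simp add: a_def c1_def c2_def algebra_simps)
    then show "a r = Ar" by (simp add: PQ_det[OF r])
    have "b r = (P r * cnj (P r) - Q r * cnj (Q r)) * Br" by (simp add: b_def c1_def c2_def algebra_simps)
    then show "b r = Br" by (simp add: PQ_det[OF r])
  qed
  then have "u r = U" "p r = V"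
    using u_p_from_AB[OF r, where u = "\<lambda>_. U" and p = "\<lambda>_. V"]
    by (simp_all add: u_def p_def v_def w_def I_def Ar_def Br_def)
  ultimately show thesis by (rule that)
qed

end

section \<open>The disk automorphism of one piece\<close>

context wave_piece
begin

definition \<mu> :: complex where "\<mu> = e r * e r"

lemma \<mu>_cnj: "\<mu> * cnj \<mu> = 1" "cnj \<mu> * \<mu> = 1"
proof -
  have "\<mu> * cnj \<mu> = (e r * f r) * (e r * f r)" by (simp add: \<mu>_def ef(2))
  then show "\<mu> * cnj \<mu> = 1" by (simp add: ef(1))
  then show "cnj \<mu> * \<mu> = 1" by (simp only: mult.commute)
qed

text \<open>|P|^2 = 1 + |Q|^2.\<close>

lemma P_r_nonzero: "P r \<noteq> 0"
proof
  assume "P r = 0"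
  then have "- (Q r * cnj (Q r)) = 1" using PQ_det[of r] lr by simp
  then have "- ((norm (Q r))\<^sup>2) = 1" by (metis complex_norm_square of_real_1 of_real_eq_iff of_real_minus)
  then show False using zero_le_power2[of "norm (Q r)"] by linarith
qed

text \<open>In the normal form of the factorization; what the wave equation produces directly is the
  fraction in \<open>transfer_eq\<close>.\<close>

definition transfer :: "complex \<Rightarrow> complex" where
  "transfer \<zeta> = moebius (\<mu> * (cnj (P r) / P r)) (cnj \<mu> * (Q r / cnj (P r))) \<zeta>"

text \<open>For denominator X and numerator Y, the identity |P|^2 - |Q|^2 = 1 gives |X|^2 - |Y|^2 =
  1 - |\<zeta>|^2 > 0. So X does not vanish and the quotient stays in the disk.\<close>

lemma transfer_eq:
  assumes \<zeta>: "norm \<zeta> < 1"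
  shows "transfer \<zeta> = (\<mu> * cnj (P r) * \<zeta> + Q r) / (P r + \<mu> * cnj (Q r) * \<zeta>)"
    "P r + \<mu> * cnj (Q r) * \<zeta> \<noteq> 0" "norm (transfer \<zeta>) < 1"
proof -
  define X where "X = P r + \<mu> * cnj (Q r) * \<zeta>"
  define Y where "Y = \<mu> * cnj (P r) * \<zeta> + Q r"
  have "X * cnj X - Y * cnj Y = (P r * cnj (P r) + (\<mu> * cnj \<mu>) * (Q r * cnj (Q r)) * (\<zeta> * cnj \<zeta>)) - ((\<mu> * cnj \<mu>) * (P r * cnj (P r)) * (\<zeta> * cnj \<zeta>) + Q r * cnj (Q r))"
    by (simp add: X_def Y_def algebra_simps)
  also have "\<dots> = (P r * cnj (P r) - Q r * cnj (Q r)) * (1 - \<zeta> * cnj \<zeta>)"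
    unfolding \<mu>_cnj by (simp add: algebra_simps)
  also have "\<dots> = 1 - \<zeta> * cnj \<zeta>" using PQ_det[of r] lr by simp
  finally have "complex_of_real ((norm X)\<^sup>2 - (norm Y)\<^sup>2) = complex_of_real (1 - (norm \<zeta>)\<^sup>2)"
    by (simp only: complex_norm_square of_real_diff of_real_1)
  then have n: "(norm X)\<^sup>2 - (norm Y)\<^sup>2 = 1 - (norm \<zeta>)\<^sup>2" by (simp only: of_real_eq_iff)
  have "(norm \<zeta>)\<^sup>2 < 1" using \<zeta> by (simp add: power_less_one_iff)
  with n have lt: "(norm Y)\<^sup>2 < (norm X)\<^sup>2" by linarith
  then have nYX: "norm Y < norm X" by (rule power2_less_imp_less) simp
  then have X0: "X \<noteq> 0" by auto
  then show "P r + \<mu> * cnj (Q r) * \<zeta> \<noteq> 0" by (simp add: X_def)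
  have P0: "P r \<noteq> 0" "cnj (P r) \<noteq> 0" using P_r_nonzero by auto
  have "transfer \<zeta> = (\<mu> * cnj (P r) * (\<zeta> + cnj \<mu> * (Q r / cnj (P r)))) / (P r * (1 + \<mu> * (cnj (Q r) / P r) * \<zeta>))"
    by (simp add: transfer_def moebius_def)
  also have "\<mu> * cnj (P r) * (\<zeta> + cnj \<mu> * (Q r / cnj (P r))) = \<mu> * cnj (P r) * \<zeta> + (\<mu> * cnj \<mu>) * Q r"
    using P0 by (simp add: algebra_simps)
  also have "P r * (1 + \<mu> * (cnj (Q r) / P r) * \<zeta>) = X" using P0 by (simp add: X_def algebra_simps)
  finally have T: "transfer \<zeta> = Y / X" by (simp add: \<mu>_cnj Y_def)
  then show "transfer \<zeta> = (\<mu> * cnj (P r) * \<zeta> + Q r) / (P r + \<mu> * cnj (Q r) * \<zeta>)" by (simp add: X_def Y_def)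
  show "norm (transfer \<zeta>) < 1" unfolding T using nYX X0 by (simp add: norm_divide)
qed

end

context wave_piece_nonzero
begin

text \<open>The second claim keeps ratios meaningful: a right going part that is nonzero at the
  right end is nonzero at the left end.\<close>

lemma wave_transfer:
  assumes w: "wave_ac z l r \<omega> u p" and \<zeta>: "norm \<zeta> < 1"
    and ratio: "lpart \<omega> (z r) (u r) (p r) = \<zeta> * rpart \<omega> (z r) (u r) (p r)"
  shows "lpart \<omega> (z l) (u l) (p l) = transfer \<zeta> * rpart \<omega> (z l) (u l) (p l)"
    and "rpart \<omega> (z r) (u r) (p r) \<noteq> 0 \<Longrightarrow> rpart \<omega> (z l) (u l) (p l) \<noteq> 0"
proof -
  have r: "r \<in> {l..r}" and l: "l \<in> {l..r}" using lr by simp_all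
  have \<tau>0: "of_real (\<tau> r) \<noteq> (0::complex)" "of_real (\<tau> l) \<noteq> (0::complex)" using \<sigma>\<tau>(4)[OF r] \<sigma>\<tau>(4)[OF l] by auto
  have e0: "e r \<noteq> 0" using ef(1)[of r] by auto
  have "f r * A u p r = \<zeta> * (e r * B u p r)"
    using ratio \<tau>0(1) unfolding parts_from_AB[OF r] by simp
  then have "e r * (f r * A u p r) = e r * (\<zeta> * (e r * B u p r))" by simp
  moreover have "e r * (f r * A u p r) = A u p r" by (simp only: ef(1) mult.assoc[symmetric] mult_1_left)
  \<comment> \<open>The frame rotates the two components in opposite directions, so their ratio at
    \<open>r\<close> picks up the square of the phase, which is \<mu>.\<close>
  ultimately have Ar: "A u p r = \<mu> * \<zeta> * B u p r" by (simp only: \<mu>_def mult_ac)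
  have Al: "A u p l = (\<mu> * cnj (P r) * \<zeta> + Q r) * B u p r"
    using frame_invariants(1)[OF ac_AB[OF w] r] unfolding Ar by (simp add: algebra_simps)
  have Bl: "B u p l = (P r + \<mu> * cnj (Q r) * \<zeta>) * B u p r"
    using frame_invariants(2)[OF ac_AB[OF w] r] unfolding Ar by (simp add: algebra_simps)
  have "A u p l = transfer \<zeta> * B u p l"
    unfolding Al Bl transfer_eq(1)[OF \<zeta>] using transfer_eq(2)[OF \<zeta>] by simp
  then show "lpart \<omega> (z l) (u l) (p l) = transfer \<zeta> * rpart \<omega> (z l) (u l) (p l)"
    unfolding parts_from_AB[OF l] by (simp add: ef)
  assume "rpart \<omega> (z r) (u r) (p r) \<noteq> 0"
  then have "B u p r \<noteq> 0" unfolding parts_from_AB[OF r] by auto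
  then have "B u p l \<noteq> 0" unfolding Bl using transfer_eq(2)[OF \<zeta>] by simp
  then show "rpart \<omega> (z l) (u l) (p l) \<noteq> 0" unfolding parts_from_AB[OF l] using \<tau>0 by (simp add: ef)
qed

end

section \<open>The wave equation across jumps\<close>

text \<open>Across a jump \<open>u\<close> and \<open>p\<close> keep their values; only the
  coefficient in the two parts changes, from \<open>zp\<close> on the right to \<open>zm\<close> on
  the left.\<close>

lemma jump_transfer:
  fixes u p :: complex
  assumes z: "0 < zm" "0 < zp" and \<zeta>: "norm \<zeta> < 1" and \<omega>: "\<omega> \<noteq> 0"
    and ratio: "lpart \<omega> zp u p = \<zeta> * rpart \<omega> zp u p"
  shows "lpart \<omega> zm u p = moebius 1 (of_real ((zm - zp) / (zm + zp))) \<zeta> * rpart \<omega> zm u p"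
    and "rpart \<omega> zp u p \<noteq> 0 \<Longrightarrow> rpart \<omega> zm u p \<noteq> 0"
    and "norm (moebius 1 (of_real ((zm - zp) / (zm + zp))) \<zeta>) < 1"
proof -
  \<comment> \<open>\<open>u\<close> and \<open>p\<close> are expressed by the right going part on
    the right side; this makes both parts on the left side explicit.\<close>
  define R where "R = rpart \<omega> zp u p"
  define s where "s = zm + zp"
  define d where "d = zm - zp"
  have s0: "s > 0" "\<bar>d\<bar> < s" using z by (auto simp: s_def d_def)
  define q where "q = p / (\<i> * of_real (\<omega> * zp))"
  have ab: "(u - q) / 2 = \<zeta> * R" "(u + q) / 2 = R" using ratio by (simp_all add: lpart_def rpart_def R_def q_def)
  have "u = (u - q) / 2 + (u + q) / 2" by (simp add: add_divide_distrib diff_divide_distrib)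
  then have u: "u = (\<zeta> + 1) * R" unfolding ab by (simp add: algebra_simps)
  have "q = (u + q) / 2 - (u - q) / 2" by (simp add: add_divide_distrib diff_divide_distrib)
  then have q: "q = (1 - \<zeta>) * R" unfolding ab by (simp add: algebra_simps)
  have pq: "p / (\<i> * of_real \<omega>) = of_real zp * ((1 - \<zeta>) * R)"
    unfolding q[symmetric] q_def using z(2) by simp
  have pm: "p / (\<i> * of_real (\<omega> * zm)) = of_real (zp / zm) * ((1 - \<zeta>) * R)"
  proof -
    have "p / (\<i> * of_real (\<omega> * zm)) = p / (\<i> * of_real \<omega>) / of_real zm" by simp
    then show ?thesis unfolding pq by simp
  qed
  have L: "lpart \<omega> zm u p = of_real (1 / (2 * zm)) * (of_real s * \<zeta> + of_real d) * R"
    unfolding lpart_def u pm using z by (simp add: s_def d_def field_simps)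
  have Rm: "rpart \<omega> zm u p = of_real (1 / (2 * zm)) * (of_real s + of_real d * \<zeta>) * R"
    unfolding rpart_def u pm using z by (simp add: s_def d_def field_simps)
  define X where "X = of_real s + of_real d * \<zeta>"
  define Y where "Y = of_real s * \<zeta> + of_real d"
  \<comment> \<open>The same invariant form as within a piece, now up to the factor s^2 - d^2 = 4 zm
    zp > 0.\<close>
  have "X * cnj X - Y * cnj Y = of_real (s * s - d * d) * (1 - \<zeta> * cnj \<zeta>)"
    by (simp add: X_def Y_def algebra_simps)
  then have "complex_of_real ((norm X)\<^sup>2 - (norm Y)\<^sup>2) = complex_of_real ((s * s - d * d) * (1 - (norm \<zeta>)\<^sup>2))"
    by (simp only: complex_norm_square of_real_diff of_real_mult of_real_1)
  then have n: "(norm X)\<^sup>2 - (norm Y)\<^sup>2 = (s * s - d * d) * (1 - (norm \<zeta>)\<^sup>2)" by (simp only: of_real_eq_iff)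
  have "(norm \<zeta>)\<^sup>2 < 1" using \<zeta> by (simp add: power_less_one_iff)
  moreover have "s * s - d * d = 4 * zm * zp" by (simp add: s_def d_def algebra_simps)
  ultimately have "0 < (s * s - d * d) * (1 - (norm \<zeta>)\<^sup>2)" using z by simp
  with n have "(norm Y)\<^sup>2 < (norm X)\<^sup>2" by linarith
  then have nYX: "norm Y < norm X" by (rule power2_less_imp_less) simp
  then have X0: "X \<noteq> 0" by auto
  have "moebius 1 (of_real (d / s)) \<zeta> = (of_real s * (\<zeta> + of_real (d / s))) / (of_real s * (1 + of_real (d / s) * \<zeta>))"
    using s0 by (simp add: moebius_def)
  also have "\<dots> = Y / X" using s0 by (simp add: X_def Y_def algebra_simps)
  finally have T: "moebius 1 (of_real ((zm - zp) / (zm + zp))) \<zeta> = Y / X" by (simp add: s_def d_def)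
  show "lpart \<omega> zm u p = moebius 1 (of_real ((zm - zp) / (zm + zp))) \<zeta> * rpart \<omega> zm u p"
    unfolding T L Rm X_def[symmetric] Y_def[symmetric] using X0 by simp
  show "norm (moebius 1 (of_real ((zm - zp) / (zm + zp))) \<zeta>) < 1" unfolding T using nYX X0 by (simp add: norm_divide)
  assume "rpart \<omega> zp u p \<noteq> 0"
  then show "rpart \<omega> zm u p \<noteq> 0" unfolding Rm X_def[symmetric] using X0 z by (simp add: R_def)
qed

text \<open>The coefficient may change at the end points. This is needed because the extension of
  \<zeta> to a closed piece agrees with \<zeta> only inside.\<close>

lemma wave_ac_cong:
  assumes w: "wave_ac z a b \<omega> u p" and uv: "\<And>x. a \<le> x \<Longrightarrow> x \<le> b \<Longrightarrow> v x = u x" and pq: "\<And>x. a \<le> x \<Longrightarrow> x \<le> b \<Longrightarrow> q x = p x"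
    and z: "\<And>x. a < x \<Longrightarrow> x < b \<Longrightarrow> z' x = z x"
  shows "wave_ac z' a b \<omega> v q"
proof -
  have "ac_primitive a b v (\<lambda>x. q x / of_real (z' x))"
    by (rule ac_primitive_cong[OF conjunct1[OF w[unfolded wave_ac_def]] uv])
      (simp, simp, intro AE_I2 impI, simp add: pq z)
  moreover have "ac_primitive a b q (\<lambda>x. - (of_real (\<omega>\<^sup>2 * z' x) * v x))"
    by (rule ac_primitive_cong[OF conjunct2[OF w[unfolded wave_ac_def]] pq])
      (simp, simp, intro AE_I2 impI, simp add: uv z)
  ultimately show ?thesis by (simp add: wave_ac_def)
qed

lemma wave_ac_scale:
  assumes w: "wave_ac z a b \<omega> u p"
  shows "wave_ac z a b \<omega> (\<lambda>x. c * u x) (\<lambda>x. c * p x)"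
proof -
  have "ac_primitive a b (\<lambda>x. c * u x) (\<lambda>x. c * p x / of_real (z x))"
    using ac_primitive_cmult[OF conjunct1[OF w[unfolded wave_ac_def]], of c] by simp
  moreover have "ac_primitive a b (\<lambda>x. c * p x) (\<lambda>x. - (of_real (\<omega>\<^sup>2 * z x) * (c * u x)))"
    by (rule ac_primitive_cong[OF ac_primitive_cmult[OF conjunct2[OF w[unfolded wave_ac_def]], of c]])
      (simp, intro AE_I2 impI, simp)
  ultimately show ?thesis by (simp add: wave_ac_def)
qed

lemma wave_ac_subinterval: "wave_ac z a b \<omega> u p \<Longrightarrow> a \<le> c \<Longrightarrow> d \<le> b \<Longrightarrow> wave_ac z c d \<omega> u p"
  unfolding wave_ac_def by (blast intro: ac_primitive_subinterval)

lemma wave_ac_join: "wave_ac z a b \<omega> u p \<Longrightarrow> wave_ac z b c \<omega> u p \<Longrightarrow> a \<le> b \<Longrightarrow> b \<le> c \<Longrightarrow> wave_ac z a c \<omega> u p"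
  unfolding wave_ac_def by (blast intro: ac_primitive_join)

lemma lrpart_scale: "lpart \<omega> z (c * u) (c * p) = c * lpart \<omega> z u p" "rpart \<omega> z (c * u) (c * p) = c * rpart \<omega> z u p"
  by (simp_all add: lpart_def rpart_def algebra_simps)

lemma tendsto_lrpart:
  assumes "(\<zeta> \<longlongrightarrow> Z) F" "Z \<noteq> 0" "\<omega> \<noteq> 0" "(u \<longlongrightarrow> U) F" "(p \<longlongrightarrow> V) F"
  shows "((\<lambda>x. lpart \<omega> (\<zeta> x) (u x) (p x)) \<longlongrightarrow> lpart \<omega> Z U V) F"
    "((\<lambda>x. rpart \<omega> (\<zeta> x) (u x) (p x)) \<longlongrightarrow> rpart \<omega> Z U V) F"
  unfolding lpart_def rpart_def using assms by (auto intro!: tendsto_intros)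

text \<open>Starting data for shooting from the right end.\<close>

lemma lrpart_terminal:
  assumes "\<omega> \<noteq> 0" "z \<noteq> 0"
  shows "lpart \<omega> z ((\<xi> + 1) * c) (\<i> * of_real (\<omega> * z) * ((1 - \<xi>) * c)) = \<xi> * c"
    "rpart \<omega> z ((\<xi> + 1) * c) (\<i> * of_real (\<omega> * z) * ((1 - \<xi>) * c)) = c"
  using assms by (simp_all add: lpart_def rpart_def field_simps)

lemma lrpart_inverse:
  assumes "\<omega> \<noteq> 0" "z \<noteq> 0"
  shows "u = lpart \<omega> z u p + rpart \<omega> z u p" "p = \<i> * of_real (\<omega> * z) * (rpart \<omega> z u p - lpart \<omega> z u p)"
proof -
  define q where "q = p / (\<i> * of_real (\<omega> * z))"
  have "(u + q) / 2 - (u - q) / 2 = q" "(u - q) / 2 + (u + q) / 2 = u" by (simp_all add: field_simps)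
  then have "rpart \<omega> z u p - lpart \<omega> z u p = q" "lpart \<omega> z u p + rpart \<omega> z u p = u"
    by (simp_all only: lpart_def rpart_def q_def)
  then show "u = lpart \<omega> z u p + rpart \<omega> z u p" "p = \<i> * of_real (\<omega> * z) * (rpart \<omega> z u p - lpart \<omega> z u p)"
    using assms by (simp_all add: q_def)
qed

text \<open>Piece \<open>j\<close> runs from \<open>y j\<close> to \<open>y (Suc j)\<close>, so
  pieces are numbered from 0, one less than in the factorization. \<open>g j\<close> is the
  continuous extension of \<zeta> to the closed piece; its end values are one-sided limits,
  independent of the values of \<zeta> at the jumps themselves. One derivative and one lower bound
  serve all pieces.\<close>

locale wave_chain =
  fixes n :: nat and y :: "nat \<Rightarrow> real" and \<zeta> \<zeta>' :: "real \<Rightarrow> real" and g :: "nat \<Rightarrow> real \<Rightarrow> real" and \<epsilon> :: real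
  assumes y: "\<And>j. j \<le> n \<Longrightarrow> y j < y (Suc j)" and \<epsilon>: "0 < \<epsilon>"
    and g: "\<And>j. j \<le> n \<Longrightarrow> ac_primitive (y j) (y (Suc j)) (g j) \<zeta>'"
    and g\<zeta>: "\<And>j x. j \<le> n \<Longrightarrow> y j < x \<Longrightarrow> x < y (Suc j) \<Longrightarrow> g j x = \<zeta> x"
    and g_ge: "\<And>j x. j \<le> n \<Longrightarrow> x \<in> {y j..y (Suc j)} \<Longrightarrow> \<epsilon> \<le> g j x"
    and \<zeta>_pos: "\<And>x. y 0 < x \<Longrightarrow> x < y (Suc n) \<Longrightarrow> 0 < \<zeta> x"
begin

lemma piece: "j \<le> n \<Longrightarrow> wave_piece (y j) (y (Suc j)) \<epsilon> (g j) \<zeta>'"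
  by unfold_locales (use y \<epsilon> g g_ge in auto)

lemma piece_nonzero: "j \<le> n \<Longrightarrow> \<omega> \<noteq> 0 \<Longrightarrow> wave_piece_nonzero (y j) (y (Suc j)) \<epsilon> \<omega> (g j) \<zeta>'"
  unfolding wave_piece_nonzero_def wave_piece_nonzero_axioms_def using piece by blast

definition T :: "real \<Rightarrow> nat \<Rightarrow> complex \<Rightarrow> complex" where
  "T \<omega> j = wave_piece.transfer (y j) (y (Suc j)) \<omega> (g j) \<zeta>'"

definition jump :: "nat \<Rightarrow> real" where
  "jump j = (g (j - 1) (y j) - g j (y j)) / (g (j - 1) (y j) + g j (y j))"

text \<open>\<open>j - 1\<close> is the piece to the left of jump \<open>j\<close>. The factor of
  the last piece has no jump behind it and is left to the argument \<open>x\<close>.\<close>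

definition chain :: "real \<Rightarrow> nat list \<Rightarrow> complex \<Rightarrow> complex" where
  "chain \<omega> js x = foldr (\<lambda>j v. T \<omega> (j - 1) (moebius 1 (of_real (jump j)) v)) js x"

lemma y_mono: "i \<le> j \<Longrightarrow> j \<le> Suc n \<Longrightarrow> y i \<le> y j"
proof (induction rule: dec_induct)
  case (step j)
  then show ?case using y[of j] by simp
qed simp

lemma g_pos: "j \<le> n \<Longrightarrow> 0 < g j (y j)" "j \<le> n \<Longrightarrow> 0 < g j (y (Suc j))"
proof -
  assume j: "j \<le> n"
  show "0 < g j (y j)" using g_ge[OF j, of "y j"] y[OF j] \<epsilon> by simp
  show "0 < g j (y (Suc j))" using g_ge[OF j, of "y (Suc j)"] y[OF j] \<epsilon> by simp
qed

text \<open>Appending a piece on the right changes the innermost argument; this is the form needed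
  for induction over the pieces.\<close>

lemma chain_snoc: "chain \<omega> [1..<Suc (Suc k)] x = chain \<omega> [1..<Suc k] (T \<omega> k (moebius 1 (of_real (jump (Suc k))) x))"
  by (simp add: chain_def)

lemma wave_ac_piece:
  assumes w: "wave_ac \<zeta> (y 0) (y (Suc k)) \<omega> u p" and k: "j \<le> k" "k \<le> n"
  shows "wave_ac (g j) (y j) (y (Suc j)) \<omega> u p"
proof (rule wave_ac_cong)
  show "wave_ac \<zeta> (y j) (y (Suc j)) \<omega> u p"
    by (rule wave_ac_subinterval[OF w]) (use k y_mono in auto)
qed (use g\<zeta> k in auto)

text \<open>Induction on the number of pieces with arbitrary ratio \<open>x\<close>. The last piece
  and the jump before it turn \<open>x\<close> into another point of the disk, which is the ratio at
  the right end of a shorter chain.\<close>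

lemma wave_chain_transfer:
  assumes "\<omega> \<noteq> 0" "k \<le> n" "wave_ac \<zeta> (y 0) (y (Suc k)) \<omega> u p" "norm x < 1"
    and "lpart \<omega> (g k (y (Suc k))) (u (y (Suc k))) (p (y (Suc k))) = x * rpart \<omega> (g k (y (Suc k))) (u (y (Suc k))) (p (y (Suc k)))"
  shows "lpart \<omega> (g 0 (y 0)) (u (y 0)) (p (y 0)) = chain \<omega> [1..<Suc k] (T \<omega> k x) * rpart \<omega> (g 0 (y 0)) (u (y 0)) (p (y 0)) \<and>
    (rpart \<omega> (g k (y (Suc k))) (u (y (Suc k))) (p (y (Suc k))) \<noteq> 0 \<longrightarrow> rpart \<omega> (g 0 (y 0)) (u (y 0)) (p (y 0)) \<noteq> 0)"
  using assms(2-5)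
proof (induction k arbitrary: x)
  case 0
  interpret W: wave_piece_nonzero "y 0" "y (Suc 0)" \<epsilon> \<omega> "g 0" \<zeta>' by (rule piece_nonzero[OF 0(1) assms(1)])
  show ?case
    using W.wave_transfer[OF wave_ac_piece[OF 0(2) order.refl 0(1)] 0(3,4)] by (simp add: chain_def T_def)
next
  case (Suc k)
  interpret W: wave_piece_nonzero "y (Suc k)" "y (Suc (Suc k))" \<epsilon> \<omega> "g (Suc k)" \<zeta>' by (rule piece_nonzero[OF Suc.prems(1) assms(1)])
  define v where "v = T \<omega> (Suc k) x"
  note t = W.wave_transfer[OF wave_ac_piece[OF Suc.prems(2) order.refl Suc.prems(1)] Suc.prems(3,4), folded T_def, folded v_def]
  have nv: "norm v < 1" unfolding v_def T_def by (rule W.transfer_eq(3)[OF Suc.prems(3)])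
  have k: "k \<le> n" using Suc.prems(1) by simp
  note jt = jump_transfer[OF g_pos(2)[OF k] g_pos(1)[OF Suc.prems(1)] nv assms(1) t(1)]
  have jmp: "(g k (y (Suc k)) - g (Suc k) (y (Suc k))) / (g k (y (Suc k)) + g (Suc k) (y (Suc k))) = jump (Suc k)" by (simp add: jump_def)
  have w: "wave_ac \<zeta> (y 0) (y (Suc k)) \<omega> u p"
    by (rule wave_ac_subinterval[OF Suc.prems(2)]) (use Suc.prems(1) y_mono in auto)
  from Suc.IH[OF k w jt(3)[unfolded jmp] jt(1)[unfolded jmp]] show ?case
    unfolding chain_snoc v_def[symmetric] using t(2) jt(2) by blast
qed

lemma wave_chain_unique:
  assumes "\<omega> \<noteq> 0" "k \<le> n" "wave_ac \<zeta> (y 0) (y (Suc k)) \<omega> u p" "wave_ac \<zeta> (y 0) (y (Suc k)) \<omega> v q"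
    and "u (y (Suc k)) = v (y (Suc k))" "p (y (Suc k)) = q (y (Suc k))" and "t \<in> {y 0..y (Suc k)}"
  shows "u t = v t \<and> p t = q t"
  using assms(2-7)
proof (induction k)
  case 0
  interpret W: wave_piece_nonzero "y 0" "y (Suc 0)" \<epsilon> \<omega> "g 0" \<zeta>' by (rule piece_nonzero[OF 0(1) assms(1)])
  show ?case
    using W.wave_unique[OF wave_ac_piece[OF 0(2) order.refl 0(1)] wave_ac_piece[OF 0(3) order.refl 0(1)] 0(4,5,6)] by simp
next
  case (Suc k)
  interpret W: wave_piece_nonzero "y (Suc k)" "y (Suc (Suc k))" \<epsilon> \<omega> "g (Suc k)" \<zeta>' by (rule piece_nonzero[OF Suc.prems(1) assms(1)])
  note U = W.wave_unique[OF wave_ac_piece[OF Suc.prems(2) order.refl Suc.prems(1)] wave_ac_piece[OF Suc.prems(3) order.refl Suc.prems(1)] Suc.prems(4,5)]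
  have k: "k \<le> n" using Suc.prems(1) by simp
  have le: "y (Suc k) \<le> y (Suc (Suc k))" using y[OF Suc.prems(1)] by simp
  show ?case
  proof (cases "t \<le> y (Suc k)")
    case True
    have w: "wave_ac \<zeta> (y 0) (y (Suc k)) \<omega> u p" "wave_ac \<zeta> (y 0) (y (Suc k)) \<omega> v q"
      using wave_ac_subinterval[OF Suc.prems(2) order.refl le] wave_ac_subinterval[OF Suc.prems(3) order.refl le] by simp_all
    show ?thesis
      by (rule Suc.IH[OF k w]) (use U[of "y (Suc k)"] le True Suc.prems(6) in auto)
  next
    case False
    then show ?thesis using U[of t] Suc.prems(6) by simp
  qed
qed

text \<open>The rightmost piece is solved first, and its values at the left end become the terminal
  data of the remaining chain. Gluing asks only for agreement of \<open>u\<close> and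
  \<open>p\<close> at the common point.\<close>

lemma wave_chain_exists:
  assumes "\<omega> \<noteq> 0" "k \<le> n"
  shows "\<exists>u p. wave_ac \<zeta> (y 0) (y (Suc k)) \<omega> u p \<and> u (y (Suc k)) = U \<and> p (y (Suc k)) = V"
  using assms(2)
proof (induction k arbitrary: U V)
  case 0
  interpret W: wave_piece_nonzero "y 0" "y (Suc 0)" \<epsilon> \<omega> "g 0" \<zeta>' by (rule piece_nonzero[OF 0 assms(1)])
  obtain u p where "wave_ac (g 0) (y 0) (y (Suc 0)) \<omega> u p" "u (y (Suc 0)) = U" "p (y (Suc 0)) = V"
    by (rule W.wave_exists)
  moreover from this(1) have "wave_ac \<zeta> (y 0) (y (Suc 0)) \<omega> u p"
    by (rule wave_ac_cong) (use g\<zeta> 0 in auto)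
  ultimately show ?case by blast
next
  case (Suc k)
  interpret W: wave_piece_nonzero "y (Suc k)" "y (Suc (Suc k))" \<epsilon> \<omega> "g (Suc k)" \<zeta>' by (rule piece_nonzero[OF Suc.prems(1) assms(1)])
  obtain u2 p2 where 2: "wave_ac (g (Suc k)) (y (Suc k)) (y (Suc (Suc k))) \<omega> u2 p2" "u2 (y (Suc (Suc k))) = U" "p2 (y (Suc (Suc k))) = V"
    by (rule W.wave_exists)
  have k: "k \<le> n" using Suc.prems by simp
  have le: "y 0 \<le> y (Suc k)" "y (Suc k) < y (Suc (Suc k))" using y_mono[of 0 "Suc k"] y[OF Suc.prems(1)] k by auto
  obtain u1 p1 where 1: "wave_ac \<zeta> (y 0) (y (Suc k)) \<omega> u1 p1" "u1 (y (Suc k)) = u2 (y (Suc k))" "p1 (y (Suc k)) = p2 (y (Suc k))"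
    using Suc.IH[OF k, of "u2 (y (Suc k))" "p2 (y (Suc k))"] by blast
  define u where "u = (\<lambda>x. if x \<le> y (Suc k) then u1 x else u2 x)"
  define p where "p = (\<lambda>x. if x \<le> y (Suc k) then p1 x else p2 x)"
  have "wave_ac \<zeta> (y 0) (y (Suc k)) \<omega> u p"
    by (rule wave_ac_cong[OF 1(1)]) (auto simp: u_def p_def)
  moreover have "wave_ac \<zeta> (y (Suc k)) (y (Suc (Suc k))) \<omega> u p"
  proof (rule wave_ac_cong[OF 2(1)])
    fix x assume "y (Suc k) \<le> x"
    then have "x = y (Suc k) \<or> y (Suc k) < x" by auto
    then show "u x = u2 x" "p x = p2 x" using 1(2,3) by (auto simp: u_def p_def)
  qed (use g\<zeta>[OF Suc.prems(1)] in simp)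
  ultimately have "wave_ac \<zeta> (y 0) (y (Suc (Suc k))) \<omega> u p"
    by (rule wave_ac_join) (use le in simp_all)
  moreover have "u (y (Suc (Suc k))) = U" "p (y (Suc (Suc k))) = V" using 2(2,3) le(2) by (simp_all add: u_def p_def)
  ultimately show ?case by blast
qed

lemma \<zeta>_limits: "(\<zeta> \<longlongrightarrow> g 0 (y 0)) (at_right (y 0))" "(\<zeta> \<longlongrightarrow> g n (y (Suc n))) (at_left (y (Suc n)))"
proof -
  have "(g 0 \<longlongrightarrow> g 0 (y 0)) (at_right (y 0))"
    by (rule continuous_on_Icc_at_rightD[OF ac_primitive_continuous_on[OF g] y]) auto
  moreover have "\<forall>\<^sub>F x in at_right (y 0). g 0 x = \<zeta> x"
    using eventually_at_right_real[OF y[of 0]] by (auto elim!: eventually_mono intro: g\<zeta>)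
  ultimately show "(\<zeta> \<longlongrightarrow> g 0 (y 0)) (at_right (y 0))" by (rule Lim_transform_eventually)
  have "(g n \<longlongrightarrow> g n (y (Suc n))) (at_left (y (Suc n)))"
    by (rule continuous_on_Icc_at_leftD[OF ac_primitive_continuous_on[OF g] y]) auto
  moreover have "\<forall>\<^sub>F x in at_left (y (Suc n)). g n x = \<zeta> x"
    using eventually_at_left_real[OF y[of n]] by (auto elim!: eventually_mono intro: g\<zeta>)
  ultimately show "(\<zeta> \<longlongrightarrow> g n (y (Suc n))) (at_left (y (Suc n)))" by (rule Lim_transform_eventually)
qed

lemma y_ends: "y 0 < y (Suc n)"
  using y_mono[of 0 n] y[of n] by simp

section \<open>From the chain of pieces to the reflection coefficient\<close>

lemma parts_eq:
  assumes "y 0 < x" "x < y (Suc n)" "v x = u x" "p x = of_real (\<zeta> x) * u' x"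
  shows "left_part \<omega> u u' x = lpart \<omega> (\<zeta> x) (v x) (p x)" "right_part \<omega> u u' x = rpart \<omega> (\<zeta> x) (v x) (p x)"
  using \<zeta>_pos[OF assms(1,2)] assms(3,4) by (simp_all add: left_part_def right_part_def lpart_def rpart_def)

lemma part_limits:
  assumes w: "wave_ac \<zeta> (y 0) (y (Suc n)) \<omega> v p" and \<omega>: "\<omega> \<noteq> 0"
    and eq: "\<forall>x. y 0 < x \<and> x < y (Suc n) \<longrightarrow> v x = u x \<and> p x = of_real (\<zeta> x) * u' x"
  shows "(left_part \<omega> u u' \<longlongrightarrow> lpart \<omega> (g 0 (y 0)) (v (y 0)) (p (y 0))) (at_right (y 0))"
    "(right_part \<omega> u u' \<longlongrightarrow> rpart \<omega> (g 0 (y 0)) (v (y 0)) (p (y 0))) (at_right (y 0))"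
    "(left_part \<omega> u u' \<longlongrightarrow> lpart \<omega> (g n (y (Suc n))) (v (y (Suc n))) (p (y (Suc n)))) (at_left (y (Suc n)))"
    "(right_part \<omega> u u' \<longlongrightarrow> rpart \<omega> (g n (y (Suc n))) (v (y (Suc n))) (p (y (Suc n)))) (at_left (y (Suc n)))"
proof -
  have c: "continuous_on {y 0..y (Suc n)} v" "continuous_on {y 0..y (Suc n)} p"
    using w by (auto simp: wave_ac_def intro: ac_primitive_continuous_on)
  note R = tendsto_lrpart[OF \<zeta>_limits(1) _ \<omega> continuous_on_Icc_at_rightD[OF c(1) y_ends] continuous_on_Icc_at_rightD[OF c(2) y_ends]]
  note L = tendsto_lrpart[OF \<zeta>_limits(2) _ \<omega> continuous_on_Icc_at_leftD[OF c(1) y_ends] continuous_on_Icc_at_leftD[OF c(2) y_ends]]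
  have nz: "g 0 (y 0) \<noteq> 0" "g n (y (Suc n)) \<noteq> 0" using g_pos(1)[of 0] g_pos(2)[of n] by auto
  have ev: "\<forall>\<^sub>F x in at_right (y 0). y 0 < x \<and> x < y (Suc n)" "\<forall>\<^sub>F x in at_left (y (Suc n)). y 0 < x \<and> x < y (Suc n)"
    using eventually_at_right_real[OF y_ends] eventually_at_left_real[OF y_ends] by (auto elim: eventually_mono)
  have pe: "lpart \<omega> (\<zeta> x) (v x) (p x) = left_part \<omega> u u' x" "rpart \<omega> (\<zeta> x) (v x) (p x) = right_part \<omega> u u' x" if "y 0 < x \<and> x < y (Suc n)" for x
    using parts_eq[of x v u p u' \<omega>] eq[rule_format, OF that] that by auto
  show "(left_part \<omega> u u' \<longlongrightarrow> lpart \<omega> (g 0 (y 0)) (v (y 0)) (p (y 0))) (at_right (y 0))"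
    by (rule Lim_transform_eventually[OF R(1)[OF nz(1)] eventually_mono[OF ev(1) pe(1)]])
  show "(right_part \<omega> u u' \<longlongrightarrow> rpart \<omega> (g 0 (y 0)) (v (y 0)) (p (y 0))) (at_right (y 0))"
    by (rule Lim_transform_eventually[OF R(2)[OF nz(1)] eventually_mono[OF ev(1) pe(2)]])
  show "(left_part \<omega> u u' \<longlongrightarrow> lpart \<omega> (g n (y (Suc n))) (v (y (Suc n))) (p (y (Suc n)))) (at_left (y (Suc n)))"
    by (rule Lim_transform_eventually[OF L(1)[OF nz(2)] eventually_mono[OF ev(2) pe(1)]])
  show "(right_part \<omega> u u' \<longlongrightarrow> rpart \<omega> (g n (y (Suc n))) (v (y (Suc n))) (p (y (Suc n)))) (at_left (y (Suc n)))"
    by (rule Lim_transform_eventually[OF L(2)[OF nz(2)] eventually_mono[OF ev(2) pe(2)]])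
qed

text \<open>\<open>wave_solution\<close> lives on the open interval and uses the derivative of
  \<open>u\<close>; \<open>wave_ac\<close> lives on the closed one and uses the flux. Absolute
  continuity provides the extension to the end points.\<close>

lemma wave_solution_iff:
  "wave_solution \<zeta> (y 0) (y (Suc n)) \<omega> u u' \<longleftrightarrow>
    (\<exists>v p. wave_ac \<zeta> (y 0) (y (Suc n)) \<omega> v p \<and> (\<forall>x. y 0 < x \<and> x < y (Suc n) \<longrightarrow> v x = u x \<and> p x = of_real (\<zeta> x) * u' x))"
proof
  assume "wave_solution \<zeta> (y 0) (y (Suc n)) \<omega> u u'"
  then have s: "absolutely_continuous_on {y 0<..<y (Suc n)} u" "absolutely_continuous_on {y 0<..<y (Suc n)} (\<lambda>x. of_real (\<zeta> x) * u' x)"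
    and d: "AE x in lborel. x \<in> {y 0<..<y (Suc n)} \<longrightarrow> (u has_vector_derivative u' x) (at x)"
      "AE x in lborel. x \<in> {y 0<..<y (Suc n)} \<longrightarrow> ((\<lambda>t. of_real (\<zeta> t) * u' t) has_vector_derivative - (of_real (\<omega>\<^sup>2 * \<zeta> x) * u x)) (at x)"
    by (simp_all only: wave_solution_def)
  obtain v where v: "absolutely_continuous_on {y 0..y (Suc n)} v" "\<And>x. x \<in> {y 0<..<y (Suc n)} \<Longrightarrow> v x = u x"
    using absolutely_continuous_on_extend[OF y_ends s(1)] by blast
  obtain p where p: "absolutely_continuous_on {y 0..y (Suc n)} p" "\<And>x. x \<in> {y 0<..<y (Suc n)} \<Longrightarrow> p x = of_real (\<zeta> x) * u' x"
    using absolutely_continuous_on_extend[OF y_ends s(2)] by blast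
  have "AE x in lborel. y 0 < x \<and> x < y (Suc n) \<longrightarrow> (v has_vector_derivative p x / of_real (\<zeta> x)) (at x)"
    using d(1)
  proof eventually_elim
    case (elim x)
    show ?case
    proof
      assume x: "y 0 < x \<and> x < y (Suc n)"
      then have "(u has_vector_derivative p x / of_real (\<zeta> x)) (at x)" using elim p(2)[of x] \<zeta>_pos[of x] by simp
      then show "(v has_vector_derivative p x / of_real (\<zeta> x)) (at x)"
        by (rule has_vector_derivative_transform_within_open[of _ _ _ "{y 0<..<y (Suc n)}"]) (use x v(2) in auto)
    qed
  qed
  moreover have "AE x in lborel. y 0 < x \<and> x < y (Suc n) \<longrightarrow> (p has_vector_derivative - (of_real (\<omega>\<^sup>2 * \<zeta> x) * v x)) (at x)"
    using d(2)
  proof eventually_elim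
    case (elim x)
    show ?case
    proof
      assume x: "y 0 < x \<and> x < y (Suc n)"
      then have "((\<lambda>t. of_real (\<zeta> t) * u' t) has_vector_derivative - (of_real (\<omega>\<^sup>2 * \<zeta> x) * v x)) (at x)" using elim v(2)[of x] by simp
      then show "(p has_vector_derivative - (of_real (\<omega>\<^sup>2 * \<zeta> x) * v x)) (at x)"
        by (rule has_vector_derivative_transform_within_open[of _ _ _ "{y 0<..<y (Suc n)}"]) (use x p(2) in auto)
    qed
  qed
  ultimately have "wave_ac \<zeta> (y 0) (y (Suc n)) \<omega> v p" using v(1) p(1) by (simp only: wave_ac_def ac_primitive_def)
  then show "\<exists>v p. wave_ac \<zeta> (y 0) (y (Suc n)) \<omega> v p \<and> (\<forall>x. y 0 < x \<and> x < y (Suc n) \<longrightarrow> v x = u x \<and> p x = of_real (\<zeta> x) * u' x)"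
    using v(2) p(2) by (intro exI[of _ v] exI[of _ p]) simp
next
  assume "\<exists>v p. wave_ac \<zeta> (y 0) (y (Suc n)) \<omega> v p \<and> (\<forall>x. y 0 < x \<and> x < y (Suc n) \<longrightarrow> v x = u x \<and> p x = of_real (\<zeta> x) * u' x)"
  then obtain v p where w: "wave_ac \<zeta> (y 0) (y (Suc n)) \<omega> v p" and eq: "\<And>x. y 0 < x \<and> x < y (Suc n) \<Longrightarrow> v x = u x \<and> p x = of_real (\<zeta> x) * u' x" by blast
  have v: "ac_primitive (y 0) (y (Suc n)) v (\<lambda>x. p x / of_real (\<zeta> x))" and p: "ac_primitive (y 0) (y (Suc n)) p (\<lambda>x. - (of_real (\<omega>\<^sup>2 * \<zeta> x) * v x))"
    using w by (simp_all add: wave_ac_def)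
  have vo: "absolutely_continuous_on {y 0<..<y (Suc n)} v" "absolutely_continuous_on {y 0<..<y (Suc n)} p"
    by (rule absolutely_continuous_on_subset[OF ac_primitiveD(1)[OF v]], force)
      (rule absolutely_continuous_on_subset[OF ac_primitiveD(1)[OF p]], force)
  show "wave_solution \<zeta> (y 0) (y (Suc n)) \<omega> u u'"
    unfolding wave_solution_def
  proof (intro conjI)
    show "absolutely_continuous_on {y 0<..<y (Suc n)} u"
      by (rule absolutely_continuous_on_dominated[OF vo(1) vo(1), of _ 1]) (use eq in force)
    show "absolutely_continuous_on {y 0<..<y (Suc n)} (\<lambda>x. of_real (\<zeta> x) * u' x)"
    proof (rule absolutely_continuous_on_dominated[OF vo(2) vo(2), of _ 1])
      fix a b assume "a \<in> {y 0<..<y (Suc n)}" "b \<in> {y 0<..<y (Suc n)}"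
      then have "of_real (\<zeta> a) * u' a = p a" "of_real (\<zeta> b) * u' b = p b" using eq[of a] eq[of b] by simp_all
      then show "norm (of_real (\<zeta> b) * u' b - of_real (\<zeta> a) * u' a) \<le> 1 * (norm (p b - p a) + norm (p b - p a))" by simp
    qed
    show "AE x in lborel. x \<in> {y 0<..<y (Suc n)} \<longrightarrow> (u has_vector_derivative u' x) (at x)"
      using ac_primitiveD(2)[OF v]
    proof eventually_elim
      case (elim x)
      show ?case
      proof
        assume x: "x \<in> {y 0<..<y (Suc n)}"
        then have "(v has_vector_derivative u' x) (at x)" using elim eq[of x] \<zeta>_pos[of x] by simp
        then show "(u has_vector_derivative u' x) (at x)"
          by (rule has_vector_derivative_transform_within_open[of _ _ _ "{y 0<..<y (Suc n)}"]) (use x eq in auto)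
      qed
    qed
    show "AE x in lborel. x \<in> {y 0<..<y (Suc n)} \<longrightarrow> ((\<lambda>t. of_real (\<zeta> t) * u' t) has_vector_derivative - (of_real (\<omega>\<^sup>2 * \<zeta> x) * u x)) (at x)"
      using ac_primitiveD(2)[OF p]
    proof eventually_elim
      case (elim x)
      show ?case
      proof
        assume x: "x \<in> {y 0<..<y (Suc n)}"
        then have "(p has_vector_derivative - (of_real (\<omega>\<^sup>2 * \<zeta> x) * u x)) (at x)" using elim eq[of x] by simp
        then show "((\<lambda>t. of_real (\<zeta> t) * u' t) has_vector_derivative - (of_real (\<omega>\<^sup>2 * \<zeta> x) * u x)) (at x)"
          by (rule has_vector_derivative_transform_within_open[of _ _ _ "{y 0<..<y (Suc n)}"]) (use x eq in auto)
      qed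
    qed
  qed
qed

lemma reflection_coeff_eq:
  assumes \<omega>: "\<omega> \<noteq> 0" and \<xi>: "norm \<xi> < 1"
  shows "reflection_coeff \<zeta> (y 0) (y (Suc n)) \<omega> \<xi> = chain \<omega> [1..<Suc n] (T \<omega> n \<xi>)"
proof -
  define R where "R = chain \<omega> [1..<Suc n] (T \<omega> n \<xi>)"
  define z1 where "z1 = g n (y (Suc n))"
  have z1: "z1 \<noteq> 0" using g_pos(2)[of n] by (simp add: z1_def)
  \<comment> \<open>Terminal data with ratio \<xi> and right going part 1 at the right end.\<close>
  obtain u0 p0 where w0: "wave_ac \<zeta> (y 0) (y (Suc n)) \<omega> u0 p0" "u0 (y (Suc n)) = \<xi> + 1" "p0 (y (Suc n)) = \<i> * of_real (\<omega> * z1) * (1 - \<xi>)"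
    using wave_chain_exists[OF \<omega> order.refl] by blast
  have e0: "lpart \<omega> z1 (u0 (y (Suc n))) (p0 (y (Suc n))) = \<xi>" "rpart \<omega> z1 (u0 (y (Suc n))) (p0 (y (Suc n))) = 1"
    using lrpart_terminal[OF \<omega> z1, of \<xi> 1] by (simp_all add: w0(2,3))
  define r0 where "r0 = rpart \<omega> (g 0 (y 0)) (u0 (y 0)) (p0 (y 0))"
  have r0: "r0 \<noteq> 0" and l0: "lpart \<omega> (g 0 (y 0)) (u0 (y 0)) (p0 (y 0)) = R * r0"
    using wave_chain_transfer[OF \<omega> order.refl w0(1) \<xi>] e0 unfolding z1_def[symmetric] R_def r0_def by simp_all
  \<comment> \<open>Dividing by \<open>r0\<close>, which is nonzero, moves the normalisation from
    the right end to the left end.\<close>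
  define v where "v = (\<lambda>x. 1 / r0 * u0 x)"
  define p where "p = (\<lambda>x. 1 / r0 * p0 x)"
  define v' where "v' = (\<lambda>x. p x / of_real (\<zeta> x))"
  have w: "wave_ac \<zeta> (y 0) (y (Suc n)) \<omega> v p" unfolding v_def p_def by (rule wave_ac_scale[OF w0(1)])
  have eq: "\<forall>x. y 0 < x \<and> x < y (Suc n) \<longrightarrow> v x = v x \<and> p x = of_real (\<zeta> x) * v' x"
  proof (intro allI impI conjI refl)
    fix x assume "y 0 < x \<and> x < y (Suc n)"
    then have "\<zeta> x \<noteq> 0" using \<zeta>_pos[of x] by simp
    then show "p x = of_real (\<zeta> x) * v' x" by (simp add: v'_def)
  qed
  note lim = part_limits[OF w \<omega> eq]
  have r1: "rpart \<omega> (g 0 (y 0)) (v (y 0)) (p (y 0)) = 1" "lpart \<omega> (g 0 (y 0)) (v (y 0)) (p (y 0)) = R"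
    unfolding v_def p_def lrpart_scale r0_def[symmetric] l0 using r0 by simp_all
  have r2: "rpart \<omega> z1 (v (y (Suc n))) (p (y (Suc n))) = 1 / r0" "lpart \<omega> z1 (v (y (Suc n))) (p (y (Suc n))) = \<xi> * (1 / r0)"
    unfolding v_def p_def lrpart_scale e0 by simp_all
  have sol: "wave_solution \<zeta> (y 0) (y (Suc n)) \<omega> v v'"
    by (rule iffD2[OF wave_solution_iff]) (rule exI[of _ v], rule exI[of _ p], rule conjI[OF w eq])
  have prob: "reflection_problem \<zeta> (y 0) (y (Suc n)) \<omega> \<xi> v v'"
    unfolding reflection_problem_def
  proof (intro conjI sol exI[of _ "1 / r0"])
    show "(right_part \<omega> v v' \<longlongrightarrow> 1) (at_right (y 0))" using lim(2) unfolding r1(1) .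
    show "(right_part \<omega> v v' \<longlongrightarrow> 1 / r0) (at_left (y (Suc n)))" using lim(4) unfolding z1_def[symmetric] r2(1) .
    show "(left_part \<omega> v v' \<longlongrightarrow> \<xi> * (1 / r0)) (at_left (y (Suc n)))" using lim(3) unfolding z1_def[symmetric] r2(2) .
  qed
  \<comment> \<open>The terminal values of any solution are m times those of \<open>u0\<close>. By
    uniqueness it is m \<open>u0\<close> throughout, and the condition at the left end forces m = 1
    / r0.\<close>
  have any: "(\<forall>x\<in>{y 0<..<y (Suc n)}. s x = v x) \<and> (left_part \<omega> s s' \<longlongrightarrow> R) (at_right (y 0))"
    if s: "reflection_problem \<zeta> (y 0) (y (Suc n)) \<omega> \<xi> s s'" for s s'
  proof -
    have ws: "wave_solution \<zeta> (y 0) (y (Suc n)) \<omega> s s'" and s0: "(right_part \<omega> s s' \<longlongrightarrow> 1) (at_right (y 0))"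
      using s by (simp_all add: reflection_problem_def)
    obtain m where m: "(right_part \<omega> s s' \<longlongrightarrow> m) (at_left (y (Suc n)))" "(left_part \<omega> s s' \<longlongrightarrow> \<xi> * m) (at_left (y (Suc n)))"
      using s unfolding reflection_problem_def by blast
    obtain u q where w': "wave_ac \<zeta> (y 0) (y (Suc n)) \<omega> u q"
      and eq': "\<forall>x. y 0 < x \<and> x < y (Suc n) \<longrightarrow> u x = s x \<and> q x = of_real (\<zeta> x) * s' x"
      using iffD1[OF wave_solution_iff ws] by (elim exE conjE) 
    note lim' = part_limits[OF w' \<omega> eq']
    have ntr: "at_right (y 0) \<noteq> bot" "at_left (y (Suc n)) \<noteq> bot" by simp_all
    have ru: "rpart \<omega> (g 0 (y 0)) (u (y 0)) (q (y 0)) = 1" by (rule tendsto_unique[OF ntr(1) lim'(2) s0])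
    have rm: "rpart \<omega> z1 (u (y (Suc n))) (q (y (Suc n))) = m" unfolding z1_def by (rule tendsto_unique[OF ntr(2) lim'(4) m(1)])
    have lm: "lpart \<omega> z1 (u (y (Suc n))) (q (y (Suc n))) = \<xi> * m" unfolding z1_def by (rule tendsto_unique[OF ntr(2) lim'(3) m(2)])
    have uT: "u (y (Suc n)) = m * u0 (y (Suc n))" "q (y (Suc n)) = m * p0 (y (Suc n))"
      using lrpart_inverse[OF \<omega> z1, where u = "u (y (Suc n))" and p = "q (y (Suc n))"] unfolding rm lm w0(2,3) by (simp_all add: algebra_simps)
    have ue: "u t = m * u0 t \<and> q t = m * p0 t" if "t \<in> {y 0..y (Suc n)}" for t
      by (rule wave_chain_unique[OF \<omega> order.refl w' wave_ac_scale[OF w0(1), of m] uT that])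
    then have "u (y 0) = m * u0 (y 0)" "q (y 0) = m * p0 (y 0)" using y_ends by simp_all
    then have "m * r0 = 1" using ru unfolding r0_def by (simp add: lrpart_scale)
    then have m0: "m = 1 / r0" using r0 by (simp add: field_simps)
    have uv: "u t = v t" "q t = p t" if "t \<in> {y 0..y (Suc n)}" for t
      using ue[OF that] by (simp_all add: v_def p_def m0)
    have y0: "y 0 \<in> {y 0..y (Suc n)}" using y_ends by simp
    have "(left_part \<omega> s s' \<longlongrightarrow> R) (at_right (y 0))" using lim'(1) unfolding uv[OF y0] r1(2) .
    moreover have "s x = v x" if "x \<in> {y 0<..<y (Suc n)}" for x
      using uv(1)[of x] eq'[rule_format, of x] that by simp
    ultimately show ?thesis by simp
  qed
  show ?thesis
    unfolding reflection_coeff_def R_def[symmetric]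
  proof (rule the_equality)
    show "\<exists>u u'. reflection_problem \<zeta> (y 0) (y (Suc n)) \<omega> \<xi> u u' \<and>
        (\<forall>v v'. reflection_problem \<zeta> (y 0) (y (Suc n)) \<omega> \<xi> v v' \<longrightarrow> (\<forall>x\<in>{y 0<..<y (Suc n)}. v x = u x)) \<and>
        (left_part \<omega> u u' \<longlongrightarrow> R) (at_right (y 0))"
    proof (rule exI[of _ v], rule exI[of _ v'], intro conjI prob allI impI)
      fix s s' assume "reflection_problem \<zeta> (y 0) (y (Suc n)) \<omega> \<xi> s s'"
      then show "\<forall>x\<in>{y 0<..<y (Suc n)}. s x = v x" by (rule conjunct1[OF any])
    next
      show "(left_part \<omega> v v' \<longlongrightarrow> R) (at_right (y 0))" by (rule conjunct2[OF any[OF prob]])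
    qed
  next
    fix w' assume "\<exists>u u'. reflection_problem \<zeta> (y 0) (y (Suc n)) \<omega> \<xi> u u' \<and>
        (\<forall>v v'. reflection_problem \<zeta> (y 0) (y (Suc n)) \<omega> \<xi> v v' \<longrightarrow> (\<forall>x\<in>{y 0<..<y (Suc n)}. v x = u x)) \<and>
        (left_part \<omega> u u' \<longlongrightarrow> w') (at_right (y 0))"
    then obtain s s' where s: "reflection_problem \<zeta> (y 0) (y (Suc n)) \<omega> \<xi> s s'" "(left_part \<omega> s s' \<longlongrightarrow> w') (at_right (y 0))"
      by blast
    have "(left_part \<omega> s s' \<longlongrightarrow> R) (at_right (y 0))" by (rule conjunct2[OF any[OF s(1)]])
    from tendsto_unique[OF _ s(2) this] show "w' = R" by simp
  qed
qed

end

section \<open>Dependence on the frequency\<close>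

text \<open>\<open>analytic_on\<close> the real axis asks for holomorphy on some neighbourhood of it
  only: the quotients that occur may have poles off the axis.\<close>

definition real_analytic :: "(real \<Rightarrow> complex) \<Rightarrow> bool" where
  "real_analytic F \<longleftrightarrow> (\<exists>h. h analytic_on \<real> \<and> (\<forall>x. h (of_real x) = F x))"

lemma real_analyticI: "h holomorphic_on UNIV \<Longrightarrow> (\<And>x. h (of_real x) = F x) \<Longrightarrow> real_analytic F"
  unfolding real_analytic_def using analytic_on_subset[of h UNIV "\<real>"] by (auto simp: analytic_on_open)

lemma real_analytic_smooth:
  assumes "real_analytic F"
  shows "smooth F"
proof -
  obtain h where h: "h analytic_on \<real>" "\<And>x. h (of_real x) = F x" using assms by (auto simp: real_analytic_def)
  \<comment> \<open>The higher derivatives of the extension, restricted to the axis.\<close>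
  define D where "D = (\<lambda>k x. (deriv ^^ k) h (of_real x :: complex))"
  have "(D k has_vector_derivative D (Suc k) x) (at x)" for k x
  proof -
    have "(deriv ^^ k) h analytic_on \<real>" by (rule analytic_higher_deriv[OF h(1)])
    then have "(deriv ^^ k) h analytic_on {of_real x}" by (rule analytic_on_subset) auto
    then have "((deriv ^^ k) h has_field_derivative deriv ((deriv ^^ k) h) (of_real x)) (at (of_real x))"
      by (rule analytic_derivI)
    from has_vector_derivative_real_field[OF this] show ?thesis by (simp add: D_def)
  qed
  moreover have "D 0 = F" using h(2) by (simp add: D_def fun_eq_iff)
  ultimately show ?thesis unfolding smooth_def by (intro exI[of _ D]) simp
qed

lemma real_analytic_const: "real_analytic (\<lambda>x. c)"
  by (rule real_analyticI[of "\<lambda>_. c"]) auto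

lemma real_analytic_add:
  assumes "real_analytic F" "real_analytic G"
  shows "real_analytic (\<lambda>x. F x + G x)"
proof -
  obtain f where f: "f analytic_on \<real>" "\<And>x. f (of_real x) = F x" using assms(1) by (auto simp: real_analytic_def)
  obtain g where g: "g analytic_on \<real>" "\<And>x. g (of_real x) = G x" using assms(2) by (auto simp: real_analytic_def)
  show ?thesis unfolding real_analytic_def
    using analytic_on_add[OF f(1) g(1)] f(2) g(2) by (intro exI[of _ "\<lambda>z. f z + g z"]) simp
qed

lemma real_analytic_mult:
  assumes "real_analytic F" "real_analytic G"
  shows "real_analytic (\<lambda>x. F x * G x)"
proof -
  obtain f where f: "f analytic_on \<real>" "\<And>x. f (of_real x) = F x" using assms(1) by (auto simp: real_analytic_def)
  obtain g where g: "g analytic_on \<real>" "\<And>x. g (of_real x) = G x" using assms(2) by (auto simp: real_analytic_def)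
  show ?thesis unfolding real_analytic_def
    using analytic_on_mult[OF f(1) g(1)] f(2) g(2) by (intro exI[of _ "\<lambda>z. f z * g z"]) simp
qed

lemma real_analytic_divide:
  assumes "real_analytic F" "real_analytic G" "\<And>x. G x \<noteq> 0"
  shows "real_analytic (\<lambda>x. F x / G x)"
proof -
  obtain f where f: "f analytic_on \<real>" "\<And>x. f (of_real x) = F x" using assms(1) by (auto simp: real_analytic_def)
  obtain g where g: "g analytic_on \<real>" "\<And>x. g (of_real x) = G x" using assms(2) by (auto simp: real_analytic_def)
  have "(\<lambda>z. f z / g z) analytic_on \<real>"
    by (rule analytic_on_divide[OF f(1) g(1)]) (auto elim!: Reals_cases simp: g(2) assms(3))
  then show ?thesis unfolding real_analytic_def using f(2) g(2) by (intro exI[of _ "\<lambda>z. f z / g z"]) simp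
qed

lemma harmonic_exp_real_analytic:
  fixes \<beta> :: "real \<Rightarrow> real"
  assumes "\<beta> absolutely_integrable_on {a..b}" "a \<le> b"
  shows "real_analytic (\<lambda>\<omega>. harmonic_exp a b \<beta> \<omega>)" "real_analytic (\<lambda>\<omega>. cnj (harmonic_exp a b \<beta> \<omega>))"
proof -
  note h = harmonic_exp_complex_holomorphic[OF assms]
  show "real_analytic (\<lambda>\<omega>. harmonic_exp a b \<beta> \<omega>)"
    by (rule real_analyticI[OF h harmonic_exp_complex_of_real[OF assms]])
  have "harmonic_exp_complex a b \<beta> \<circ> uminus holomorphic_on UNIV"
    by (rule holomorphic_on_compose_gen[OF _ h]) (auto intro: holomorphic_intros)
  then show "real_analytic (\<lambda>\<omega>. cnj (harmonic_exp a b \<beta> \<omega>))"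
    by (rule real_analyticI) (simp add: cnj_harmonic_exp[OF assms] harmonic_exp_complex_of_real[OF assms] flip: of_real_minus)
qed

text \<open>Permits computing the logarithmic derivative from \<zeta> in place of its extension,
  which may differ at the end points.\<close>

lemma harmonic_exp_cong:
  assumes "\<And>s. a < s \<Longrightarrow> s < b \<Longrightarrow> \<beta> s = \<gamma> s"
  shows "harmonic_exp a b \<beta> \<omega> = harmonic_exp a b \<gamma> \<omega>"
proof -
  have "harmonic_integrand a b \<beta> z j s = harmonic_integrand a b \<gamma> z j s" for z j s
  proof (cases "s \<in> ordered_simplex a b j")
    case True
    then have "(\<Prod>\<nu>=1..j. \<beta> (s \<nu>)) = (\<Prod>\<nu>=1..j. \<gamma> (s \<nu>))"
      by (intro prod.cong refl assms) (auto dest: ordered_simplexD)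
    then show ?thesis by (simp only: harmonic_integrand_def)
  qed (simp add: harmonic_integrand_def)
  then show ?thesis by (simp add: harmonic_exp_def harmonic_exp_term_eq)
qed

lemma one_plus_mult_ge:
  assumes "\<bar>r\<bar> < 1" "norm a < 1"
  shows "1 - \<bar>r\<bar> \<le> norm (1 + of_real r * a :: complex)"
proof -
  have "norm (of_real r * a) \<le> \<bar>r\<bar> * 1" unfolding norm_mult norm_of_real using assms by (intro mult_left_mono) auto
  moreover have "1 - norm (of_real r * a) \<le> norm (1 + of_real r * a)"
    using norm_diff_ineq[of 1 "of_real r * a"] by simp
  ultimately show ?thesis by simp
qed

text \<open>The difference of the images is (1 - r^2) (a - b) divided by both denominators, each of
  modulus at least 1 - |r|. The constant depends on \<open>r\<close> alone, hence not on the
  frequency.\<close>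

lemma moebius_lipschitz:
  assumes r: "\<bar>r\<bar> < 1" and a: "norm a < 1" and b: "norm b < 1"
  shows "norm (moebius 1 (of_real r) a - moebius 1 (of_real r) b) \<le> 1 / (1 - \<bar>r\<bar>)\<^sup>2 * norm (a - b)"
proof -
  define x where "x = 1 + of_real r * a"
  define y where "y = 1 + of_real r * b"
  have n: "1 - \<bar>r\<bar> \<le> norm x" "1 - \<bar>r\<bar> \<le> norm y" unfolding x_def y_def by (rule one_plus_mult_ge[OF r a], rule one_plus_mult_ge[OF r b])
  have nz: "x \<noteq> 0" "y \<noteq> 0" using n r by auto
  have "moebius 1 (of_real r) a - moebius 1 (of_real r) b = (a + of_real r) / x - (b + of_real r) / y"
    by (simp add: moebius_def x_def y_def)
  also have "\<dots> = ((a + of_real r) * y - (b + of_real r) * x) / (x * y)" using nz by (simp add: diff_frac_eq mult.commute)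
  also have "(a + of_real r) * y - (b + of_real r) * x = of_real (1 - r * r) * (a - b)" by (simp add: x_def y_def algebra_simps)
  finally have "norm (moebius 1 (of_real r) a - moebius 1 (of_real r) b) = \<bar>1 - r * r\<bar> * norm (a - b) / (norm x * norm y)"
    by (simp only: norm_divide norm_mult norm_of_real)
  also have "\<dots> \<le> 1 * norm (a - b) / ((1 - \<bar>r\<bar>) * (1 - \<bar>r\<bar>))"
  proof (intro frac_le mult_right_mono mult_mono n)
    have "r * r \<le> 1" using r by (metis abs_le_square_iff abs_one less_imp_le mult_1 power2_eq_square)
    then show "\<bar>1 - r * r\<bar> \<le> 1" by simp
  qed (use r in auto)
  finally show ?thesis by (simp add: power2_eq_square)
qed

lemma jump_abs_less:
  fixes zm zp :: real
  assumes "0 < zm" "0 < zp"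
  shows "\<bar>(zm - zp) / (zm + zp)\<bar> < 1"
  using assms by (simp add: abs_divide)

lemma moebius_1_norm_less:
  assumes r: "\<bar>r\<bar> < 1" and x: "norm x < 1"
  shows "norm (moebius 1 (of_real r) x) < 1"
proof -
  \<comment> \<open>A fictitious jump from 1 + r to 1 - r has exactly the parameter
    \<open>r\<close>, so the claim is an instance of the one for jumps; \<open>p\<close> is chosen
    to produce the ratio \<open>x\<close>.\<close>
  have r1: "0 < 1 + r" "0 < 1 - r" using r by auto
  have e: "((1 + r) - (1 - r)) / ((1 + r) + (1 - r)) = r" by simp
  define p :: complex where "p = \<i> * of_real (1 * (1 - r)) * ((1 - x) * 1)"
  have "lpart 1 (1 - r) ((x + 1) * 1) p = x * rpart 1 (1 - r) ((x + 1) * 1) p"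
    unfolding p_def using lrpart_terminal[of 1 "1 - r" x 1] r1 by simp
  from jump_transfer(3)[OF r1 x one_neq_zero this] show ?thesis unfolding e .
qed

text \<open>From composed maps to iterated application, the form of \<open>chain\<close>.\<close>

lemma foldr_comp_apply:
  "foldr (\<lambda>j h. a j \<circ> h) js h0 x = foldr (\<lambda>j v. a j v) js (h0 x)"
  by (induction js) auto

section \<open>Transfer maps as functions of the frequency\<close>

context wave_chain
begin

text \<open>The locale of one piece fixes \<omega>, so its P, Q and \<mu> are set up again with the
  frequency as an argument. Referring to \<zeta> rather than to its extensions gives one function
  for all pieces.\<close>

definition log_slope :: "real \<Rightarrow> real" where "log_slope t = - \<zeta>' t / (2 * \<zeta> t)"
definition half_sum :: "real \<Rightarrow> nat \<Rightarrow> complex" where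
  "half_sum \<omega> j = (harmonic_exp (y j) (y (Suc j)) log_slope \<omega> + harmonic_exp (y j) (y (Suc j)) (\<lambda>s. - log_slope s) \<omega>) / 2"
definition half_diff :: "real \<Rightarrow> nat \<Rightarrow> complex" where
  "half_diff \<omega> j = (harmonic_exp (y j) (y (Suc j)) log_slope \<omega> - harmonic_exp (y j) (y (Suc j)) (\<lambda>s. - log_slope s) \<omega>) / 2"
definition phase :: "real \<Rightarrow> nat \<Rightarrow> complex" where
  "phase \<omega> j = exp (2 * \<i> * of_real ((y (Suc j) - y j) * \<omega>))"

lemma log_slope_integrable:
  assumes j: "j \<le> n"
  shows "log_slope absolutely_integrable_on {y j..y (Suc j)}" "(\<lambda>s. - log_slope s) absolutely_integrable_on {y j..y (Suc j)}"
proof -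
  \<comment> \<open>The logarithmic derivative does not involve the frequency, so it can be taken
    from the piece at frequency 1.\<close>
  interpret W: wave_piece "y j" "y (Suc j)" \<epsilon> 1 "g j" \<zeta>' by (rule piece[OF j])
  have eq: "log_slope x = W.\<alpha> x" if "x \<in> {y j..y (Suc j)} - {y j, y (Suc j)}" for x
    using that g\<zeta>[OF j, of x] by (simp add: log_slope_def W.\<alpha>_def)
  show "log_slope absolutely_integrable_on {y j..y (Suc j)}"
    by (rule absolutely_integrable_spike[OF W.\<alpha>_integrable(1), of "{y j, y (Suc j)}"]) (use eq in auto)
  show "(\<lambda>s. - log_slope s) absolutely_integrable_on {y j..y (Suc j)}"
    by (rule absolutely_integrable_spike[OF W.\<alpha>_integrable(2), of "{y j, y (Suc j)}"]) (use eq in auto)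
qed

lemma T_properties:
  assumes j: "j \<le> n"
  shows "T \<omega> j x = moebius (phase \<omega> j * (cnj (half_sum \<omega> j) / half_sum \<omega> j)) (cnj (phase \<omega> j) * (half_diff \<omega> j / cnj (half_sum \<omega> j))) x"
    "norm x < 1 \<Longrightarrow> T \<omega> j x = (phase \<omega> j * cnj (half_sum \<omega> j) * x + half_diff \<omega> j) / (half_sum \<omega> j + phase \<omega> j * cnj (half_diff \<omega> j) * x)"
    "norm x < 1 \<Longrightarrow> half_sum \<omega> j + phase \<omega> j * cnj (half_diff \<omega> j) * x \<noteq> 0" "norm x < 1 \<Longrightarrow> norm (T \<omega> j x) < 1"
    "half_sum \<omega> j * cnj (half_sum \<omega> j) - half_diff \<omega> j * cnj (half_diff \<omega> j) = 1"
proof -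
  interpret W: wave_piece "y j" "y (Suc j)" \<epsilon> \<omega> "g j" \<zeta>' by (rule piece[OF j])
  have eq: "log_slope t = W.\<alpha> t" if "y j < t" "t < y (Suc j)" for t
    using that g\<zeta>[OF j, of t] by (simp add: log_slope_def W.\<alpha>_def)
  have h: "harmonic_exp (y j) (y (Suc j)) log_slope \<omega> = harmonic_exp (y j) (y (Suc j)) W.\<alpha> \<omega>"
    "harmonic_exp (y j) (y (Suc j)) (\<lambda>s. - log_slope s) \<omega> = harmonic_exp (y j) (y (Suc j)) (\<lambda>s. - W.\<alpha> s) \<omega>"
    by (rule harmonic_exp_cong, simp add: eq)+
  have P: "half_sum \<omega> j = W.P (y (Suc j))" and Q: "half_diff \<omega> j = W.Q (y (Suc j))"
    by (simp_all only: half_sum_def half_diff_def W.P_def W.Q_def h)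
  have m: "phase \<omega> j = W.\<mu>" unfolding phase_def W.\<mu>_def W.e2[symmetric] by (simp only: mult.commute[of \<omega>])
  show "T \<omega> j x = moebius (phase \<omega> j * (cnj (half_sum \<omega> j) / half_sum \<omega> j)) (cnj (phase \<omega> j) * (half_diff \<omega> j / cnj (half_sum \<omega> j))) x"
    unfolding P Q m T_def W.transfer_def ..
  show "norm x < 1 \<Longrightarrow> T \<omega> j x = (phase \<omega> j * cnj (half_sum \<omega> j) * x + half_diff \<omega> j) / (half_sum \<omega> j + phase \<omega> j * cnj (half_diff \<omega> j) * x)"
    "norm x < 1 \<Longrightarrow> half_sum \<omega> j + phase \<omega> j * cnj (half_diff \<omega> j) * x \<noteq> 0" "norm x < 1 \<Longrightarrow> norm (T \<omega> j x) < 1"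
    unfolding P Q m T_def by (rule W.transfer_eq; assumption)+
  show "half_sum \<omega> j * cnj (half_sum \<omega> j) - half_diff \<omega> j * cnj (half_diff \<omega> j) = 1"
    unfolding P Q by (rule W.PQ_det) (use W.lr in simp)
qed

lemma norm_phase: "norm (phase \<omega> j) = 1"
  by (simp add: phase_def norm_exp_eq_Re)

lemma real_analytic_parameters:
  assumes j: "j \<le> n"
  shows "real_analytic (\<lambda>\<omega>. half_sum \<omega> j)" "real_analytic (\<lambda>\<omega>. half_diff \<omega> j)" "real_analytic (\<lambda>\<omega>. cnj (half_sum \<omega> j))"
    "real_analytic (\<lambda>\<omega>. cnj (half_diff \<omega> j))" "real_analytic (\<lambda>\<omega>. phase \<omega> j)"
proof -
  have le: "y j \<le> y (Suc j)" using y[OF j] by simp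
  note p = harmonic_exp_real_analytic[OF log_slope_integrable(1)[OF j] le]
  note m = harmonic_exp_real_analytic[OF log_slope_integrable(2)[OF j] le]
  show "real_analytic (\<lambda>\<omega>. half_sum \<omega> j)"
    using real_analytic_mult[OF real_analytic_const[of "1/2"] real_analytic_add[OF p(1) m(1)]] by (simp add: half_sum_def)
  show "real_analytic (\<lambda>\<omega>. cnj (half_sum \<omega> j))"
    using real_analytic_mult[OF real_analytic_const[of "1/2"] real_analytic_add[OF p(2) m(2)]] by (simp add: half_sum_def)
  show "real_analytic (\<lambda>\<omega>. half_diff \<omega> j)"
    using real_analytic_mult[OF real_analytic_const[of "1/2"] real_analytic_add[OF p(1) real_analytic_mult[OF real_analytic_const[of "-1"] m(1)]]] by (simp add: half_diff_def)
  show "real_analytic (\<lambda>\<omega>. cnj (half_diff \<omega> j))"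
    using real_analytic_mult[OF real_analytic_const[of "1/2"] real_analytic_add[OF p(2) real_analytic_mult[OF real_analytic_const[of "-1"] m(2)]]] by (simp add: half_diff_def)
  show "real_analytic (\<lambda>\<omega>. phase \<omega> j)"
    by (rule real_analyticI[of "\<lambda>z. exp (2 * \<i> * (of_real (y (Suc j) - y j) * z))"])
      (auto simp: phase_def intro!: holomorphic_intros)
qed

lemma parameter_limits:
  assumes j: "j \<le> n"
  shows "((\<lambda>\<omega>. half_sum \<omega> j) \<longlongrightarrow> 1) at_infinity" "((\<lambda>\<omega>. half_diff \<omega> j) \<longlongrightarrow> 0) at_infinity"
proof -
  have le: "y j \<le> y (Suc j)" using y[OF j] by simp
  note p = harmonic_exp_tendsto_1[OF log_slope_integrable(1)[OF j] le]
  note m = harmonic_exp_tendsto_1[OF log_slope_integrable(2)[OF j] le]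
  have "((\<lambda>\<omega>. half_sum \<omega> j) \<longlongrightarrow> (1 + 1) / 2) at_infinity" "((\<lambda>\<omega>. half_diff \<omega> j) \<longlongrightarrow> (1 - 1) / 2) at_infinity"
    unfolding half_sum_def half_diff_def by (intro tendsto_divide tendsto_add tendsto_diff p m tendsto_const; simp)+
  then show "((\<lambda>\<omega>. half_sum \<omega> j) \<longlongrightarrow> 1) at_infinity" "((\<lambda>\<omega>. half_diff \<omega> j) \<longlongrightarrow> 0) at_infinity" by simp_all
qed

text \<open>P tends to 1 and Q to 0, so the transfer map approaches multiplication by the phase,
  uniformly on the disk. Uniformity is what allows the argument to vary with \<omega>.\<close>

lemma T_approx:
  fixes a :: "real \<Rightarrow> complex"
  assumes j: "j \<le> n" and a: "\<And>\<omega>. norm (a \<omega>) < 1"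
  shows "((\<lambda>\<omega>. T \<omega> j (a \<omega>) - phase \<omega> j * a \<omega>) \<longlongrightarrow> 0) at_infinity"
proof (rule Lim_null_comparison)
  \<comment> \<open>Bounds numerator and denominator of (m (cnj P - P) x + Q - m^2 cnj Q x^2) / (P +
    m cnj Q x), the difference between the transfer map and multiplication by the phase m, for |x| <
    1 and |m| = 1.\<close>
  define \<delta> where "\<delta> = (\<lambda>\<omega>. (norm (cnj (half_sum \<omega> j) - half_sum \<omega> j) + 2 * norm (half_diff \<omega> j)) / (norm (half_sum \<omega> j) - norm (half_diff \<omega> j)))"
  have "(\<delta> \<longlongrightarrow> (norm (cnj 1 - 1 :: complex) + 2 * norm (0::complex)) / (norm (1::complex) - norm (0::complex))) at_infinity"
    unfolding \<delta>_def by (intro tendsto_divide tendsto_add tendsto_diff tendsto_norm tendsto_mult tendsto_const tendsto_cnj parameter_limits[OF j]) simp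
  then show "(\<delta> \<longlongrightarrow> 0) at_infinity" by simp
  have "norm (T \<omega> j (a \<omega>) - phase \<omega> j * a \<omega>) \<le> \<delta> \<omega>" for \<omega>
  proof -
    define P where "P = half_sum \<omega> j"
    define Q where "Q = half_diff \<omega> j"
    define m where "m = phase \<omega> j"
    define x where "x = a \<omega>"
    have x: "norm x < 1" by (simp add: x_def a)
    have nm: "norm m = 1" by (simp add: m_def norm_phase)
    note t5 = T_properties(5)[OF j, of \<omega>, folded P_def Q_def]
    note t = T_properties(1-4)[OF j, where \<omega> = \<omega> and x = x, folded P_def Q_def m_def]
    have "complex_of_real ((norm P)\<^sup>2 - (norm Q)\<^sup>2) = complex_of_real 1"
      using t5 by (simp only: complex_norm_square of_real_diff of_real_1)
    then have "(norm P)\<^sup>2 - (norm Q)\<^sup>2 = 1" by (simp only: of_real_eq_iff)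
    then have "(norm Q)\<^sup>2 < (norm P)\<^sup>2" by linarith
    then have QP: "norm Q < norm P" by (rule power2_less_imp_less) simp
    define D where "D = P + m * cnj Q * x"
    have D0: "D \<noteq> 0" unfolding D_def by (rule t(3)[OF x])
    have "norm (m * cnj Q * x) \<le> norm Q" using x by (simp add: norm_mult nm mult_left_le)
    then have nD: "norm P - norm Q \<le> norm D" unfolding D_def using norm_diff_ineq[of P "m * cnj Q * x"] by simp
    have "T \<omega> j x - m * x = (m * cnj P * x + Q - m * x * D) / D"
      unfolding t(2)[OF x] D_def[symmetric] using D0 by (simp add: diff_divide_distrib)
    also have "m * cnj P * x + Q - m * x * D = m * (cnj P - P) * x + (Q - m * m * cnj Q * (x * x))"
      by (simp add: D_def algebra_simps)
    finally have "norm (T \<omega> j x - m * x) = norm (m * (cnj P - P) * x + (Q - m * m * cnj Q * (x * x))) / norm D" by (simp only: norm_divide)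
    also have "\<dots> \<le> (norm (cnj P - P) + 2 * norm Q) / (norm P - norm Q)"
    proof (rule frac_le)
      have 1: "norm (m * (cnj P - P) * x) \<le> norm (cnj P - P)" using x by (simp add: norm_mult nm mult_left_le)
      have "norm x * norm x \<le> 1" using x by (intro mult_le_one) auto
      then have 2: "norm (m * m * cnj Q * (x * x)) \<le> norm Q" by (simp add: norm_mult nm mult_left_le)
      have "norm (m * (cnj P - P) * x + (Q - m * m * cnj Q * (x * x))) \<le> norm (m * (cnj P - P) * x) + norm (Q - m * m * cnj Q * (x * x))"
        by (rule norm_triangle_ineq)
      also have "norm (Q - m * m * cnj Q * (x * x)) \<le> norm Q + norm (m * m * cnj Q * (x * x))" by (rule norm_triangle_ineq4)
      finally show "norm (m * (cnj P - P) * x + (Q - m * m * cnj Q * (x * x))) \<le> norm (cnj P - P) + 2 * norm Q"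
        using 1 2 by linarith
    qed (use QP nD in simp_all)
    finally show ?thesis unfolding \<delta>_def P_def Q_def m_def x_def .
  qed
  then show "\<forall>\<^sub>F \<omega> in at_infinity. norm (T \<omega> j (a \<omega>) - phase \<omega> j * a \<omega>) \<le> \<delta> \<omega>" by (simp add: always_eventually)
qed

lemma jump_less_1: "j \<in> {1..n} \<Longrightarrow> \<bar>jump j\<bar> < 1"
  unfolding jump_def using g_pos(2)[of "j - 1"] g_pos(1)[of j] by (intro jump_abs_less) auto

lemma T_real_analytic:
  assumes j: "j \<le> n" and a: "real_analytic a" "\<And>\<omega>. norm (a \<omega>) < 1"
  shows "real_analytic (\<lambda>\<omega>. T \<omega> j (a \<omega>))"
  unfolding T_properties(2)[OF j a(2)]
  by (intro real_analytic_divide real_analytic_add real_analytic_mult real_analytic_parameters[OF j] a(1) T_properties(3)[OF j a(2)])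

lemma chain_norm_less: "set js \<subseteq> {1..n} \<Longrightarrow> norm x < 1 \<Longrightarrow> norm (chain \<omega> js x) < 1"
proof (induction js)
  case (Cons j js)
  then have "j - 1 \<le> n" by auto
  then show ?case using Cons by (auto simp: chain_def intro!: T_properties(4) moebius_1_norm_less jump_less_1)
qed (simp add: chain_def)

text \<open>The argument is a function of the frequency because the factor of the last piece, which
  is inserted there, is one.\<close>

lemma chain_real_analytic:
  assumes "set js \<subseteq> {1..n}" and a: "real_analytic a" "\<And>\<omega>. norm (a \<omega>) < 1"
  shows "real_analytic (\<lambda>\<omega>. chain \<omega> js (a \<omega>))"
  using assms(1)
proof (induction js)
  case (Cons j js)
  define v where "v = (\<lambda>\<omega>. chain \<omega> js (a \<omega>))"
  have v: "real_analytic v" "\<And>\<omega>. norm (v \<omega>) < 1" unfolding v_def using Cons chain_norm_less a(2) by auto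
  have j: "j - 1 \<le> n" "\<bar>jump j\<bar> < 1" using Cons.prems by (auto intro: jump_less_1)
  have nz: "1 + of_real (jump j) * v \<omega> \<noteq> 0" for \<omega> using one_plus_mult_ge[OF j(2) v(2)[of \<omega>]] j(2) by auto
  have "real_analytic (\<lambda>\<omega>. (v \<omega> + of_real (jump j)) / (1 + of_real (jump j) * v \<omega>))"
    by (intro real_analytic_divide real_analytic_add real_analytic_mult real_analytic_const v(1) nz)
  then have "real_analytic (\<lambda>\<omega>. moebius 1 (of_real (jump j)) (v \<omega>))" by (simp add: moebius_def)
  from T_real_analytic[OF j(1) this moebius_1_norm_less[OF j(2) v(2)]]
  show ?case by (simp add: chain_def v_def)
qed (use a in \<open>simp add: chain_def\<close>)

definition leading_chain :: "real \<Rightarrow> nat list \<Rightarrow> complex \<Rightarrow> complex" where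
  "leading_chain \<omega> js x = foldr (\<lambda>j v. phase \<omega> (j - 1) * moebius 1 (of_real (jump j)) v) js x"

lemma leading_chain_norm_less: "set js \<subseteq> {1..n} \<Longrightarrow> norm x < 1 \<Longrightarrow> norm (leading_chain \<omega> js x) < 1"
  by (induction js) (auto simp: leading_chain_def norm_mult norm_phase intro!: moebius_1_norm_less jump_less_1)

text \<open>Two errors per step: replacing the transfer map by its phase, uniformly small on the
  disk, and the error of the inner arguments, which the Moebius map of the jump enlarges at most by
  a fixed factor.\<close>

lemma chain_approx:
  fixes a b :: "real \<Rightarrow> complex"
  assumes "set js \<subseteq> {1..n}" and a: "\<And>\<omega>. norm (a \<omega>) < 1" and b: "\<And>\<omega>. norm (b \<omega>) < 1"
    and ab: "((\<lambda>\<omega>. a \<omega> - b \<omega>) \<longlongrightarrow> 0) at_infinity"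
  shows "((\<lambda>\<omega>. chain \<omega> js (a \<omega>) - leading_chain \<omega> js (b \<omega>)) \<longlongrightarrow> 0) at_infinity"
  using assms(1)
proof (induction js)
  case (Cons j js)
  define v where "v = (\<lambda>\<omega>. chain \<omega> js (a \<omega>))"
  define w where "w = (\<lambda>\<omega>. leading_chain \<omega> js (b \<omega>))"
  have vw: "\<And>\<omega>. norm (v \<omega>) < 1" "\<And>\<omega>. norm (w \<omega>) < 1"
    unfolding v_def w_def using Cons.prems a b by (auto intro!: chain_norm_less leading_chain_norm_less)
  have j: "j - 1 \<le> n" "\<bar>jump j\<bar> < 1" using Cons.prems by (auto intro: jump_less_1)
  define M where "M = moebius 1 (of_real (jump j))"
  have lim: "((\<lambda>\<omega>. v \<omega> - w \<omega>) \<longlongrightarrow> 0) at_infinity" unfolding v_def w_def using Cons by simp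
  have "((\<lambda>\<omega>. 1 / (1 - \<bar>jump j\<bar>)\<^sup>2 * norm (v \<omega> - w \<omega>)) \<longlongrightarrow> 1 / (1 - \<bar>jump j\<bar>)\<^sup>2 * norm (0::complex)) at_infinity"
    by (intro tendsto_mult tendsto_const tendsto_norm lim)
  then have "((\<lambda>\<omega>. 1 / (1 - \<bar>jump j\<bar>)\<^sup>2 * norm (v \<omega> - w \<omega>)) \<longlongrightarrow> 0) at_infinity" by simp
  moreover have "\<forall>\<^sub>F \<omega> in at_infinity. norm (phase \<omega> (j - 1) * (M (v \<omega>) - M (w \<omega>))) \<le> 1 / (1 - \<bar>jump j\<bar>)\<^sup>2 * norm (v \<omega> - w \<omega>)"
    unfolding M_def norm_mult norm_phase mult_1_left
    by (rule always_eventually, rule allI, rule moebius_lipschitz[OF j(2) vw])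
  ultimately have 1: "((\<lambda>\<omega>. phase \<omega> (j - 1) * (M (v \<omega>) - M (w \<omega>))) \<longlongrightarrow> 0) at_infinity"
    by (rule Lim_null_comparison[rotated])
  have 2: "((\<lambda>\<omega>. T \<omega> (j - 1) (M (v \<omega>)) - phase \<omega> (j - 1) * M (v \<omega>)) \<longlongrightarrow> 0) at_infinity"
    unfolding M_def by (rule T_approx[OF j(1) moebius_1_norm_less[OF j(2) vw(1)]])
  have "((\<lambda>\<omega>. (T \<omega> (j - 1) (M (v \<omega>)) - phase \<omega> (j - 1) * M (v \<omega>)) + phase \<omega> (j - 1) * (M (v \<omega>) - M (w \<omega>))) \<longlongrightarrow> 0 + 0) at_infinity"
    by (rule tendsto_add[OF 2 1])
  then have "((\<lambda>\<omega>. T \<omega> (j - 1) (M (v \<omega>)) - phase \<omega> (j - 1) * M (w \<omega>)) \<longlongrightarrow> 0) at_infinity" by (simp add: algebra_simps)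
  then show ?case by (simp add: chain_def leading_chain_def v_def w_def M_def)
qed (use ab in \<open>simp add: chain_def leading_chain_def\<close>)

text \<open>The halves cancel in the quotients; the index moves by one from pieces to
  factors.\<close>

lemma T_eq_moebius:
  assumes j: "j \<le> n" and log_slope: "log_slope = alpha \<zeta>"
  shows "T \<omega> j = moebius (mu_tilde \<zeta> y (Suc j) \<omega>) (rho \<zeta> y (Suc j) \<omega>)"
proof
  fix x
  have half: "s / 2 / (t / 2) = s / t" for s t :: complex by simp
  have m: "mu y (Suc j) \<omega> = phase \<omega> j" by (simp add: mu_def phase_def)
  have P: "half_sum \<omega> j = (E_plus \<zeta> y (Suc j) \<omega> + E_minus \<zeta> y (Suc j) \<omega>) / 2"
    and Q: "half_diff \<omega> j = (E_plus \<zeta> y (Suc j) \<omega> - E_minus \<zeta> y (Suc j) \<omega>) / 2"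
    by (simp_all add: half_sum_def half_diff_def E_plus_def E_minus_def log_slope)
  have 2: "cnj (s / 2) = cnj s / 2" for s by simp
  show "T \<omega> j x = moebius (mu_tilde \<zeta> y (Suc j) \<omega>) (rho \<zeta> y (Suc j) \<omega>) x"
    unfolding T_properties(1)[OF j] P Q 2 half mu_tilde_def rho_def m ..
qed

lemma mu_eq_phase: "j \<in> {1..n} \<Longrightarrow> mu y j \<omega> = phase \<omega> (j - 1)"
  by (simp add: mu_def phase_def)

end

section \<open>Factorization, smoothness and asymptotics\<close>

theorem theorem8:
  fixes x0 x1 :: real and \<zeta> :: "real \<Rightarrow> real" and n :: nat and y :: "nat \<Rightarrow> real"
  assumes "x0 < x1"
    and "\<zeta> \<in> C_pw_plus x0 x1"
    and "no_removable_discontinuities {x0<..<x1} \<zeta>"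
    and "\<zeta> \<notin> C_plus x0 x1"
    and "y 0 = x0" and "y (Suc n) = x1"
    and "strict_mono_on {0..Suc n} y"
    and "y ` {1..n} = {x \<in> {x0<..<x1}. \<not> isCont \<zeta> x}"
  shows
    "(AE \<omega> in lborel. \<forall>\<xi>\<in>ball 0 1.
        reflection_coeff \<zeta> x0 x1 \<omega> \<xi> =
          foldr (\<lambda>j h. moebius (mu_tilde \<zeta> y j \<omega>) (rho \<zeta> y j \<omega>) \<circ>
                       moebius 1 (of_real (jump_coeff \<zeta> (y j))) \<circ> h)
            [1..<Suc n]
            (moebius (mu_tilde \<zeta> y (Suc n) \<omega>) (rho \<zeta> y (Suc n) \<omega>)) \<xi>) \<and>
     (\<forall>\<xi>\<in>ball 0 1. \<exists>G :: real \<Rightarrow> complex.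
        (AE \<omega> in lborel. reflection_coeff \<zeta> x0 x1 \<omega> \<xi> = G \<omega>) \<and>
        smooth G \<and>
        ((\<lambda>\<omega>. G \<omega> -
            foldr (\<lambda>j h. moebius (mu y j \<omega>) (of_real (jump_coeff \<zeta> (y j))) \<circ> h)
              [1..<Suc n] (\<lambda>z. mu y (Suc n) \<omega> * z) \<xi>) \<longlongrightarrow> 0) at_infinity)"
proof -
  have ys: "y i < y j" if "i < j" "j \<le> Suc n" for i j
    by (rule strict_mono_onD[OF assms(7)]) (use that in auto)
  have yle: "y i \<le> y j" if "i \<le> j" "j \<le> Suc n" for i j
    using ys[of i j] that by (cases "i = j") auto
  have yl: "y j < y (Suc j)" "x0 \<le> y j" "y (Suc j) \<le> x1" if "j \<le> n" for j
    using ys[of j "Suc j"] yle[of 0 j] yle[of "Suc j" "Suc n"] assms(5,6) that by auto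
  obtain \<epsilon> where \<epsilon>: "0 < \<epsilon>" "\<And>x. x0 < x \<Longrightarrow> x < x1 \<Longrightarrow> \<epsilon> < \<zeta> x"
    using assms(2) by (auto simp: C_pw_plus_def Reg_plus_def)
  obtain N p where p: "interval_partition x0 x1 N p" "\<And>i. i < N \<Longrightarrow> absolutely_continuous_on {p i<..<p (Suc i)} \<zeta>"
    using assms(2) by (auto simp: C_pw_plus_def)
  \<comment> \<open>A discontinuity strictly inside a piece would be one of the points
    \<open>y k\<close>, against monotonicity.\<close>
  have cont: "continuous_on {y j<..<y (Suc j)} \<zeta>" if j: "j \<le> n" for j
  proof (rule continuous_at_imp_continuous_on, rule ballI, rule ccontr)
    fix x assume x: "x \<in> {y j<..<y (Suc j)}" and "\<not> isCont \<zeta> x"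
    then have "x \<in> y ` {1..n}" unfolding assms(8) using yl[OF j] by auto
    then obtain k where k: "x = y k" "k \<in> {1..n}" by blast
    have "k \<le> j \<or> Suc j \<le> k" by linarith
    then show False
      using yle[of k j] yle[of "Suc j" k] k j x by auto
  qed
  define piece where "piece = (\<lambda>j h. ac_primitive (y j) (y (Suc j)) h (deriv \<zeta>) \<and> (\<forall>x. y j < x \<and> x < y (Suc j) \<longrightarrow> h x = \<zeta> x) \<and>
    (\<zeta> \<longlongrightarrow> h (y j)) (at_right (y j)) \<and> (\<zeta> \<longlongrightarrow> h (y (Suc j))) (at_left (y (Suc j))))"
  have "\<forall>j\<in>{..n}. \<exists>h. piece j h"
  proof
    fix j assume "j \<in> {..n}"
    then have j: "j \<le> n" by simp
    show "\<exists>h. piece j h"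
      by (rule piecewise_absolutely_continuous_extension[OF p yl(2)[OF j] yl(1)[OF j] yl(3)[OF j] cont[OF j]])
        (assumption, rule exI, unfold piece_def, intro conjI allI impI, simp_all)
  qed
  from bchoice[OF this] obtain g where g: "\<forall>j\<in>{..n}. piece j (g j)" by (elim exE)
  have gp: "ac_primitive (y j) (y (Suc j)) (g j) (deriv \<zeta>)" and g\<zeta>: "\<And>x. y j < x \<Longrightarrow> x < y (Suc j) \<Longrightarrow> g j x = \<zeta> x"
    and gl: "(\<zeta> \<longlongrightarrow> g j (y j)) (at_right (y j))" and gr: "(\<zeta> \<longlongrightarrow> g j (y (Suc j))) (at_left (y (Suc j)))" if "j \<le> n" for j
    using bspec[OF g, of j] that by (simp_all add: piece_def)
  \<comment> \<open>The strict bound on \<zeta> becomes weak in the one-sided limits at the end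
    points.\<close>
  have g_ge: "\<epsilon> \<le> g j x" if j: "j \<le> n" and x: "x \<in> {y j..y (Suc j)}" for j x
  proof -
    have "\<forall>\<^sub>F t in at_right (y j). \<epsilon> \<le> \<zeta> t"
      using eventually_at_right_real[OF yl(1)[OF j]]
      by (rule eventually_mono) (use yl[OF j] \<epsilon>(2) in \<open>auto intro!: less_imp_le\<close>)
    then have l: "\<epsilon> \<le> g j (y j)" by (rule tendsto_lowerbound[OF gl[OF j]]) simp
    have "\<forall>\<^sub>F t in at_left (y (Suc j)). \<epsilon> \<le> \<zeta> t"
      using eventually_at_left_real[OF yl(1)[OF j]]
      by (rule eventually_mono) (use yl[OF j] \<epsilon>(2) in \<open>auto intro!: less_imp_le\<close>)
    then have r: "\<epsilon> \<le> g j (y (Suc j))" by (rule tendsto_lowerbound[OF gr[OF j]]) simp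
    consider "x = y j" | "x = y (Suc j)" | "y j < x" "x < y (Suc j)" using x by fastforce
    then show ?thesis
    proof cases
      case 3
      then show ?thesis using g\<zeta>[OF j 3] \<epsilon>(2)[of x] yl[OF j] by simp
    qed (use l r in simp_all)
  qed
  have pos: "0 < \<zeta> x" if "y 0 < x" "x < y (Suc n)" for x using \<epsilon>(1) \<epsilon>(2)[of x] that assms(5,6) by simp
  interpret C: wave_chain n y \<zeta> "deriv \<zeta>" g \<epsilon>
    by (unfold_locales; fact yl(1) \<epsilon>(1) gp g\<zeta> g_ge pos)
  have log_slope: "C.log_slope = alpha \<zeta>" by (simp add: fun_eq_iff C.log_slope_def alpha_def)
  have jump: "jump_coeff \<zeta> (y j) = C.jump j" if j: "j \<in> {1..n}" for j
  proof -
    have s: "Suc (j - 1) = j" and le: "j - 1 \<le> n" "j \<le> n" using j by auto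
    have "Lim (at_left (y j)) \<zeta> = g (j - 1) (y j)" by (rule tendsto_Lim[OF _ gr[OF le(1), unfolded s]]) simp
    moreover have "Lim (at_right (y j)) \<zeta> = g j (y j)" by (rule tendsto_Lim[OF _ gl[OF le(2)]]) simp
    ultimately show ?thesis by (simp only: jump_coeff_def C.jump_def)
  qed
  have refl_eq: "reflection_coeff \<zeta> x0 x1 \<omega> \<xi> = C.chain \<omega> [1..<Suc n] (C.T \<omega> n \<xi>)" if "\<omega> \<noteq> 0" "\<xi> \<in> ball 0 1" for \<omega> \<xi>
    using C.reflection_coeff_eq[of \<omega> \<xi>] that assms(5,6) by simp
  \<comment> \<open>The exceptional set consists of the frequency 0 alone.\<close>
  have nz: "AE \<omega> in lborel. \<omega> \<noteq> (0::real)" by (rule AE_lborel_singleton)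
  have js: "set [1..<Suc n] \<subseteq> {1..n}" by auto
  show ?thesis
  proof (intro conjI ballI)
    show "AE \<omega> in lborel. \<forall>\<xi>\<in>ball 0 1.
        reflection_coeff \<zeta> x0 x1 \<omega> \<xi> =
          foldr (\<lambda>j h. moebius (mu_tilde \<zeta> y j \<omega>) (rho \<zeta> y j \<omega>) \<circ>
                       moebius 1 (of_real (jump_coeff \<zeta> (y j))) \<circ> h)
            [1..<Suc n]
            (moebius (mu_tilde \<zeta> y (Suc n) \<omega>) (rho \<zeta> y (Suc n) \<omega>)) \<xi>"
      using nz
    proof (rule AE_mp, intro AE_I2 impI ballI)
      fix \<omega> :: real and \<xi> :: complex assume w: "\<omega> \<noteq> 0" and x: "\<xi> \<in> ball 0 1"
      have "foldr (\<lambda>j v. (moebius (mu_tilde \<zeta> y j \<omega>) (rho \<zeta> y j \<omega>) \<circ> moebius 1 (of_real (jump_coeff \<zeta> (y j)))) v) [1..<Suc n] v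
          = C.chain \<omega> [1..<Suc n] v" for v
        unfolding C.chain_def
      proof (rule foldr_cong[OF refl refl])
        fix a j assume "j \<in> set [1..<Suc n]"
        then have j: "j \<in> {1..n}" using js by blast
        then have "j - 1 \<le> n" "Suc (j - 1) = j" by auto
        then have "C.T \<omega> (j - 1) = moebius (mu_tilde \<zeta> y j \<omega>) (rho \<zeta> y j \<omega>)"
          using C.T_eq_moebius[OF _ log_slope, of "j - 1" \<omega>] by simp
        then show "(moebius (mu_tilde \<zeta> y j \<omega>) (rho \<zeta> y j \<omega>) \<circ> moebius 1 (of_real (jump_coeff \<zeta> (y j)))) a =
            C.T \<omega> (j - 1) (moebius 1 (of_real (C.jump j)) a)" by (simp add: jump[OF j])
      qed
      then show "reflection_coeff \<zeta> x0 x1 \<omega> \<xi> =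
          foldr (\<lambda>j h. moebius (mu_tilde \<zeta> y j \<omega>) (rho \<zeta> y j \<omega>) \<circ>
                       moebius 1 (of_real (jump_coeff \<zeta> (y j))) \<circ> h)
            [1..<Suc n]
            (moebius (mu_tilde \<zeta> y (Suc n) \<omega>) (rho \<zeta> y (Suc n) \<omega>)) \<xi>"
        unfolding foldr_comp_apply refl_eq[OF w x] C.T_eq_moebius[OF order.refl log_slope] by (rule sym)
    qed
  next
    fix \<xi> :: complex assume x: "\<xi> \<in> ball 0 1"
    then have nx: "norm \<xi> < 1" by simp
    have T1: "norm (C.T \<omega> n \<xi>) < 1" for \<omega> by (rule C.T_properties(4)[OF order.refl nx])
    \<comment> \<open>The chain formula makes sense at every frequency, also at 0, where the
      reflection coefficient is unspecified; it is the smooth representative.\<close>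
    define G where "G = (\<lambda>\<omega>. C.chain \<omega> [1..<Suc n] (C.T \<omega> n \<xi>))"
    have "real_analytic G"
      unfolding G_def
      by (rule C.chain_real_analytic[OF js C.T_real_analytic[OF order.refl real_analytic_const nx] T1])
    then have "smooth G" by (rule real_analytic_smooth)
    moreover have "AE \<omega> in lborel. reflection_coeff \<zeta> x0 x1 \<omega> \<xi> = G \<omega>"
      using nz by (rule AE_mp, intro AE_I2 impI) (simp only: G_def, rule refl_eq[OF _ x])
    moreover have "((\<lambda>\<omega>. G \<omega> - foldr (\<lambda>j h. moebius (mu y j \<omega>) (of_real (jump_coeff \<zeta> (y j))) \<circ> h)
              [1..<Suc n] (\<lambda>z. mu y (Suc n) \<omega> * z) \<xi>) \<longlongrightarrow> 0) at_infinity"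
    proof -
      have m: "mu y (Suc n) \<omega> = C.phase \<omega> n" for \<omega> by (simp add: mu_def C.phase_def)
      have "foldr (\<lambda>j v. moebius (mu y j \<omega>) (of_real (jump_coeff \<zeta> (y j))) v) [1..<Suc n] v = C.leading_chain \<omega> [1..<Suc n] v" for v \<omega>
        unfolding C.leading_chain_def
      proof (rule foldr_cong[OF refl refl])
        fix a j assume "j \<in> set [1..<Suc n]"
        then have j: "j \<in> {1..n}" using js by blast
        \<comment> \<open>The first parameter of a Moebius map is a plain factor, here the phase of
          the piece to the left of the jump.\<close>
        show "moebius (mu y j \<omega>) (of_real (jump_coeff \<zeta> (y j))) a = C.phase \<omega> (j - 1) * moebius 1 (of_real (C.jump j)) a"
          by (simp add: moebius_def jump[OF j] C.mu_eq_phase[OF j])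
      qed
      moreover have "norm (C.phase \<omega> n * \<xi>) < 1" for \<omega> using nx by (simp add: norm_mult C.norm_phase)
      ultimately show ?thesis
        unfolding foldr_comp_apply m G_def
        using C.chain_approx[OF js T1 _ C.T_approx[OF order.refl nx]] by simp
    qed
    ultimately show "\<exists>G :: real \<Rightarrow> complex.
        (AE \<omega> in lborel. reflection_coeff \<zeta> x0 x1 \<omega> \<xi> = G \<omega>) \<and>
        smooth G \<and>
        ((\<lambda>\<omega>. G \<omega> -
            foldr (\<lambda>j h. moebius (mu y j \<omega>) (of_real (jump_coeff \<zeta> (y j))) \<circ> h)
              [1..<Suc n] (\<lambda>z. mu y (Suc n) \<omega> * z) \<xi>) \<longlongrightarrow> 0) at_infinity" by blast
  qed
qed

end
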